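(* Assume the following. (1) The rows of $\mathbf{Z}$ are i.i.d. real or complex random vectors, either standard normal distributed, or distributed as $\sqrt{M}\,\mathbf{u}$ where $\mathbf{u}$ is uniformly (Haar) distributed on the unit sphere in $\mathbb{R}^M$ or $\mathbb{C}^M$. (2) $\mathbf{C}_N=\mathrm{diag}(c_1,\dots,c_N)$ with $c_n\ge0$ (the $c_n$ may depend on $N$), and there exist constants $C>0$, $\kappa>0$ such that $\frac1N\mathrm{tr}\,\mathbf{C}_N^2\le C$ and $\|\mathbf{C}_N\|\le\kappa\log M$. (3) The spectral density $f\in L^1(-\pi,\pi)$ of $\mathbf{R}_M$ is positive and is bounded on $[-\pi,\pi]\setminus(-\delta,\delta)$ for every $\delta>0$. (4) $\operatorname{ess\,inf}_{\theta\in(-\pi,\pi)}f(\theta)>0$. (5) $f$ is even and $f(x)=L(|x|^{-1})/|x|^a$ for $x\in[-\pi,\pi]\setminus\{0\}$, where $a\in(0,1)$ and $L$, defined on $[\pi^{-1},\infty)$, is slowly varying at $\infty$. Suppose that $\xi_N\to1$ as $N\to\infty$. Then as $M\to\infty$ with $N=N(M)\gg\log^3M$, almost surely the empirical spectral distribution of $\mathbf{R}_M^{-1}\hat{\mathbf{R}}_M^b$ converges weakly to the Dirac measure $\delta_1$.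
   Context: For integers $M,N\ge1$, let $\mathbf{X}=\mathbf{C}_N^{1/2}\mathbf{Z}\mathbf{R}_M^{1/2}$, where $\mathbf{C}_N$ is an $N\times N$ deterministic matrix, $\mathbf{Z}$ is an $N\times M$ random matrix (all random matrices being defined on a common probability space), and $\mathbf{R}_M=(r_{i-j})_{i,j=1}^M$ is the Toeplitz matrix with spectral density $f$, i.e. $r_k=\frac{1}{2\pi}\int_{-\pi}^{\pi}f(x)e^{-\mathbf{i}kx}\,dx$. Put $\xi_N=\frac1N\mathrm{tr}\,\mathbf{C}_N$. Let $S_{i,j}$ denote the entries of the $M\times M$ matrix $\frac1N\mathbf{X}^*\mathbf{X}$, and define $$\hat r_k^b=\frac{1}{M}\sum_i S_{i+k,i}\,\mathbf{1}_{\{1\le i,\ i+k\le M\}}\quad(|k|\le M-1),$$ where the sum is over $i$ with both $1\le i\le M$ and $1\le i+k\le M$, and $\hat{\mathbf{R}}_M^b=(\hat r^b_{i-j})_{1\le i,j\le M}$. The empirical spectral distribution of an $M\times M$ matrix with real eigenvalues $\lambda_1,\dots,\lambda_M$ is $\frac1M\sum_{i=1}^M\delta_{\lambda_i}$ (the eigenvalues of $\mathbf{R}_M^{-1}\hat{\mathbf{R}}_M^b$ are those of the Hermitian matrix $\mathbf{R}_M^{-1/2}\hat{\mathbf{R}}_M^b\mathbf{R}_M^{-1/2}$). $\|\cdot\|$ is the operator norm. $a_M\gg b_M$ means $a_M/b_M\to\infty$. *)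

theory Defs
  imports
    "HOL-Probability.Probability"
    "Jordan_Normal_Form.Schur_Decomposition"
    "Jordan_Normal_Form.Gauss_Jordan_Elimination"
    "Jordan_Normal_Form.Char_Poly"
begin

text \<open>
  Matrices have type \<open>complex mat\<close> because their sizes vary within the statement; indices start
  at 0, so entry \<open>(i, j)\<close> of a text-book matrix is entry \<open>(i - 1, j - 1)\<close> here.
\<close>

definition mat_trace :: "complex mat \<Rightarrow> complex" where
  "mat_trace A = (\<Sum>i<dim_row A. A $$ (i, i))"

definition l2_norm_vec :: "complex Matrix.vec \<Rightarrow> real" where
  "l2_norm_vec v = sqrt (\<Sum>i<dim_vec v. (cmod (vec_index v i))\<^sup>2)"

definition op_norm :: "complex mat \<Rightarrow> real" where
  "op_norm A = Sup {l2_norm_vec (A *\<^sub>v v) | v. v \<in> carrier_vec (dim_col A) \<and> l2_norm_vec v = 1}"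

definition pos_semidef :: "complex mat \<Rightarrow> bool" where
  "pos_semidef A \<longleftrightarrow> A \<in> carrier_mat (dim_row A) (dim_row A) \<and> mat_adjoint A = A \<and>
     (\<forall>v \<in> carrier_vec (dim_row A). 0 \<le> Re ((A *\<^sub>v v) \<bullet>c v))"

text \<open>The positive semidefinite square root, for positive semidefinite \<open>A\<close>.\<close>

definition psd_sqrt :: "complex mat \<Rightarrow> complex mat" where
  "psd_sqrt A = (THE B. B \<in> carrier_mat (dim_row A) (dim_row A) \<and> pos_semidef B \<and> B * B = A)"

definition toeplitz :: "nat \<Rightarrow> (int \<Rightarrow> complex) \<Rightarrow> complex mat" where
  "toeplitz n r = Matrix.mat n n (\<lambda>(i, j). r (int i - int j))"

text \<open>
  For \<open>n \<ge> 1\<close> the multiset \<open>proots (char_poly A)\<close> consists of the \<open>n\<close> eigenvalues of \<open>A\<close>, counted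
  with algebraic multiplicity. The notion is used only for matrices with real eigenvalues, for
  which \<open>Re\<close> is merely the passage from \<open>complex\<close> to \<open>real\<close>.
\<close>

definition esd :: "complex mat \<Rightarrow> real measure" where
  "esd A = distr (measure_pmf (pmf_of_multiset (proots (char_poly A)))) borel Re"

definition essinf :: "'a measure \<Rightarrow> ('a \<Rightarrow> ereal) \<Rightarrow> ereal" where
  "essinf M f = - esssup M (\<lambda>x. - f x)"

definition slowly_varying_on :: "real \<Rightarrow> (real \<Rightarrow> real) \<Rightarrow> bool" where
  "slowly_varying_on A L \<longleftrightarrow>
     L \<in> borel_measurable (lebesgue_on {A..}) \<and> (\<forall>x\<ge>A. 0 < L x) \<and>
     (\<forall>t>0. ((\<lambda>x. L (t * x) / L x) \<longlongrightarrow> 1) at_top)"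

definition fourier_coeff :: "(real \<Rightarrow> real) \<Rightarrow> int \<Rightarrow> complex" where
  "fourier_coeff f k = 1 / (2 * of_real pi) *
     set_lebesgue_integral lebesgue {-pi..pi}
       (\<lambda>x. of_real (f x) * exp (- \<i> * of_int k * of_real x))"

definition R_mat :: "(real \<Rightarrow> real) \<Rightarrow> nat \<Rightarrow> complex mat" where
  "R_mat f M = toeplitz M (fourier_coeff f)"

text \<open>
  A random vector of length \<open>n\<close> is a random variable with values in \<open>cvec_space n\<close>; real vectors
  are vectors with entries in \<open>\<real> :: complex set\<close>.
\<close>

definition cvec_space :: "nat \<Rightarrow> (nat \<Rightarrow> complex) measure" where
  "cvec_space n = PiM {..<n} (\<lambda>_. borel)"

definition real_std_normal :: "complex measure" where
  "real_std_normal = distr (density lborel (\<lambda>x. ennreal (std_normal_density x))) borel complex_of_real"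

text \<open>
  Circularly symmetric and normalised so that the second absolute moment is 1, that is, the real
  and imaginary parts are independent with variance \<open>1/2\<close>.
\<close>

definition complex_std_normal :: "complex measure" where
  "complex_std_normal =
     distr (density lborel (\<lambda>x. ennreal (normal_density 0 (sqrt (1/2)) x)) \<Otimes>\<^sub>M
            density lborel (\<lambda>x. ennreal (normal_density 0 (sqrt (1/2)) x)))
       borel (\<lambda>(x, y). Complex x y)"

text \<open>
  The rotation invariant probability measure on the unit sphere of \<open>K\<^sup>n\<close>, where \<open>K\<close> is \<open>\<real>\<close> or
  \<open>UNIV\<close> (that is, the complex numbers). For \<open>K = \<real>\<close> the matrices \<open>U\<close> below are the orthogonal ones.
\<close>

definition haar_sphere :: "complex set \<Rightarrow> nat \<Rightarrow> (nat \<Rightarrow> complex) measure \<Rightarrow> bool" where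
  "haar_sphere K n \<mu> \<longleftrightarrow>
     prob_space \<mu> \<and> sets \<mu> = sets (cvec_space n) \<and>
     (AE x in \<mu>. (\<forall>j<n. x j \<in> K) \<and> (\<Sum>j<n. (cmod (x j))\<^sup>2) = 1) \<and>
     (\<forall>U \<in> carrier_mat n n.
        U * mat_adjoint U = 1\<^sub>m n \<longrightarrow> (\<forall>i<n. \<forall>j<n. U $$ (i, j) \<in> K) \<longrightarrow>
        distr \<mu> (cvec_space n) (\<lambda>x. \<lambda>i\<in>{..<n}. \<Sum>j<n. U $$ (i, j) * x j) = \<mu>)"

definition admissible_row_law :: "nat \<Rightarrow> (nat \<Rightarrow> complex) measure \<Rightarrow> bool" where
  "admissible_row_law n \<nu> \<longleftrightarrow>
     \<nu> = PiM {..<n} (\<lambda>_. real_std_normal) \<or>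
     \<nu> = PiM {..<n} (\<lambda>_. complex_std_normal) \<or>
     (\<exists>K \<in> {\<real>, UNIV}. \<exists>\<mu>. haar_sphere K n \<mu> \<and>
        \<nu> = distr \<mu> (cvec_space n) (\<lambda>x. \<lambda>j\<in>{..<n}. of_real (sqrt (real n)) * x j))"

definition random_row :: "nat \<Rightarrow> ('w \<Rightarrow> complex mat) \<Rightarrow> nat \<Rightarrow> 'w \<Rightarrow> nat \<Rightarrow> complex" where
  "random_row M Z i \<omega> = (\<lambda>j\<in>{..<M}. Z \<omega> $$ (i, j))"

definition iid_admissible_rows ::
    "'w measure \<Rightarrow> nat \<Rightarrow> nat \<Rightarrow> ('w \<Rightarrow> complex mat) \<Rightarrow> bool" where
  "iid_admissible_rows P N M Z \<longleftrightarrow>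
     (\<forall>\<omega> \<in> space P. Z \<omega> \<in> carrier_mat N M) \<and>
     prob_space.indep_vars P (\<lambda>_. cvec_space M) (random_row M Z) {..<N} \<and>
     (\<exists>\<nu>. admissible_row_law M \<nu> \<and> (\<forall>i<N. distr P (cvec_space M) (random_row M Z i) = \<nu>))"

definition C_mat :: "(nat \<Rightarrow> nat \<Rightarrow> real) \<Rightarrow> nat \<Rightarrow> complex mat" where
  "C_mat c N = mat_diag N (\<lambda>n. complex_of_real (c N n))"

definition X_mat :: "complex mat \<Rightarrow> complex mat \<Rightarrow> complex mat \<Rightarrow> complex mat" where
  "X_mat C Z R = psd_sqrt C * Z * psd_sqrt R"

definition S_mat :: "complex mat \<Rightarrow> complex mat" where
  "S_mat X = (1 / of_nat (dim_row X)) \<cdot>\<^sub>m (mat_adjoint X * X)"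

definition rhat_b :: "complex mat \<Rightarrow> int \<Rightarrow> complex" where
  "rhat_b S k = 1 / of_nat (dim_row S) *
     (\<Sum>i \<in> {i. i < dim_row S \<and> 0 \<le> int i + k \<and> int i + k < int (dim_row S)}.
        S $$ (nat (int i + k), i))"

definition Rhat_b :: "complex mat \<Rightarrow> complex mat" where
  "Rhat_b X = toeplitz (dim_col X) (rhat_b (S_mat X))"

end

theory Submission
  imports Defs
begin

text \<open>
  Let \<open>R\<close> be the Toeplitz matrix of the spectral density \<open>f\<close>, let \<open>S\<close> be the sample covariance matrix
  \<open>X\<^sup>* X / N\<close>, and let \<open>A(S)\<close> be the Toeplitz matrix obtained by averaging \<open>S\<close> along its diagonals, so
  that the estimator is \<open>A(S)\<close>. Denote by \<open>l\<^sub>1, \<dots>, l\<^sub>M\<close> the eigenvalues of \<open>R\<inverse> A(S)\<close>. If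
  \<open>(\<bar>l\<^sub>1 - 1\<bar> + \<dots> + \<bar>l\<^sub>M - 1\<bar>) / M\<close> tends to 0, then the proportion of eigenvalues outside any
  neighbourhood of 1 tends to 0 (\<open>weak_conv_esd_dirac\<close>).

  There are vectors \<open>v\<^sub>1, \<dots>, v\<^sub>M\<close> that are orthonormal for the form of \<open>R\<close> and diagonalize \<open>A(S)\<close>, with
  \<open>v\<^sub>i\<^sup>* A(S) v\<^sub>i = l\<^sub>i\<close> (\<open>simultaneous_diagonalization\<close>). Hence the sum in question is the sum of the
  absolute values of \<open>v\<^sub>i\<^sup>* (A(S) - R) v\<^sub>i\<close>. A lower bound \<open>m > 0\<close> of \<open>f\<close> gives
  \<open>R \<ge> m\<close>, and Bessel's inequality for the inner product of \<open>R\<close> says that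
  \<open>\<bar>\<langle>v\<^sub>1, e\<rangle>\<bar>\<^sup>2 + \<dots> + \<bar>\<langle>v\<^sub>M, e\<rangle>\<bar>\<^sup>2 \<le> \<bar>e\<bar>\<^sup>2 / m\<close> (\<open>bessel_sform\<close>). Consequently, for a positive matrix
  \<open>B\<close>, the sum of the \<open>v\<^sub>i\<^sup>* B v\<^sub>i\<close> is at most \<open>tr B / m\<close>: the problem is one about traces, and the
  unboundedness of \<open>f\<close>, which makes the operator norm of \<open>R\<close> grow, does no harm.

  The difference is split as \<open>(A(S) - \<xi> A(R)) + (\<xi> - 1) A(R) + (A(R) - R)\<close>, where \<open>\<xi>\<close> is the
  normalized trace of \<open>C\<close>.

  For the random term, sampling at \<open>2 M\<close> frequencies exhibits \<open>v\<^sup>* A(S) v\<close> as a positive combination of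
  the numbers \<open>e\<^sub>k\<^sup>* S e\<^sub>k\<close> with exponential vectors \<open>e\<^sub>k\<close> (\<open>toeplitz_avg_form\<close>). Each of these is a weighted
  mean of the independent variables \<open>\<bar>\<langle>z\<^sub>n, y\<^sub>k\<rangle>\<bar>\<^sup>2\<close>, where \<open>y\<^sub>k = R\<^sup>1\<^sup>/\<^sup>2 e\<^sub>k\<close> has square norm \<open>e\<^sub>k\<^sup>* R e\<^sub>k\<close>. For a
  unit vector \<open>y\<close>, every admissible row law gives \<open>\<bar>\<langle>z, y\<rangle>\<bar>\<^sup>2\<close> mean 1 and a bounded exponential moment
  (\<open>admissible_row_law_isotropic_subgaussian\<close>). As the weights are at most \<open>\<kappa> log M\<close>, Bernstein's
  method bounds the probability of a relative error \<open>t\<close> at one frequency by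
  \<open>2 exp (- const t N / log M)\<close>, which is eventually at most \<open>2 / M\<^sup>4\<close> because \<open>N\<close> outgrows
  \<open>log\<^sup>3 M\<close>. By the Borel--Cantelli lemma all \<open>2 M\<close> relative errors are eventually below \<open>t\<close>
  (\<open>weighted_squares_uniform\<close>), which means \<open>- t A(R) \<le> A(S) - \<xi> A(R) \<le> t A(R)\<close>. The trace of \<open>A(R)\<close> is
  the one of \<open>R\<close>, a constant multiple of \<open>M\<close>.

  The deterministic term \<open>A(R) - R\<close> has entries \<open>- \<bar>i - j\<bar> r\<^bsub>i-j\<^esub> / M\<close>. The part of \<open>f\<close> above a level
  \<open>K\<close> has a small integral and contributes two positive matrices of small trace. The truncated part has
  square summable Fourier coefficients, so that its contribution has a Frobenius norm of order
  \<open>o(\<surd>M)\<close>, and the Cauchy--Schwarz inequality applies (\<open>eigenvalue_deviation\<close>).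
\<close>

section \<open>Adjoints and reflections\<close>

lemma mult_mat_entry:
  assumes "A \<in> carrier_mat n m" "B \<in> carrier_mat m p" "i < n" "j < p"
  shows "(A * B) $$ (i, j) = (\<Sum>k<m. A $$ (i, k) * B $$ (k, j))"
  using assms by (auto simp: scalar_prod_def lessThan_atLeast0 intro!: sum.cong)

lemma mat_adjoint_carrier [simp]:
  "A \<in> carrier_mat n m \<Longrightarrow> mat_adjoint A \<in> carrier_mat m n"
  by (auto simp: mat_adjoint_def mat_of_rows_def)

lemma dim_mat_adjoint [simp]:
  "dim_row (mat_adjoint A) = dim_col A" "dim_col (mat_adjoint A) = dim_row A"
  by (auto simp: mat_adjoint_def mat_of_rows_def)

lemma mat_adjoint_entry:
  assumes "A \<in> carrier_mat n m" "i < m" "j < n"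
  shows "mat_adjoint A $$ (i, j) = conjugate (A $$ (j, i))"
  using assms by (auto simp: mat_adjoint_def mat_of_rows_def)

lemma mat_adjoint_mult:
  fixes A B :: "complex mat"
  assumes A: "A \<in> carrier_mat n m" and B: "B \<in> carrier_mat m p"
  shows "mat_adjoint (A * B) = mat_adjoint B * mat_adjoint A"
proof (rule eq_matI)
  have AB: "A * B \<in> carrier_mat n p" using A B by auto
  fix i j assume "i < dim_row (mat_adjoint B * mat_adjoint A)" "j < dim_col (mat_adjoint B * mat_adjoint A)"
  hence ij: "i < p" "j < n" using mat_adjoint_carrier[OF A] mat_adjoint_carrier[OF B] by auto
  show "mat_adjoint (A * B) $$ (i, j) = (mat_adjoint B * mat_adjoint A) $$ (i, j)"
    unfolding mat_adjoint_entry[OF AB ij] mult_mat_entry[OF A B ij(2,1)]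
      mult_mat_entry[OF mat_adjoint_carrier[OF B] mat_adjoint_carrier[OF A] ij]
    by (auto simp: mat_adjoint_entry[OF A _ ij(2)] mat_adjoint_entry[OF B ij(1)] intro!: sum.cong)
qed (use A B in auto)

lemma mat_adjoint_adjoint [simp]:
  fixes A :: "complex mat"
  shows "mat_adjoint (mat_adjoint A) = A"
proof -
  have A: "A \<in> carrier_mat (dim_row A) (dim_col A)" by auto
  have A': "mat_adjoint A \<in> carrier_mat (dim_col A) (dim_row A)" using A by (rule mat_adjoint_carrier)
  show ?thesis
    by (rule eq_matI) (auto simp: mat_adjoint_entry[OF A'] mat_adjoint_entry[OF A])
qed

lemma hermitianI:
  assumes A: "A \<in> carrier_mat n n" and h: "\<And>i j. i < n \<Longrightarrow> j < n \<Longrightarrow> A $$ (j, i) = cnj (A $$ (i, j))"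
  shows "mat_adjoint A = A"
proof (rule eq_matI)
  fix i j assume "i < dim_row A" "j < dim_col A"
  with A h[of j i] show "mat_adjoint A $$ (i, j) = A $$ (i, j)"
    by (simp add: mat_adjoint_entry[OF A])
qed (use A in auto)

lemma hermitianD:
  assumes "mat_adjoint A = A" "A \<in> carrier_mat n n" "i < n" "j < n"
  shows "A $$ (j, i) = cnj (A $$ (i, j))"
  using mat_adjoint_entry[OF assms(2) assms(4,3)] assms(1) by simp

lemma mat_adjoint_mat_diag:
  "mat_adjoint (mat_diag n d) = mat_diag n (\<lambda>i. cnj (d i))"
  by (rule eq_matI) (auto simp: mat_adjoint_entry[OF mat_diag_dim[unfolded mat_diag_def]] mat_diag_def)

text \<open>The reflection in the hyperplane orthogonal to \<open>x - y\<close>. It maps \<open>x\<close> to \<open>y\<close> if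
  \<open>\<bar>x - y\<bar>\<^sup>2 = 2 (1 - \<langle>x, y\<rangle>)\<close>, which is why the inner product has to be real.\<close>

lemma householder:
  fixes x y :: "nat \<Rightarrow> complex"
  assumes nx: "(\<Sum>i<n. (cmod (x i))\<^sup>2) = 1" and ny: "(\<Sum>i<n. (cmod (y i))\<^sup>2) = 1"
    and re: "(\<Sum>i<n. cnj (x i) * y i) \<in> \<real>"
  obtains U where "U \<in> carrier_mat n n" "U * U = 1\<^sub>m n" "mat_adjoint U = U"
    "\<And>i. i < n \<Longrightarrow> (\<Sum>j<n. U $$ (i, j) * x j) = y i"
    "(\<forall>i<n. x i \<in> \<real> \<and> y i \<in> \<real>) \<Longrightarrow> (\<forall>i<n. \<forall>j<n. U $$ (i, j) \<in> \<real>)"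
proof -
  define v where "v i = x i - y i" for i
  define q where "q = (\<Sum>i<n. (cmod (v i))\<^sup>2)"
  define c :: complex where "c = of_real (2 / q)"
  define U where "U = Matrix.mat n n (\<lambda>(i, j). (if i = j then 1 else 0) - c * v i * cnj (v j))"
  have U: "U \<in> carrier_mat n n" by (simp add: U_def)
  have Ue: "U $$ (i, j) = (if i = j then 1 else 0) - c * v i * cnj (v j)" if "i < n" "j < n" for i j
    using that by (simp add: U_def)
  have sum_cnj_self: "(\<Sum>i<n. cnj (u i) * u i) = of_real (\<Sum>i<n. (cmod (u i))\<^sup>2)" for u :: "nat \<Rightarrow> complex"
    unfolding of_real_sum complex_norm_square by (simp add: mult.commute)
  have qc: "(\<Sum>i<n. cnj (v i) * v i) = of_real q"
    unfolding q_def by (rule sum_cnj_self)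
  have cc: "c * c * of_real q = 2 * c" by (cases "q = 0") (auto simp: c_def)
  have adj: "mat_adjoint U = U"
    by (rule hermitianI[OF U]) (auto simp: Ue c_def)
  have delta: "(\<Sum>k<n. (if i = k then 1 else 0) * g k) = g i" if "i < n" for g :: "nat \<Rightarrow> complex" and i
  proof -
    have "(\<Sum>k<n. (if i = k then 1 else 0) * g k) = (\<Sum>k<n. if i = k then g k else 0)"
      by (intro sum.cong) auto
    thus ?thesis using that by simp
  qed
  have UU: "U * U = 1\<^sub>m n"
  proof (rule eq_matI)
    fix i j assume "i < dim_row (1\<^sub>m n :: complex mat)" "j < dim_col (1\<^sub>m n :: complex mat)"
    hence ij: "i < n" "j < n" by auto
    have "(U * U) $$ (i, j) = (\<Sum>k<n. U $$ (i, k) * U $$ (k, j))"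
      by (rule mult_mat_entry[OF U U ij])
    also have "\<dots> = (\<Sum>k<n. (if i = k then 1 else 0) * U $$ (k, j)) - (\<Sum>k<n. c * v i * cnj (v k) * U $$ (k, j))"
      unfolding sum_subtractf[symmetric] using ij by (intro sum.cong) (auto simp: Ue left_diff_distrib)
    also have "(\<Sum>k<n. c * v i * cnj (v k) * U $$ (k, j)) = c * v i * (\<Sum>k<n. (if j = k then 1 else 0) * cnj (v k)) 
        - c * c * v i * cnj (v j) * (\<Sum>k<n. cnj (v k) * v k)"
      unfolding sum_distrib_left sum_subtractf[symmetric] using ij
      by (intro sum.cong) (auto simp: Ue algebra_simps)
    also have "\<dots> = - (c * v i * cnj (v j))" unfolding qc delta[OF ij(2)]
    proof -
      have "c * c * v i * cnj (v j) * of_real q = (c * c * of_real q) * (v i * cnj (v j))" by (simp only: ac_simps)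
      also have "\<dots> = 2 * (c * v i * cnj (v j))" unfolding cc by (simp only: ac_simps)
      finally show "c * v i * cnj (v j) - c * c * v i * cnj (v j) * of_real q = - (c * v i * cnj (v j))" by simp
    qed
    finally show "(U * U) $$ (i, j) = 1\<^sub>m n $$ (i, j)"
      using ij by (subst (asm) delta[OF ij(1)]) (auto simp: Ue)
  qed (use U in auto)
  have 1: "(\<Sum>i<n. cnj (x i) * x i) = 1" 
    using sum_cnj_self[of x] nx by simp
  have 2: "(\<Sum>i<n. cnj (y i) * y i) = 1" 
    using sum_cnj_self[of y] ny by simp
  define r where "r = (\<Sum>i<n. cnj (x i) * y i)"
  have rr: "(\<Sum>i<n. cnj (y i) * x i) = r"
  proof -
    have "(\<Sum>i<n. cnj (y i) * x i) = cnj r" unfolding r_def cnj_sum by (intro sum.cong) auto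
    thus ?thesis using re by (simp add: r_def Reals_cnj_iff)
  qed
  have vx: "(\<Sum>i<n. cnj (v i) * x i) = 1 - r"
    using 1 rr by (simp add: v_def left_diff_distrib sum_subtractf)
  have "of_real q = 2 * (1 - r)"
    unfolding qc[symmetric] using 1 2 rr by (simp add: v_def algebra_simps sum_subtractf sum.distrib r_def)
  hence cq: "c * (1 - r) = 1" if "q \<noteq> 0" using that unfolding c_def
    by (simp add: field_simps)
  have Ux: "(\<Sum>j<n. U $$ (i, j) * x j) = y i" if i: "i < n" for i
  proof -
    have "(\<Sum>j<n. U $$ (i, j) * x j) = (\<Sum>k<n. (if i = k then 1 else 0) * x k) - c * v i * (\<Sum>j<n. cnj (v j) * x j)"
      unfolding sum_distrib_left sum_subtractf[symmetric] using i by (intro sum.cong) (auto simp: Ue algebra_simps)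
    also have "\<dots> = x i - c * (1 - r) * v i" unfolding delta[OF i] vx by (simp add: algebra_simps)
    also have "\<dots> = y i"
    proof (cases "q = 0")
      case True
      hence "v i = 0" using i unfolding q_def by (subst (asm) sum_nonneg_eq_0_iff) auto
      thus ?thesis by (simp add: v_def)
    next
      case False
      show ?thesis unfolding cq[OF False] by (simp add: v_def)
    qed
    finally show ?thesis .
  qed
  have "\<forall>i<n. \<forall>j<n. U $$ (i, j) \<in> \<real>" if "\<forall>i<n. x i \<in> \<real> \<and> y i \<in> \<real>"
    using that by (auto simp: Ue v_def c_def complex_is_Real_iff)
  with U UU adj Ux show ?thesis by (intro that[of U]) auto
qed

section \<open>The spectral theorem and positive square roots\<close>

definition border :: "complex \<Rightarrow> complex mat \<Rightarrow> complex mat" where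
  "border a V = Matrix.mat (Suc (dim_row V)) (Suc (dim_col V))
     (\<lambda>(i, j). if i = 0 \<and> j = 0 then a else if i = 0 \<or> j = 0 then 0 else V $$ (i - 1, j - 1))"

lemma border_carrier [simp]: "V \<in> carrier_mat n m \<Longrightarrow> border a V \<in> carrier_mat (Suc n) (Suc m)"
  by (auto simp: border_def)

lemma border_entry:
  assumes "V \<in> carrier_mat n m"
  shows "border a V $$ (0, 0) = a"
    "j < m \<Longrightarrow> border a V $$ (0, Suc j) = 0"
    "i < n \<Longrightarrow> border a V $$ (Suc i, 0) = 0"
    "i < n \<Longrightarrow> j < m \<Longrightarrow> border a V $$ (Suc i, Suc j) = V $$ (i, j)"
  using assms by (auto simp: border_def)

text \<open>Bordering by a diagonal entry is compatible with products and adjoints, which carries an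
  orthonormal eigenbasis of a compression of a matrix over to the matrix.\<close>

lemma border_mult:
  assumes V: "V \<in> carrier_mat n m" and W: "W \<in> carrier_mat m p"
  shows "border a V * border b W = border (a * b) (V * W)"
proof (rule eq_matI)
  have VW: "V * W \<in> carrier_mat n p" using V W by auto
  fix i j assume "i < dim_row (border (a * b) (V * W))" "j < dim_col (border (a * b) (V * W))"
  hence ij: "i < Suc n" "j < Suc p" using V W by (auto simp: border_def)
  show "(border a V * border b W) $$ (i, j) = border (a * b) (V * W) $$ (i, j)"
    unfolding mult_mat_entry[OF border_carrier[OF V] border_carrier[OF W] ij] sum.lessThan_Suc_shift
    using ij by (cases i; cases j) (auto simp: border_entry[OF V] border_entry[OF W] border_entry[OF VW]
         mult_mat_entry[OF V W])
qed (use V W in \<open>auto simp: border_def\<close>)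

lemma border_adjoint:
  assumes V: "V \<in> carrier_mat n m"
  shows "mat_adjoint (border a V) = border (cnj a) (mat_adjoint V)"
proof (rule eq_matI)
  note V' = mat_adjoint_carrier[OF V]
  fix i j assume "i < dim_row (border (cnj a) (mat_adjoint V))" "j < dim_col (border (cnj a) (mat_adjoint V))"
  hence ij: "i < Suc m" "j < Suc n" using V by (auto simp: border_def)
  thus "mat_adjoint (border a V) $$ (i, j) = border (cnj a) (mat_adjoint V) $$ (i, j)"
    unfolding mat_adjoint_entry[OF border_carrier[OF V] ij]
    by (cases i; cases j) (auto simp: border_entry[OF V] border_entry[OF V'] mat_adjoint_entry[OF V])
qed (use V in \<open>auto simp: border_def\<close>)

lemma border_diag: "border a (mat_diag n d) = mat_diag (Suc n) (case_nat a d)"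
  by (rule eq_matI) (auto simp: border_def mat_diag_def split: nat.splits)

lemma border_one: "border 1 (1\<^sub>m n) = 1\<^sub>m (Suc n)"
  by (rule eq_matI) (auto simp: border_def)

text \<open>Induction on the size: a reflection \<open>H\<close> moves the first coordinate vector to an eigenvector, so
  that \<open>H A H\<close> is a smaller Hermitian matrix bordered by the eigenvalue.\<close>

theorem spectral_theorem:
  fixes A :: "complex mat"
  assumes "A \<in> carrier_mat n n" "mat_adjoint A = A"
  shows "\<exists>U d. U \<in> carrier_mat n n \<and> mat_adjoint U * U = 1\<^sub>m n \<and> U * mat_adjoint U = 1\<^sub>m n \<and>
     A = U * mat_diag n (\<lambda>i. complex_of_real (d i)) * mat_adjoint U"
  using assms
proof (induction n arbitrary: A)
  case 0
  show ?case by (rule exI[of _ "1\<^sub>m 0"]) (use 0 in \<open>auto intro!: eq_matI\<close>)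
next
  case (Suc n)
  note A = Suc.prems(1) and hA = Suc.prems(2)
  obtain es where es: "char_poly A = (\<Prod>a\<leftarrow>es. [:- a, 1:])" "length es = Suc n"
    using char_poly_factorized[OF A] by auto
  then obtain e where "poly (char_poly A) e = 0" by (cases es) auto
  hence "eigenvalue A e" using eigenvalue_root_char_poly[OF A] by simp
  then obtain u where u: "u \<in> carrier_vec (Suc n)" "u \<noteq> 0\<^sub>v (Suc n)" "A *\<^sub>v u = e \<cdot>\<^sub>v u"
    using A by (auto simp: eigenvalue_def eigenvector_def)
  define s where "s = sqrt (\<Sum>i<Suc n. (cmod (vec_index u i))\<^sup>2)"
  have spos: "0 < (\<Sum>i<Suc n. (cmod (vec_index u i))\<^sup>2)"
  proof (rule ccontr)
    assume "\<not> ?thesis"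
    moreover have "0 \<le> (\<Sum>i<Suc n. (cmod (vec_index u i))\<^sup>2)" by (intro sum_nonneg) auto
    ultimately have "(\<Sum>i<Suc n. (cmod (vec_index u i))\<^sup>2) = 0" by linarith
    hence "\<forall>i\<in>{..<Suc n}. (cmod (vec_index u i))\<^sup>2 = 0" by (subst (asm) sum_nonneg_eq_0_iff) auto
    hence "u = 0\<^sub>v (Suc n)" using u(1) by (intro eq_vecI) auto
    with u(2) show False by blast
  qed
  hence s0: "s > 0" by (simp add: s_def)
  \<comment> \<open>The phase makes the first coordinate real, which is the inner product that the reflection needs.\<close>
  define p :: complex where "p = (if vec_index u 0 = 0 then 1 else cnj (vec_index u 0) / of_real (cmod (vec_index u 0)))"
  have p: "cmod p = 1" by (auto simp: p_def norm_divide)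
  define w where "w i = p / of_real s * vec_index u i" for i
  have nw: "(\<Sum>i<Suc n. (cmod (w i))\<^sup>2) = 1"
  proof -
    have "(\<Sum>i<Suc n. (cmod (w i))\<^sup>2) = (\<Sum>i<Suc n. (cmod (vec_index u i))\<^sup>2) / s\<^sup>2"
      unfolding sum_divide_distrib using s0
      by (intro sum.cong) (auto simp: w_def norm_mult norm_divide p power_mult_distrib power_divide)
    also have "\<dots> = 1" using spos by (simp add: s_def sum_nonneg del: sum.lessThan_Suc)
    finally show ?thesis .
  qed
  have w0: "w 0 \<in> \<real>"
  proof (cases "vec_index u 0 = 0")
    case False
    have "w 0 = of_real ((cmod (vec_index u 0))\<^sup>2 / (s * cmod (vec_index u 0)))"
      using False s0 by (simp add: w_def p_def complex_norm_square del: of_real_power) (simp add: field_simps)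
    thus ?thesis by simp
  qed (simp add: w_def)
  have Aw: "(\<Sum>j<Suc n. A $$ (i, j) * w j) = e * w i" if "i < Suc n" for i
  proof -
    have "vec_index (A *\<^sub>v u) i = (\<Sum>j<Suc n. A $$ (i, j) * vec_index u j)"
      using that A u(1) by (auto simp: scalar_prod_def lessThan_atLeast0 simp del: sum.lessThan_Suc intro!: sum.cong)
    hence "(\<Sum>j<Suc n. A $$ (i, j) * vec_index u j) = e * vec_index u i" using u that by auto
    hence "p / of_real s * (\<Sum>j<Suc n. A $$ (i, j) * vec_index u j) = e * w i" by (simp add: w_def)
    thus ?thesis unfolding sum_distrib_left w_def by (simp add: algebra_simps del: sum.lessThan_Suc)
  qed
  define x :: "nat \<Rightarrow> complex" where "x i = (if i = 0 then 1 else 0)" for i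
  have nx: "(\<Sum>i<Suc n. (cmod (x i))\<^sup>2) = 1" unfolding sum.lessThan_Suc_shift by (simp add: x_def)
  have xw: "(\<Sum>i<Suc n. cnj (x i) * w i) \<in> \<real>" unfolding sum.lessThan_Suc_shift using w0 by (simp add: x_def)
  obtain H where H: "H \<in> carrier_mat (Suc n) (Suc n)" "H * H = 1\<^sub>m (Suc n)" "mat_adjoint H = H"
    "\<And>i. i < Suc n \<Longrightarrow> (\<Sum>j<Suc n. H $$ (i, j) * x j) = w i"
    by (rule householder[OF nx nw xw]) blast
  have H0: "H $$ (i, 0) = w i" if "i < Suc n" for i
    using H(4)[OF that] unfolding sum.lessThan_Suc_shift by (simp add: x_def)
  define B where "B = H * A * H"
  have B: "B \<in> carrier_mat (Suc n) (Suc n)" using H A by (simp add: B_def)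
  have hB: "mat_adjoint B = B"
    unfolding B_def using H(1) A by (simp add: mat_adjoint_mult[of _ "Suc n" "Suc n" _ "Suc n"] H(3) hA assoc_mult_mat[of _ "Suc n" "Suc n" _ "Suc n" _ "Suc n"])
  have B0: "B $$ (i, 0) = (if i = 0 then e else 0)" if i: "i < Suc n" for i
  proof -
    have AH: "A * H \<in> carrier_mat (Suc n) (Suc n)" using A H(1) by simp
    have "B = H * (A * H)" using A H(1) by (simp add: B_def assoc_mult_mat[of _ "Suc n" "Suc n" _ "Suc n" _ "Suc n"])
    hence "B $$ (i, 0) = (\<Sum>j<Suc n. H $$ (i, j) * (A * H) $$ (j, 0))"
      using mult_mat_entry[OF H(1) AH i] by simp
    also have "\<dots> = (\<Sum>j<Suc n. H $$ (i, j) * (e * H $$ (j, 0)))"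
      by (intro sum.cong) (auto simp: mult_mat_entry[OF A H(1)] H0 Aw simp del: sum.lessThan_Suc)
    also have "\<dots> = e * (\<Sum>j<Suc n. H $$ (i, j) * H $$ (j, 0))"
      by (simp add: sum_distrib_left mult_ac del: sum.lessThan_Suc)
    also have "(\<Sum>j<Suc n. H $$ (i, j) * H $$ (j, 0)) = (H * H) $$ (i, 0)"
      using mult_mat_entry[OF H(1) H(1) i] by simp
    also have "\<dots> = (if i = 0 then 1 else 0)" unfolding H(2) using i by simp
    finally show ?thesis by simp
  qed
  have B0': "B $$ (0, j) = (if j = 0 then e else 0)" if j: "j < Suc n" for j
    using hermitianD[OF hB B j, of 0] B0[OF j] B0[of 0] hermitianD[OF hB B, of 0 0] by auto
  have "e = cnj e" using hermitianD[OF hB B, of 0 0] B0[of 0] by simp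
  then obtain er where er: "e = of_real er" by (metis Reals_cases Reals_cnj_iff)
  define B3 where "B3 = Matrix.mat n n (\<lambda>(i, j). B $$ (Suc i, Suc j))"
  have B3: "B3 \<in> carrier_mat n n" by (simp add: B3_def)
  have hB3: "mat_adjoint B3 = B3"
    by (rule hermitianI[OF B3]) (auto simp: B3_def intro: hermitianD[OF hB B])
  have Bb: "B = border e B3"
  proof (rule eq_matI)
    fix i j assume "i < dim_row (border e B3)" "j < dim_col (border e B3)"
    hence "i < Suc n" "j < Suc n" by (auto simp: border_def B3_def)
    thus "B $$ (i, j) = border e B3 $$ (i, j)"
      by (cases i; cases j) (auto simp: border_def B3_def B0 B0')
  qed (use B in \<open>auto simp: border_def B3_def\<close>)
  obtain V d where V: "V \<in> carrier_mat n n" "mat_adjoint V * V = 1\<^sub>m n" "V * mat_adjoint V = 1\<^sub>m n"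
    "B3 = V * mat_diag n (\<lambda>i. complex_of_real (d i)) * mat_adjoint V"
    using Suc.IH[OF B3 hB3] by blast
  define D where "D = mat_diag n (\<lambda>i. complex_of_real (d i))"
  have D: "D \<in> carrier_mat n n" by (simp add: D_def)
  note V' = mat_adjoint_carrier[OF V(1)]
  define W where "W = border 1 V"
  define d' where "d' = case_nat er d"
  define E where "E = mat_diag (Suc n) (\<lambda>i. complex_of_real (d' i))"
  have E: "E \<in> carrier_mat (Suc n) (Suc n)" by (simp add: E_def)
  have Ed: "E = border e D"
    unfolding E_def D_def border_diag er d'_def by (rule arg_cong[of _ _ "mat_diag (Suc n)"]) (auto split: nat.splits)
  have W: "W \<in> carrier_mat (Suc n) (Suc n)" using V(1) by (simp add: W_def)
  have W': "mat_adjoint W = border 1 (mat_adjoint V)" using border_adjoint[OF V(1)] by (simp add: W_def)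
  note W'c = mat_adjoint_carrier[OF W]
  have WW: "mat_adjoint W * W = 1\<^sub>m (Suc n)" "W * mat_adjoint W = 1\<^sub>m (Suc n)"
    unfolding W' unfolding W_def using V by (simp_all add: border_mult[of _ n n _ n] border_one)
  have WE: "W * E * mat_adjoint W = B"
    unfolding W' unfolding W_def Ed Bb border_mult[OF V(1) D] border_mult[OF mult_carrier_mat[OF V(1) D] V']
    using V(4) by (simp add: D_def)
  define U where "U = H * W"
  have U: "U \<in> carrier_mat (Suc n) (Suc n)" using H(1) W by (simp add: U_def)
  have U': "mat_adjoint U = mat_adjoint W * H" unfolding U_def mat_adjoint_mult[OF H(1) W] H(3) ..
  note as = assoc_mult_mat[of _ "Suc n" "Suc n" _ "Suc n" _ "Suc n"] mult_carrier_mat[of _ "Suc n" "Suc n" _ "Suc n"]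
  have 1: "mat_adjoint U * U = mat_adjoint W * (H * H) * W" unfolding U' unfolding U_def
    using H(1) W W'c by (simp add: as)
  have 2: "U * mat_adjoint U = H * (W * mat_adjoint W) * H" unfolding U' unfolding U_def
    using H(1) W W'c by (simp add: as)
  have "U * E * mat_adjoint U = H * (W * E * mat_adjoint W) * H" unfolding U' unfolding U_def
    using H(1) W W'c E by (simp add: as)
  also have "\<dots> = (H * H) * A * (H * H)" unfolding WE B_def using H(1) A by (simp add: as)
  also have "\<dots> = A" using A by (simp add: H(2))
  finally have 3: "A = U * E * mat_adjoint U" ..
  show ?case
    by (rule exI[of _ U], rule exI[of _ d']) (use U 1 2 3 W W'c WW H in \<open>auto simp: E_def\<close>)
qed


text \<open>The sesquilinear form of the leading \<open>n \<times> n\<close> block of \<open>S\<close>. Matrices and vectors enter as functions of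
  the indices, so that Toeplitz matrices, diagonal averages and matrices of type \<open>mat\<close> are treated alike.\<close>

definition sform :: "nat \<Rightarrow> (nat \<Rightarrow> nat \<Rightarrow> complex) \<Rightarrow> (nat \<Rightarrow> complex) \<Rightarrow> (nat \<Rightarrow> complex) \<Rightarrow> complex" where
  "sform n S u v = (\<Sum>i<n. \<Sum>j<n. cnj (u i) * S i j * v j)"

lemma sform_entry:
  assumes V: "V \<in> carrier_mat n n" and A: "A \<in> carrier_mat n n" and W: "W \<in> carrier_mat n n" and ij: "i < n" "j < n"
  shows "(mat_adjoint V * A * W) $$ (i, j) = sform n (\<lambda>k l. A $$ (k, l)) (\<lambda>k. V $$ (k, i)) (\<lambda>k. W $$ (k, j))"
proof -
  note V' = mat_adjoint_carrier[OF V]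
  have AW: "A * W \<in> carrier_mat n n" using A W by simp
  have "mat_adjoint V * A * W = mat_adjoint V * (A * W)"
    by (rule assoc_mult_mat[OF V' A W])
  thus ?thesis
    using ij by (auto simp: mult_mat_entry[OF V' AW] mult_mat_entry[OF A W] mat_adjoint_entry[OF V]
      sform_def sum_distrib_left mult.assoc intro!: sum.cong)
qed

lemma scalar_prod_sform:
  assumes A: "A \<in> carrier_mat n n" and v: "v \<in> carrier_vec n"
  shows "(A *\<^sub>v v) \<bullet>c v = sform n (\<lambda>k l. A $$ (k, l)) (\<lambda>k. vec_index v k) (\<lambda>k. vec_index v k)"
  using A v by (auto simp: scalar_prod_def sform_def lessThan_atLeast0 sum_distrib_left mult_ac intro!: sum.cong)

lemma pos_semidef_sform:
  assumes A: "A \<in> carrier_mat n n"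
  shows "pos_semidef A \<longleftrightarrow> mat_adjoint A = A \<and> (\<forall>v. 0 \<le> Re (sform n (\<lambda>k l. A $$ (k, l)) v v))"
proof -
  have "sform n (\<lambda>k l. A $$ (k, l)) v v = sform n (\<lambda>k l. A $$ (k, l)) (vec_index (Matrix.vec n v)) (vec_index (Matrix.vec n v))" for v
    by (auto simp: sform_def intro!: sum.cong)
  hence "(\<forall>v\<in>carrier_vec n. 0 \<le> Re ((A *\<^sub>v v) \<bullet>c v)) \<longleftrightarrow> (\<forall>v. 0 \<le> Re (sform n (\<lambda>k l. A $$ (k, l)) v v))"
    using scalar_prod_sform[OF A] by (metis vec_carrier)
  thus ?thesis using A by (auto simp: pos_semidef_def)
qed

lemma unitary_conj_cancel:
  assumes "A = U * D * mat_adjoint U" "U \<in> carrier_mat n n" "D \<in> carrier_mat n n"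
    and "mat_adjoint U * U = 1\<^sub>m n"
  shows "mat_adjoint U * A * U = D"
proof -
  note as = assoc_mult_mat[of _ n n _ n _ n] mult_carrier_mat[of _ n n _ n]
  have "mat_adjoint U * A * U = (mat_adjoint U * U) * D * (mat_adjoint U * U)"
    unfolding assms(1) using assms(2,3) mat_adjoint_carrier[OF assms(2)] by (simp add: as)
  thus ?thesis using assms by simp
qed

text \<open>Let \<open>u\<close> be a unit eigenvector of \<open>D = B - C\<close> with eigenvalue \<open>d\<close>. Evaluating \<open>B\<^sup>2 - C\<^sup>2\<close> at \<open>u\<close> gives
  \<open>d (u\<^sup>* B u + u\<^sup>* C u) = 0\<close>. If \<open>d \<noteq> 0\<close>, then both summands vanish by positivity, and their difference
  \<open>d\<close> vanishes as well.\<close>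

lemma psd_sqrt_unique:
  assumes B: "B \<in> carrier_mat n n" "pos_semidef B" and C: "C \<in> carrier_mat n n" "pos_semidef C"
    and eq: "B * B = C * C"
  shows "B = C"
proof -
  note as = assoc_mult_mat[of _ n n _ n _ n] mult_carrier_mat[of _ n n _ n]
  have hB: "mat_adjoint B = B" and hC: "mat_adjoint C = C" 
    using B C by (auto simp: pos_semidef_def)
  define D where "D = B - C"
  have D: "D \<in> carrier_mat n n" unfolding D_def by (rule minus_carrier_mat[OF C(1)])
  have hD: "mat_adjoint D = D"
  proof (rule hermitianI[OF D])
    fix i j assume "i < n" "j < n"
    with hermitianD[OF hB B(1), of i j] hermitianD[OF hC C(1), of i j] B C
    show "D $$ (j, i) = cnj (D $$ (i, j))" by (simp add: D_def)
  qed
  obtain U d where U: "U \<in> carrier_mat n n" "mat_adjoint U * U = 1\<^sub>m n" "U * mat_adjoint U = 1\<^sub>m n"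
     and DU: "D = U * mat_diag n (\<lambda>i. complex_of_real (d i)) * mat_adjoint U"
    using spectral_theorem[OF D hD] by blast
  note U' = mat_adjoint_carrier[OF U(1)]
  define E where "E = mat_diag n (\<lambda>i. complex_of_real (d i))"
  have E: "E \<in> carrier_mat n n" by (simp add: E_def)
  define B' where "B' = mat_adjoint U * B * U"
  define C' where "C' = mat_adjoint U * C * U"
  have B': "B' \<in> carrier_mat n n" and C': "C' \<in> carrier_mat n n"
    using U U' B C by (auto simp: B'_def C'_def)
  have sq: "mat_adjoint U * (X * X) * U = (mat_adjoint U * X * U) * (mat_adjoint U * X * U)"
    if X: "X \<in> carrier_mat n n" for X
  proof -
    have "(mat_adjoint U * X * U) * (mat_adjoint U * X * U) = mat_adjoint U * X * (U * mat_adjoint U) * X * U"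
      using U(1) U' X by (simp add: as)
    also have "\<dots> = mat_adjoint U * (X * X) * U" unfolding U(3) using U(1) U' X by (simp add: as)
    finally show ?thesis ..
  qed
  have BC: "B' * B' = C' * C'" unfolding B'_def C'_def using sq[OF B(1)] sq[OF C(1)] eq by simp
  have "mat_adjoint U * D * U = B' - C'" unfolding D_def B'_def C'_def
    using U(1) U' B C by (simp add: mult_minus_distrib_mat[of _ n n _ n] minus_mult_distrib_mat[of _ n n _ _ n] as)
  hence BE: "B' - C' = E" using unitary_conj_cancel[OF DU[folded E_def] U(1) E U(2)] by simp
  have d0: "d i = 0" if i: "i < n" for i
  proof -
    have Bij: "B' $$ (j, k) = C' $$ (j, k) + (if j = k then of_real (d j) else 0)" if "j < n" "k < n" for j k
    proof -
      have "(B' - C') $$ (j, k) = E $$ (j, k)" unfolding BE ..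
      thus ?thesis using that B' C' by (auto simp: E_def mat_diag_def algebra_simps)
    qed
    have "(\<Sum>k<n. B' $$ (i, k) * B' $$ (k, i)) = (\<Sum>k<n. C' $$ (i, k) * C' $$ (k, i))"
      using mult_mat_entry[OF B' B' i i] mult_mat_entry[OF C' C' i i] BC by simp
    also have "(\<Sum>k<n. B' $$ (i, k) * B' $$ (k, i)) = (\<Sum>k<n. C' $$ (i, k) * C' $$ (k, i) +
       (if i = k then of_real (d i) * (2 * C' $$ (i, i) + of_real (d i)) else 0))"
      using i by (intro sum.cong) (auto simp: Bij algebra_simps)
    finally have "of_real (d i) * (2 * C' $$ (i, i) + of_real (d i)) = 0"
      using i by (simp add: sum.distrib)
    hence "d i = 0 \<or> 2 * C' $$ (i, i) + of_real (d i) = 0" unfolding mult_eq_0_iff of_real_eq_0_iff .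
    hence *: "d i = 0 \<or> C' $$ (i, i) + B' $$ (i, i) = 0"
    proof -
      have "C' $$ (i, i) + B' $$ (i, i) = 2 * C' $$ (i, i) + of_real (d i)"
        unfolding Bij[OF i i] by simp
      with \<open>d i = 0 \<or> _\<close> show ?thesis by metis
    qed
    have "0 \<le> Re (C' $$ (i, i))" "0 \<le> Re (B' $$ (i, i))"
      using sform_entry[OF U(1) B(1) U(1) i i] sform_entry[OF U(1) C(1) U(1) i i]
        pos_semidef_sform[OF B(1)] pos_semidef_sform[OF C(1)] B(2) C(2) by (auto simp: B'_def C'_def)
    moreover have "Re (B' $$ (i, i)) = Re (C' $$ (i, i)) + d i" using Bij[OF i i] by simp
    ultimately show "d i = 0" using * by (auto simp: complex_eq_iff)
  qed
  have "E = 0\<^sub>m n n" by (rule eq_matI) (auto simp: E_def mat_diag_def d0)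
  hence "D = 0\<^sub>m n n" unfolding DU[folded E_def] using U U' by simp
  show "B = C"
  proof (rule eq_matI)
    fix i j assume ij: "i < dim_row C" "j < dim_col C"
    hence "D $$ (i, j) = 0" using \<open>D = 0\<^sub>m n n\<close> C by simp
    thus "B $$ (i, j) = C $$ (i, j)" using ij B C by (simp add: D_def)
  qed (use B C in auto)
qed

lemma psd_sqrt_eqI:
  assumes A: "A \<in> carrier_mat n n" and B: "B \<in> carrier_mat n n" "pos_semidef B" "B * B = A"
  shows "psd_sqrt A = B"
  unfolding psd_sqrt_def
proof (rule the_equality)
  fix C assume "C \<in> carrier_mat (dim_row A) (dim_row A) \<and> pos_semidef C \<and> C * C = A"
  thus "C = B" using A B psd_sqrt_unique[of C n B] by auto
qed (use A B in auto)

lemma sform_mat_diag: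
  "sform n (\<lambda>k l. mat_diag n d $$ (k, l)) v v = (\<Sum>i<n. d i * of_real ((cmod (v i))\<^sup>2))"
proof -
  have "(\<Sum>j<n. cnj (v i) * mat_diag n d $$ (i, j) * v j) = d i * of_real ((cmod (v i))\<^sup>2)" if "i < n" for i
  proof -
    have "(\<Sum>j<n. cnj (v i) * mat_diag n d $$ (i, j) * v j) = (\<Sum>j<n. if i = j then cnj (v i) * d i * v i else 0)"
      using that by (intro sum.cong) (auto simp: mat_diag_def)
    also have "\<dots> = d i * of_real ((cmod (v i))\<^sup>2)"
      unfolding complex_norm_square using that by (simp add: mult_ac)
    finally show ?thesis .
  qed
  thus ?thesis by (simp add: sform_def)
qed

lemma pos_semidef_mat_diag:
  assumes "\<And>i. i < n \<Longrightarrow> 0 \<le> d i"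
  shows "pos_semidef (mat_diag n (\<lambda>i. complex_of_real (d i)))"
proof -
  have "0 \<le> Re (\<Sum>i<n. complex_of_real (d i) * of_real ((cmod (v i))\<^sup>2))" for v
    using assms by (auto intro!: sum_nonneg)
  thus ?thesis
    unfolding pos_semidef_sform[OF mat_diag_dim] sform_mat_diag mat_adjoint_mat_diag by simp
qed

lemma psd_sqrt_mat_diag:
  assumes "\<And>i. i < n \<Longrightarrow> 0 \<le> d i"
  shows "psd_sqrt (mat_diag n (\<lambda>i. complex_of_real (d i))) = mat_diag n (\<lambda>i. complex_of_real (sqrt (d i)))"
proof (rule psd_sqrt_eqI[of _ n])
  show "mat_diag n (\<lambda>i. complex_of_real (sqrt (d i))) * mat_diag n (\<lambda>i. complex_of_real (sqrt (d i))) =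
    mat_diag n (\<lambda>i. complex_of_real (d i))"
    unfolding mat_diag_diag by (rule eq_matI) (auto simp: mat_diag_def assms simp flip: of_real_mult)
qed (auto intro!: pos_semidef_mat_diag assms)

lemma sform_conj:
  assumes V: "V \<in> carrier_mat n n" and A: "A \<in> carrier_mat n n"
  shows "sform n (\<lambda>k l. (mat_adjoint V * A * V) $$ (k, l)) v v =
    sform n (\<lambda>k l. A $$ (k, l)) (\<lambda>k. \<Sum>i<n. V $$ (k, i) * v i) (\<lambda>k. \<Sum>i<n. V $$ (k, i) * v i)"
proof -
  define w where "w = Matrix.mat n n (\<lambda>(k, i). v k)"
  have w: "w \<in> carrier_mat n n" by (simp add: w_def)
  note as = assoc_mult_mat[of _ n n _ n _ n] mult_carrier_mat[of _ n n _ n]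
  note V' = mat_adjoint_carrier[OF V]
  show ?thesis
  proof (cases n)
    case (Suc m)
    hence 0: "0 < n" by simp
    have B: "mat_adjoint V * A * V \<in> carrier_mat n n" and Vw: "V * w \<in> carrier_mat n n" using V A V' w by auto
    have e: "mat_adjoint w * (mat_adjoint V * A * V) * w = mat_adjoint (V * w) * A * (V * w)"
      unfolding mat_adjoint_mult[OF V w] using V V' A w mat_adjoint_carrier[OF w] by (simp add: as)
    have 1: "(mat_adjoint w * (mat_adjoint V * A * V) * w) $$ (0, 0) = sform n (\<lambda>k l. (mat_adjoint V * A * V) $$ (k, l)) v v"
      unfolding sform_entry[OF w B w 0 0] by (auto simp: sform_def w_def intro!: sum.cong)
    have Vw0: "(V * w) $$ (k, 0) = (\<Sum>i<n. V $$ (k, i) * v i)" if "k < n" for k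
      unfolding mult_mat_entry[OF V w that 0] using 0 by (intro sum.cong) (auto simp: w_def)
    have 2: "(mat_adjoint (V * w) * A * (V * w)) $$ (0, 0) = 
      sform n (\<lambda>k l. A $$ (k, l)) (\<lambda>k. \<Sum>i<n. V $$ (k, i) * v i) (\<lambda>k. \<Sum>i<n. V $$ (k, i) * v i)"
      unfolding sform_entry[OF Vw A Vw 0 0] sform_def
      by (intro sum.cong refl) (auto simp: Vw0)
    show ?thesis using 1 2 e by simp
  qed (simp add: sform_def)
qed

lemma psd_sqrt_exists:
  assumes A: "A \<in> carrier_mat n n" "pos_semidef A"
  shows "psd_sqrt A \<in> carrier_mat n n" "mat_adjoint (psd_sqrt A) = psd_sqrt A" "psd_sqrt A * psd_sqrt A = A"
proof -
  have hA: "mat_adjoint A = A" using A by (simp add: pos_semidef_def)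
  obtain U d where U: "U \<in> carrier_mat n n" "mat_adjoint U * U = 1\<^sub>m n" "U * mat_adjoint U = 1\<^sub>m n"
     and AU: "A = U * mat_diag n (\<lambda>i. complex_of_real (d i)) * mat_adjoint U"
    using spectral_theorem[OF A(1) hA] by blast
  note as = assoc_mult_mat[of _ n n _ n _ n] mult_carrier_mat[of _ n n _ n]
  note U' = mat_adjoint_carrier[OF U(1)]
  define D where "D = mat_diag n (\<lambda>i. complex_of_real (d i))"
  define E where "E = mat_diag n (\<lambda>i. complex_of_real (sqrt (d i)))"
  have D: "D \<in> carrier_mat n n" and E: "E \<in> carrier_mat n n" by (auto simp: D_def E_def)
  have d: "0 \<le> d i" if "i < n" for i
  proof -
    have "mat_adjoint U * A * U = D" using unitary_conj_cancel[OF AU[folded D_def] U(1) D U(2)] .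
    hence "D $$ (i, i) = sform n (\<lambda>k l. A $$ (k, l)) (\<lambda>k. U $$ (k, i)) (\<lambda>k. U $$ (k, i))"
      using sform_entry[OF U(1) A(1) U(1) that that] by simp
    hence "0 \<le> Re (D $$ (i, i))" using A(2) pos_semidef_sform[OF A(1)] by simp
    thus ?thesis using that by (simp add: D_def mat_diag_def)
  qed
  have EE: "E * E = D"
    unfolding E_def D_def mat_diag_diag by (rule eq_matI) (auto simp: mat_diag_def d simp flip: of_real_mult)
  define B where "B = mat_adjoint (mat_adjoint U) * E * mat_adjoint U"
  have B: "B \<in> carrier_mat n n" using U(1) U' E by (simp add: B_def as)
  have hE: "mat_adjoint E = E" by (simp add: E_def mat_adjoint_mat_diag)
  have hB: "mat_adjoint B = B"
    unfolding B_def using U(1) U' E by (simp add: mat_adjoint_mult[of _ n n _ n] hE as)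
  have pB: "pos_semidef B"
    unfolding pos_semidef_sform[OF B] using hB pos_semidef_mat_diag[of n "\<lambda>i. sqrt (d i)"] d
    unfolding B_def sform_conj[OF U' E] pos_semidef_sform[OF E[unfolded E_def]] by (auto simp: E_def)
  have "B * B = U * E * (mat_adjoint U * U) * E * mat_adjoint U"
    using U(1) U' E by (simp add: B_def as)
  also have "\<dots> = U * (E * E) * mat_adjoint U" unfolding U(2) using U(1) U' E by (simp add: as)
  also have "\<dots> = A" unfolding EE AU D_def ..
  finally have BB: "B * B = A" .
  have "psd_sqrt A = B" by (rule psd_sqrt_eqI[OF A(1) B pB BB])
  thus "psd_sqrt A \<in> carrier_mat n n" "mat_adjoint (psd_sqrt A) = psd_sqrt A" "psd_sqrt A * psd_sqrt A = A"
    using B hB BB by auto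
qed

section \<open>Simultaneous diagonalization and spectral distributions\<close>

text \<open>With \<open>R = U D U\<^sup>*\<close>, the columns of \<open>U D\<^sup>-\<^sup>1\<^sup>/\<^sup>2\<close> are orthonormal for the form of \<open>R\<close>, and remain so
  after a further unitary change of basis that diagonalizes the other form.\<close>

theorem simultaneous_diagonalization:
  fixes R T :: "complex mat"
  assumes R: "R \<in> carrier_mat n n" "mat_adjoint R = R" and T: "T \<in> carrier_mat n n" "mat_adjoint T = T"
    and pos: "\<And>v. \<exists>i<n. v i \<noteq> 0 \<Longrightarrow> 0 < Re (sform n (\<lambda>i j. R $$ (i, j)) v v)"
  shows "\<exists>V l. V \<in> carrier_mat n n \<and> mat_adjoint V * R * V = 1\<^sub>m n \<and>
     mat_adjoint V * T * V = mat_diag n (\<lambda>i. complex_of_real (l i))"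
proof -
  note as = assoc_mult_mat[of _ n n _ n _ n] mult_carrier_mat[of _ n n _ n]
  obtain U d where U: "U \<in> carrier_mat n n" "mat_adjoint U * U = 1\<^sub>m n" "U * mat_adjoint U = 1\<^sub>m n"
     and RU: "R = U * mat_diag n (\<lambda>i. complex_of_real (d i)) * mat_adjoint U"
    using spectral_theorem[OF R] by blast
  note U' = mat_adjoint_carrier[OF U(1)]
  define D where "D = mat_diag n (\<lambda>i. complex_of_real (d i))"
  define E where "E = mat_diag n (\<lambda>i. complex_of_real (1 / sqrt (d i)))"
  have D: "D \<in> carrier_mat n n" and E: "E \<in> carrier_mat n n" by (auto simp: D_def E_def)
  have UD: "mat_adjoint U * R * U = D" using unitary_conj_cancel[OF RU[folded D_def] U(1) D U(2)] .
  have d: "0 < d i" if i: "i < n" for i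
  proof -
    have "\<exists>k<n. U $$ (k, i) \<noteq> 0"
    proof (rule ccontr)
      assume "\<not> ?thesis"
      hence "(mat_adjoint U * U) $$ (i, i) = 0" unfolding mult_mat_entry[OF U' U(1) i i] by simp
      thus False unfolding U(2) using i by simp
    qed
    hence "0 < Re (D $$ (i, i))"
      using pos sform_entry[OF U(1) R(1) U(1) i i] UD by simp
    thus ?thesis using i by (simp add: D_def mat_diag_def)
  qed
  have EDE: "E * D * E = 1\<^sub>m n"
    unfolding E_def D_def mat_diag_diag
  proof (rule eq_matI)
    fix i j assume "i < dim_row (1\<^sub>m n :: complex mat)" "j < dim_col (1\<^sub>m n :: complex mat)"
    moreover have "complex_of_real (1 / sqrt (d i)) * complex_of_real (d i) * complex_of_real (1 / sqrt (d i)) = 1" if "i < n" for i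
    proof -
      have "1 / sqrt (d i) * d i * (1 / sqrt (d i)) = 1" using d[OF that] by (simp add: field_simps)
      thus ?thesis unfolding of_real_mult[symmetric] by (metis of_real_1)
    qed
    ultimately show "mat_diag n (\<lambda>i. complex_of_real (1 / sqrt (d i)) * complex_of_real (d i) * complex_of_real (1 / sqrt (d i))) $$ (i, j) = 1\<^sub>m n $$ (i, j)"
      by (auto simp: mat_diag_def simp del: of_real_divide)
  qed (auto simp: mat_diag_def)
  have hE: "mat_adjoint E = E" by (simp add: E_def mat_adjoint_mat_diag)
  define V1 where "V1 = U * E"
  have V1: "V1 \<in> carrier_mat n n" using U(1) E by (simp add: V1_def)
  have V1a: "mat_adjoint V1 = E * mat_adjoint U" unfolding V1_def mat_adjoint_mult[OF U(1) E] hE ..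
  note V1' = mat_adjoint_carrier[OF V1]
  have RV1: "mat_adjoint V1 * R * V1 = 1\<^sub>m n"
  proof -
    have "mat_adjoint V1 * R * V1 = E * (mat_adjoint U * R * U) * E"
      unfolding V1a unfolding V1_def using U(1) U' E R by (simp add: as)
    thus ?thesis unfolding UD EDE .
  qed
  define T1 where "T1 = mat_adjoint V1 * T * V1"
  have T1: "T1 \<in> carrier_mat n n" using V1 V1' T by (simp add: T1_def as)
  have hT1: "mat_adjoint T1 = T1"
    unfolding T1_def using V1 V1' T by (simp add: mat_adjoint_mult[of _ n n _ n] as)
  obtain W l where W: "W \<in> carrier_mat n n" "mat_adjoint W * W = 1\<^sub>m n" "W * mat_adjoint W = 1\<^sub>m n"
     and TW: "T1 = W * mat_diag n (\<lambda>i. complex_of_real (l i)) * mat_adjoint W"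
    using spectral_theorem[OF T1 hT1] by blast
  note W' = mat_adjoint_carrier[OF W(1)]
  define V where "V = V1 * W"
  have V: "V \<in> carrier_mat n n" using V1 W by (simp add: V_def)
  have Va: "mat_adjoint V = mat_adjoint W * mat_adjoint V1" unfolding V_def mat_adjoint_mult[OF V1 W(1)] ..
  have "mat_adjoint V * R * V = mat_adjoint W * (mat_adjoint V1 * R * V1) * W"
    unfolding Va unfolding V_def using V1 V1' W(1) W' R by (simp add: as)
  hence 1: "mat_adjoint V * R * V = 1\<^sub>m n" unfolding RV1 using W W' by simp
  have "mat_adjoint V * T * V = mat_adjoint W * T1 * W"
    unfolding Va T1_def unfolding V_def using V1 V1' W(1) W' T by (simp add: as)
  hence 2: "mat_adjoint V * T * V = mat_diag n (\<lambda>i. complex_of_real (l i))" 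
    using unitary_conj_cancel[OF TW W(1) mat_diag_dim W(2)] by simp
  from V 1 2 show ?thesis by blast
qed

text \<open>\<open>V\<^sup>* R V = 1\<close> means \<open>R\<inverse> = V V\<^sup>*\<close> and \<open>V\<inverse> = V\<^sup>* R\<close>, so \<open>R\<inverse> T = V (V\<^sup>* T V) V\<inverse>\<close>.\<close>

lemma char_poly_inverse_mult:
  fixes R T :: "complex mat"
  assumes R: "R \<in> carrier_mat n n" and T: "T \<in> carrier_mat n n" and V: "V \<in> carrier_mat n n"
    and RV: "mat_adjoint V * R * V = 1\<^sub>m n"
    and TV: "mat_adjoint V * T * V = mat_diag n d"
  shows "char_poly (the (mat_inverse R) * T) = (\<Prod>i\<leftarrow>[0..<n]. [:- d i, 1:])"
proof -
  note as = assoc_mult_mat[of _ n n _ n _ n] mult_carrier_mat[of _ n n _ n]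
  note V' = mat_adjoint_carrier[OF V]
  define D where "D = mat_diag n d"
  have D: "D \<in> carrier_mat n n" by (simp add: D_def)
  have "mat_adjoint V * (R * V) = 1\<^sub>m n" using RV R V V' by (simp add: as)
  hence RVV: "R * V * mat_adjoint V = 1\<^sub>m n"
    using mat_mult_left_right_inverse[OF V' mult_carrier_mat[OF R V]] by simp
  have VVR: "V * (mat_adjoint V * R) = 1\<^sub>m n"
    using mat_mult_left_right_inverse[OF mult_carrier_mat[OF V' R] V RV] .
  have "R \<in> Units (ring_mat TYPE(complex) n ())"
    unfolding Units_def using R V V' RVV VVR
    by (auto simp: ring_mat_simps as intro!: bexI[of _ "V * mat_adjoint V"])
  then obtain B where B: "mat_inverse R = Some B" "R * B = 1\<^sub>m n" "B * R = 1\<^sub>m n" "B \<in> carrier_mat n n"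
    using mat_inverse(1)[OF R, where b = "()"] mat_inverse(2)[OF R] by (cases "mat_inverse R") auto
  have "B = B * (R * V * mat_adjoint V)" unfolding RVV using B by simp
  also have "\<dots> = (B * R) * (V * mat_adjoint V)"
    using assoc_mult_mat[OF B(4) R mult_carrier_mat[OF V V']] assoc_mult_mat[OF R V V'] by simp
  finally have BV: "B = V * mat_adjoint V" using B V V' by simp
  have "B * T = V * mat_adjoint V * T * (V * (mat_adjoint V * R))"
    unfolding VVR BV using V V' T by (simp add: as)
  also have "\<dots> = V * (mat_adjoint V * T * V) * (mat_adjoint V * R)" using V V' T R by (simp add: as)
  finally have BT: "B * T = V * D * (mat_adjoint V * R)" unfolding TV D_def .
  have "similar_mat_wit (B * T) D V (mat_adjoint V * R)"
    by (rule similar_mat_witI[of _ _ n]) (use BT B T D V V' R RV VVR in \<open>auto simp: as\<close>)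
  hence "char_poly (B * T) = char_poly D" by (intro char_poly_similar) (auto simp: similar_mat_def)
  also have "\<dots> = (\<Prod>a\<leftarrow>diag_mat D. [:- a, 1:])"
    by (rule char_poly_upper_triangular[OF D]) (auto simp: D_def mat_diag_def)
  also have "diag_mat D = map d [0..<n]" by (auto simp: diag_mat_def D_def mat_diag_def)
  finally show ?thesis using B by (simp add: o_def)
qed

lemma esd_eq_distr:
  assumes "char_poly A = (\<Prod>i\<leftarrow>[0..<n]. [:- complex_of_real (l i), 1:])" and n: "0 < n"
  shows "esd A = distr (measure_pmf (pmf_of_set {..<n})) borel l"
proof -
  have "proots (\<Prod>i\<leftarrow>[0..<n]. [:- complex_of_real (l i), 1:]) = image_mset (\<lambda>i. complex_of_real (l i)) (mset_set {..<n})" for n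
  proof (induction n)
    case (Suc n)
    have "(\<Prod>i\<leftarrow>[0..<n]. [:- complex_of_real (l i), 1:]) \<noteq> 0" by (auto simp: prod_list_zero_iff)
    hence "proots ((\<Prod>i\<leftarrow>[0..<n]. [:- complex_of_real (l i), 1:]) * [:- complex_of_real (l n), 1:]) =
      image_mset (\<lambda>i. complex_of_real (l i)) (mset_set {..<n}) + {#complex_of_real (l n)#}"
      by (subst proots_mult) (auto simp: Suc)
    thus ?case by (simp add: lessThan_Suc del: mult_pCons_left mult_pCons_right)
  qed simp
  hence "pmf_of_multiset (proots (char_poly A)) = map_pmf (\<lambda>i. complex_of_real (l i)) (pmf_of_set {..<n})"
    using map_pmf_of_set[of "{..<n}" "\<lambda>i. complex_of_real (l i)"] n assms(1) by (simp add: lessThan_empty_iff)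
  thus ?thesis unfolding esd_def by (simp add: map_pmf_rep_eq distr_distr o_def)
qed

text \<open>Markov's inequality: at most \<open>\<Sum> \<bar>l\<^sub>i - a\<bar> / \<bar>x - a\<bar>\<close> of the points lie on the other side of \<open>x\<close> from \<open>a\<close>.\<close>

lemma weak_conv_esd_dirac:
  fixes l :: "nat \<Rightarrow> nat \<Rightarrow> real"
  assumes lim: "(\<lambda>n. (\<Sum>i<n. \<bar>l n i - a\<bar>) / n) \<longlonglongrightarrow> 0"
    and mu: "\<And>n. 0 < n \<Longrightarrow> \<mu> n = distr (measure_pmf (pmf_of_set {..<n})) borel (l n)"
  shows "weak_conv_m \<mu> (return borel a)"
  unfolding weak_conv_m_def weak_conv_def
proof (intro allI impI)
  fix x assume cont: "isCont (cdf (return borel a)) x"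
  have cd: "cdf (return borel a) y = (if a \<le> y then 1 else 0)" for y :: real
    by (simp add: cdf_def measure_return)
  have "x \<noteq> a"
  proof
    assume "x = a"
    hence "((cdf (return borel a)) \<longlongrightarrow> 1) (at_left a)"
      using cont by (auto simp: isCont_def cd filterlim_at_split)
    moreover have "((cdf (return borel a)) \<longlongrightarrow> 0) (at_left a)"
      by (rule tendsto_eventually) (auto simp: cd eventually_at_filter)
    ultimately show False using tendsto_unique[of "at_left a"] by force
  qed
  define \<eta> where "\<eta> = \<bar>x - a\<bar>"
  have eta: "0 < \<eta>" using \<open>x \<noteq> a\<close> by (simp add: \<eta>_def)
  have cdf: "cdf (\<mu> n) x = card {i\<in>{..<n}. l n i \<le> x} / n" if "0 < n" for n
  proof -
    have "{..<n} \<inter> l n -` {..x} = {i\<in>{..<n}. l n i \<le> x}" by auto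
    thus ?thesis unfolding cdf_def mu[OF that] using that
      by (subst measure_distr) (auto simp: measure_pmf_of_set lessThan_empty_iff)
  qed
  have key: "\<bar>cdf (\<mu> n) x - (if a \<le> x then 1 else 0)\<bar> \<le> (\<Sum>i<n. \<bar>l n i - a\<bar>) / n / \<eta>" if n: "0 < n" for n
  proof -
    have markov: "card {i\<in>{..<n}. Q i} \<le> (\<Sum>i<n. \<bar>l n i - a\<bar>) / \<eta>" if Q: "\<And>i. Q i \<Longrightarrow> \<eta> \<le> \<bar>l n i - a\<bar>" for Q
    proof -
      have "card {i\<in>{..<n}. Q i} * \<eta> = (\<Sum>i\<in>{i\<in>{..<n}. Q i}. \<eta>)" by simp
      also have "\<dots> \<le> (\<Sum>i\<in>{i\<in>{..<n}. Q i}. \<bar>l n i - a\<bar>)" by (intro sum_mono) (use Q in auto)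
      also have "\<dots> \<le> (\<Sum>i<n. \<bar>l n i - a\<bar>)" by (intro sum_mono2) auto
      finally show ?thesis using eta by (simp add: field_simps)
    qed
    show ?thesis
    proof (cases "a \<le> x")
      case True
      have "card {i\<in>{..<n}. l n i \<le> x} + card {i\<in>{..<n}. \<not> l n i \<le> x} = card ({i\<in>{..<n}. l n i \<le> x} \<union> {i\<in>{..<n}. \<not> l n i \<le> x})"
        by (subst card_Un_disjoint) auto
      also have "{i\<in>{..<n}. l n i \<le> x} \<union> {i\<in>{..<n}. \<not> l n i \<le> x} = {..<n}" by auto
      finally have "real (card {i\<in>{..<n}. l n i \<le> x}) = n - real (card {i\<in>{..<n}. \<not> l n i \<le> x})" by simp
      hence "\<bar>cdf (\<mu> n) x - 1\<bar> = card {i\<in>{..<n}. \<not> l n i \<le> x} / n"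
        unfolding cdf[OF n] using n by (simp add: field_simps)
      also have "\<dots> \<le> ((\<Sum>i<n. \<bar>l n i - a\<bar>) / \<eta>) / n"
        by (intro divide_right_mono markov) (use True in \<open>auto simp: \<eta>_def\<close>)
      finally show ?thesis using True by (simp add: mult_ac)
    next
      case False
      have "cdf (\<mu> n) x \<le> ((\<Sum>i<n. \<bar>l n i - a\<bar>) / \<eta>) / n" unfolding cdf[OF n]
        by (intro divide_right_mono markov) (use False in \<open>auto simp: \<eta>_def\<close>)
      thus ?thesis using False by (simp add: mult_ac cdf[OF n])
    qed
  qed
  have "(\<lambda>n. (\<Sum>i<n. \<bar>l n i - a\<bar>) / n / \<eta>) \<longlonglongrightarrow> 0" using tendsto_divide[OF lim tendsto_const, of \<eta>] eta by simp
  moreover have "\<forall>\<^sub>F n in sequentially. norm (cdf (\<mu> n) x - cdf (return borel a) x) \<le> (\<Sum>i<n. \<bar>l n i - a\<bar>) / n / \<eta>"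
    using eventually_gt_at_top[of 0] by eventually_elim (use key in \<open>simp add: cd\<close>)
  ultimately have "(\<lambda>n. cdf (\<mu> n) x - cdf (return borel a) x) \<longlonglongrightarrow> 0"
    by (rule Lim_null_comparison[rotated])
  thus "(\<lambda>n. cdf (\<mu> n) x) \<longlonglongrightarrow> cdf (return borel a) x" using LIM_zero_iff by blast
qed

lemma sum_swap_pairs:
  "(\<Sum>p\<in>A. \<Sum>q\<in>B. \<Sum>i\<in>C. \<Sum>j\<in>D. f p q i j) = (\<Sum>i\<in>C. \<Sum>j\<in>D. \<Sum>p\<in>A. \<Sum>q\<in>B. f p q i j)"
proof -
  have "(\<Sum>p\<in>A. \<Sum>q\<in>B. \<Sum>i\<in>C. \<Sum>j\<in>D. f p q i j) = (\<Sum>p\<in>A. \<Sum>i\<in>C. \<Sum>j\<in>D. \<Sum>q\<in>B. f p q i j)"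
    by (rule sum.cong[OF refl], subst sum.swap, rule sum.cong[OF refl], rule sum.swap)
  also have "\<dots> = (\<Sum>i\<in>C. \<Sum>j\<in>D. \<Sum>p\<in>A. \<Sum>q\<in>B. f p q i j)"
    by (subst sum.swap, rule sum.cong[OF refl], rule sum.swap)
  finally show ?thesis .
qed

text \<open>Bessel's inequality in the inner product of \<open>R\<close>; the bound \<open>R \<ge> m\<close> turns the dual norm of the
  functional given by \<open>e\<close> into a multiple of its Euclidean norm.\<close>

lemma bessel_sform:
  fixes v :: "nat \<Rightarrow> nat \<Rightarrow> complex"
  assumes orth: "\<And>i j. i < k \<Longrightarrow> j < k \<Longrightarrow> sform n R (v i) (v j) = (if i = j then 1 else 0)"
    and low: "\<And>w. m * (\<Sum>i<n. (cmod (w i))\<^sup>2) \<le> Re (sform n R w w)" and m: "0 < m"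
  shows "(\<Sum>i<k. (cmod (\<Sum>j<n. v i j * e j))\<^sup>2) \<le> (\<Sum>j<n. (cmod (e j))\<^sup>2) / m"
proof -
  \<comment> \<open>The combination \<open>w\<close> pairs with \<open>e\<close> to \<open>Q\<close> and has square \<open>Q\<close> for the form, so that Cauchy--Schwarz
    gives \<open>Q\<^sup>2 \<le> \<bar>w\<bar>\<^sup>2 \<bar>e\<bar>\<^sup>2 \<le> (Q / m) \<bar>e\<bar>\<^sup>2\<close>.\<close>
  define b where "b i = cnj (\<Sum>j<n. v i j * e j)" for i
  define Q where "Q = (\<Sum>i<k. (cmod (b i))\<^sup>2)"
  define w where "w j = (\<Sum>i<k. b i * v i j)" for j
  have "sform n R w w = (\<Sum>i<k. \<Sum>i'<k. cnj (b i) * b i' * sform n R (v i) (v i'))"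
  proof -
    have "sform n R w w = (\<Sum>p<n. \<Sum>q<n. \<Sum>i<k. \<Sum>i'<k. cnj (b i) * b i' * (cnj (v i p) * R p q * v i' q))"
      unfolding sform_def w_def cnj_sum complex_cnj_mult sum_distrib_left sum_distrib_right
      by (rule sum.cong[OF refl], rule sum.cong[OF refl], subst sum.swap, intro sum.cong refl) (simp add: mult_ac)
    also have "\<dots> = (\<Sum>i<k. \<Sum>i'<k. \<Sum>p<n. \<Sum>q<n. cnj (b i) * b i' * (cnj (v i p) * R p q * v i' q))"
      by (rule sum_swap_pairs)
    finally show ?thesis by (simp add: sform_def sum_distrib_left)
  qed
  also have "\<dots> = (\<Sum>i<k. \<Sum>i'<k. if i = i' then cnj (b i) * b i else 0)"
    by (intro sum.cong refl) (auto simp: orth)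
  also have "\<dots> = of_real Q" unfolding Q_def of_real_sum complex_norm_square
    by (rule sum.cong[OF refl], subst sum.delta') (auto simp: mult.commute)
  finally have ww: "Re (sform n R w w) = Q" by simp
  have we: "(\<Sum>j<n. w j * e j) = of_real Q"
  proof -
    have "(\<Sum>j<n. w j * e j) = (\<Sum>i<k. b i * (\<Sum>j<n. v i j * e j))"
      unfolding w_def sum_distrib_left sum_distrib_right by (subst sum.swap) (simp add: mult_ac)
    also have "\<dots> = (\<Sum>i<k. b i * cnj (b i))" by (simp add: b_def)
    finally show ?thesis unfolding Q_def of_real_sum complex_norm_square .
  qed
  have Q0: "0 \<le> Q" unfolding Q_def by (intro sum_nonneg) auto
  have "Q = cmod (\<Sum>j<n. w j * e j)" unfolding we using Q0 by simp
  also have "\<dots> \<le> (\<Sum>j<n. \<bar>cmod (w j)\<bar> * \<bar>cmod (e j)\<bar>)"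
    by (rule order.trans[OF norm_sum]) (simp add: norm_mult)
  also have "\<dots> \<le> L2_set (\<lambda>j. cmod (w j)) {..<n} * L2_set (\<lambda>j. cmod (e j)) {..<n}"
    by (rule L2_set_mult_ineq)
  finally have "Q\<^sup>2 \<le> (L2_set (\<lambda>j. cmod (w j)) {..<n} * L2_set (\<lambda>j. cmod (e j)) {..<n})\<^sup>2"
    using Q0 by (rule power_mono)
  also have "\<dots> = (\<Sum>j<n. (cmod (w j))\<^sup>2) * (\<Sum>j<n. (cmod (e j))\<^sup>2)"
    unfolding power_mult_distrib L2_set_def by (simp add: sum_nonneg)
  also have "\<dots> \<le> (Q / m) * (\<Sum>j<n. (cmod (e j))\<^sup>2)"
    using low[of w] m unfolding ww by (intro mult_right_mono) (auto simp: field_simps sum_nonneg)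
  finally have "Q * Q \<le> Q * ((\<Sum>j<n. (cmod (e j))\<^sup>2) / m)" by (simp add: power2_eq_square)
  moreover have "0 \<le> (\<Sum>j<n. (cmod (e j))\<^sup>2) / m" using m by (simp add: sum_nonneg)
  ultimately have "Q \<le> (\<Sum>j<n. (cmod (e j))\<^sup>2) / m" using Q0
    by (metis mult_le_cancel_left_pos order_le_less)
  thus ?thesis by (simp only: Q_def b_def complex_mod_cnj)
qed

section \<open>Gaussian laws\<close>

abbreviation normal_law :: "real \<Rightarrow> real measure" where
  "normal_law s \<equiv> density lborel (\<lambda>x. ennreal (normal_density 0 s x))"

lemma normal_law_prob: "0 < s \<Longrightarrow> prob_space (normal_law s)"
  by (rule prob_space_normal_density)

text \<open>Completing the square: multiplying a centred normal density by \<open>exp (t x)\<close> shifts it by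
  \<open>s\<^sup>2 t\<close>.\<close>

lemma normal_law_exp:
  assumes s: "0 < s"
  shows "(\<integral>\<^sup>+x. ennreal (exp (t * x)) \<partial>normal_law s) = ennreal (exp (s\<^sup>2 * t\<^sup>2 / 2))"
proof -
  have e: "normal_density 0 s x * exp (t * x) = exp (s\<^sup>2 * t\<^sup>2 / 2) * normal_density (s\<^sup>2 * t) s x" for x
  proof -
    have "- (x - 0)\<^sup>2 / (2 * s\<^sup>2) + t * x = s\<^sup>2 * t\<^sup>2 / 2 + - (x - s\<^sup>2 * t)\<^sup>2 / (2 * s\<^sup>2)"
      using s by (simp add: field_simps power2_eq_square)
    hence "exp (- (x - 0)\<^sup>2 / (2 * s\<^sup>2)) * exp (t * x) = exp (s\<^sup>2 * t\<^sup>2 / 2) * exp (- (x - s\<^sup>2 * t)\<^sup>2 / (2 * s\<^sup>2))"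
      unfolding exp_add[symmetric] by simp
    thus ?thesis unfolding normal_density_def by (simp add: mult_ac)
  qed
  have "(\<integral>\<^sup>+x. ennreal (exp (t * x)) \<partial>normal_law s) = (\<integral>\<^sup>+x. ennreal (normal_density 0 s x * exp (t * x)) \<partial>lborel)"
    by (subst nn_integral_density) (auto simp: ennreal_mult)
  also have "\<dots> = (\<integral>\<^sup>+x. ennreal (exp (s\<^sup>2 * t\<^sup>2 / 2)) * ennreal (normal_density (s\<^sup>2 * t) s x) \<partial>lborel)"
    unfolding e by (simp add: ennreal_mult)
  also have "\<dots> = ennreal (exp (s\<^sup>2 * t\<^sup>2 / 2)) * (\<integral>\<^sup>+x. ennreal (normal_density (s\<^sup>2 * t) s x) \<partial>lborel)"
    by (rule nn_integral_cmult) simp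
  also have "(\<integral>\<^sup>+x. ennreal (normal_density (s\<^sup>2 * t) s x) \<partial>lborel) = 1"
    using s by (subst nn_integral_eq_integral) auto
  finally show ?thesis by simp
qed

lemma normal_law_exp_square:
  "(\<integral>\<^sup>+x. ennreal (exp (x\<^sup>2 / 4)) \<partial>normal_law 1) = ennreal (sqrt 2)"
proof -
  have e: "std_normal_density x * exp (x\<^sup>2 / 4) = sqrt 2 * normal_density 0 (sqrt 2) x" for x
  proof -
    have 1: "exp (- (x - 0)\<^sup>2 / (2 * 1\<^sup>2)) * exp (x\<^sup>2 / 4) = exp (- (x - 0)\<^sup>2 / (2 * (sqrt 2)\<^sup>2))"
      unfolding exp_add[symmetric] by (simp add: field_simps)
    have 2: "1 / sqrt (2 * pi * 1\<^sup>2) = sqrt 2 * (1 / sqrt (2 * pi * (sqrt 2)\<^sup>2))"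
      by (simp add: real_sqrt_mult field_simps)
    have "1 / sqrt (2 * pi * 1\<^sup>2) * exp (- (x - 0)\<^sup>2 / (2 * 1\<^sup>2)) * exp (x\<^sup>2 / 4) =
      1 / sqrt (2 * pi * 1\<^sup>2) * exp (- (x - 0)\<^sup>2 / (2 * (sqrt 2)\<^sup>2))"
      using 1 by (simp only: mult.assoc)
    also have "\<dots> = sqrt 2 * (1 / sqrt (2 * pi * (sqrt 2)\<^sup>2) * exp (- (x - 0)\<^sup>2 / (2 * (sqrt 2)\<^sup>2)))"
      unfolding 2 by (rule mult.assoc)
    finally show ?thesis unfolding normal_density_def .
  qed
  have "(\<integral>\<^sup>+x. ennreal (exp (x\<^sup>2 / 4)) \<partial>normal_law 1) = (\<integral>\<^sup>+x. ennreal (std_normal_density x * exp (x\<^sup>2 / 4)) \<partial>lborel)"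
    by (subst nn_integral_density) (auto simp: ennreal_mult)
  also have "\<dots> = (\<integral>\<^sup>+x. ennreal (sqrt 2) * ennreal (normal_density 0 (sqrt 2) x) \<partial>lborel)"
    unfolding e by (simp add: ennreal_mult)
  also have "\<dots> = ennreal (sqrt 2) * (\<integral>\<^sup>+x. ennreal (normal_density 0 (sqrt 2) x) \<partial>lborel)"
    by (rule nn_integral_cmult) simp
  also have "(\<integral>\<^sup>+x. ennreal (normal_density 0 (sqrt 2) x) \<partial>lborel) = 1"
    by (subst nn_integral_eq_integral) auto
  finally show ?thesis by simp
qed

lemma cmod_square_add_real_mult:
  "(cmod (A + of_real x * y))\<^sup>2 = (cmod A)\<^sup>2 + 2 * Re (A * cnj y) * x + (cmod y)\<^sup>2 * x\<^sup>2"
  unfolding cmod_power2 by (simp add: power2_eq_square algebra_simps)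

lemma normal_law_square:
  assumes s: "0 < s"
  shows "(\<integral>\<^sup>+x. ennreal ((cmod (A + of_real x * y))\<^sup>2) \<partial>normal_law s) = ennreal ((cmod A)\<^sup>2 + s\<^sup>2 * (cmod y)\<^sup>2)"
proof -
  have 2: "has_bochner_integral lborel (\<lambda>x. normal_density 0 s x * x\<^sup>2) (s\<^sup>2)"
    using normal_moment_even[OF s, of 0 1] s by simp
  have "has_bochner_integral lborel (\<lambda>x. (cmod A)\<^sup>2 * normal_density 0 s x + 2 * Re (A * cnj y) * (normal_density 0 s x * x)
      + (cmod y)\<^sup>2 * (normal_density 0 s x * x\<^sup>2)) ((cmod A)\<^sup>2 * 1 + 2 * Re (A * cnj y) * 0 + (cmod y)\<^sup>2 * s\<^sup>2)"
    using s by (intro has_bochner_integral_add has_bochner_integral_mult_right 2 normal_moment_nz_1)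
       (auto simp: has_bochner_integral_iff)
  hence b: "has_bochner_integral lborel (\<lambda>x. normal_density 0 s x * (cmod (A + of_real x * y))\<^sup>2) ((cmod A)\<^sup>2 + s\<^sup>2 * (cmod y)\<^sup>2)"
    unfolding cmod_square_add_real_mult by (simp add: algebra_simps)
  have "(\<integral>\<^sup>+x. ennreal ((cmod (A + of_real x * y))\<^sup>2) \<partial>normal_law s) = (\<integral>\<^sup>+x. ennreal (normal_density 0 s x * (cmod (A + of_real x * y))\<^sup>2) \<partial>lborel)"
    by (subst nn_integral_density) (auto simp: ennreal_mult)
  also have "\<dots> = ennreal ((cmod A)\<^sup>2 + s\<^sup>2 * (cmod y)\<^sup>2)"
    using b by (subst nn_integral_eq_integral) (auto simp: has_bochner_integral_iff)
  finally show ?thesis .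
qed

text \<open>Mean zero and variance one are expressed by a single identity with a free shift \<open>A\<close>, which
  integrates the square of a linear form one entry at a time.\<close>

definition std_subgaussian :: "complex measure \<Rightarrow> bool" where
  "std_subgaussian \<mu> \<longleftrightarrow> prob_space \<mu> \<and> sets \<mu> = sets borel \<and>
     (\<forall>A y. (\<integral>\<^sup>+z. ennreal ((cmod (A + z * y))\<^sup>2) \<partial>\<mu>) = ennreal ((cmod A)\<^sup>2 + (cmod y)\<^sup>2)) \<and>
     (\<forall>q. (\<integral>\<^sup>+z. ennreal (exp (Re (q * z))) \<partial>\<mu>) \<le> ennreal (exp ((cmod q)\<^sup>2 / 2)))"

lemma std_subgaussian_real: "std_subgaussian real_std_normal"
proof -
  have [measurable]: "complex_of_real \<in> measurable (normal_law 1) borel" by measurable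
  interpret N: prob_space "normal_law 1" by (rule normal_law_prob) simp
  have "prob_space real_std_normal" unfolding real_std_normal_def
    by (rule N.prob_space_distr) measurable
  moreover have "(\<integral>\<^sup>+z. ennreal ((cmod (A + z * y))\<^sup>2) \<partial>real_std_normal) = ennreal ((cmod A)\<^sup>2 + (cmod y)\<^sup>2)" for A y
    unfolding real_std_normal_def by (subst nn_integral_distr) (use normal_law_square[of 1 A y] in auto)
  moreover have "(\<integral>\<^sup>+z. ennreal (exp (Re (q * z))) \<partial>real_std_normal) \<le> ennreal (exp ((cmod q)\<^sup>2 / 2))" for q
  proof -
    have "(\<integral>\<^sup>+z. ennreal (exp (Re (q * z))) \<partial>real_std_normal) = (\<integral>\<^sup>+x. ennreal (exp (Re q * x)) \<partial>normal_law 1)"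
      unfolding real_std_normal_def by (subst nn_integral_distr) auto
    also have "\<dots> = ennreal (exp ((Re q)\<^sup>2 / 2))" using normal_law_exp[of 1 "Re q"] by simp
    also have "\<dots> \<le> ennreal (exp ((cmod q)\<^sup>2 / 2))" by (intro ennreal_leI) (simp add: cmod_power2)
    finally show ?thesis .
  qed
  ultimately show ?thesis by (simp add: std_subgaussian_def real_std_normal_def)
qed

lemma std_subgaussian_complex: "std_subgaussian complex_std_normal"
proof -
  define N where "N = normal_law (sqrt (1/2))"
  interpret N: prob_space N unfolding N_def by (rule normal_law_prob) simp
  interpret NN: pair_prob_space N N ..
  have [measurable_cong]: "sets N = sets borel" by (simp add: N_def)
  have [measurable]: "(\<lambda>(x, y). Complex x y) \<in> measurable (N \<Otimes>\<^sub>M N) borel"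
    unfolding Complex_eq split_beta by measurable
  have cs: "complex_std_normal = distr (N \<Otimes>\<^sub>M N) borel (\<lambda>(x, y). Complex x y)"
    by (simp add: complex_std_normal_def N_def)
  have int: "(\<integral>\<^sup>+z. g z \<partial>complex_std_normal) = (\<integral>\<^sup>+v. \<integral>\<^sup>+u. g (Complex u v) \<partial>N \<partial>N)" if [measurable]: "g \<in> borel_measurable borel" for g
  proof -
    have "(\<integral>\<^sup>+z. g z \<partial>complex_std_normal) = (\<integral>\<^sup>+p. g (case p of (x, y) \<Rightarrow> Complex x y) \<partial>(N \<Otimes>\<^sub>M N))"
      unfolding cs by (subst nn_integral_distr) auto
    also have "\<dots> = (\<integral>\<^sup>+v. \<integral>\<^sup>+u. g (Complex u v) \<partial>N \<partial>N)"
      by (subst NN.nn_integral_snd[symmetric]) (auto simp: split_beta)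
    finally show ?thesis .
  qed
  have "prob_space complex_std_normal" unfolding cs by (rule NN.prob_space_distr) measurable
  moreover have "(\<integral>\<^sup>+z. ennreal ((cmod (A + z * y))\<^sup>2) \<partial>complex_std_normal) = ennreal ((cmod A)\<^sup>2 + (cmod y)\<^sup>2)" for A y
  proof -
    have "(\<integral>\<^sup>+z. ennreal ((cmod (A + z * y))\<^sup>2) \<partial>complex_std_normal) = 
      (\<integral>\<^sup>+v. \<integral>\<^sup>+u. ennreal ((cmod ((A + of_real v * (\<i> * y)) + of_real u * y))\<^sup>2) \<partial>N \<partial>N)"
      by (subst int) (simp_all add: Complex_eq algebra_simps)
    also have "\<dots> = (\<integral>\<^sup>+v. ennreal ((cmod (A + of_real v * (\<i> * y)))\<^sup>2) + ennreal ((cmod y)\<^sup>2 / 2) \<partial>N)"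
      unfolding N_def by (subst normal_law_square) (simp_all add: power2_eq_square)
    also have "\<dots> = (\<integral>\<^sup>+v. ennreal ((cmod (A + of_real v * (\<i> * y)))\<^sup>2) \<partial>N) + ennreal ((cmod y)\<^sup>2 / 2)"
      by (subst nn_integral_add) (auto simp: N.emeasure_space_1)
    also have "\<dots> = ennreal ((cmod A)\<^sup>2 + (cmod y)\<^sup>2 / 2) + ennreal ((cmod y)\<^sup>2 / 2)"
      unfolding N_def by (subst normal_law_square) (simp_all add: norm_mult power_mult_distrib power_divide)
    also have "\<dots> = ennreal ((cmod A)\<^sup>2 + (cmod y)\<^sup>2)"
      by (subst ennreal_plus[symmetric]) auto
    finally show ?thesis .
  qed
  moreover have "(\<integral>\<^sup>+z. ennreal (exp (Re (q * z))) \<partial>complex_std_normal) \<le> ennreal (exp ((cmod q)\<^sup>2 / 2))" for q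
  proof -
    have "(\<integral>\<^sup>+z. ennreal (exp (Re (q * z))) \<partial>complex_std_normal) =
       (\<integral>\<^sup>+v. \<integral>\<^sup>+u. ennreal (exp (- Im q * v)) * ennreal (exp (Re q * u)) \<partial>N \<partial>N)"
      by (subst int) (simp_all add: exp_add[symmetric] algebra_simps flip: ennreal_mult)
    also have "\<dots> = (\<integral>\<^sup>+v. ennreal (exp (- Im q * v)) * ennreal (exp ((Re q)\<^sup>2 / 4)) \<partial>N)"
      unfolding N_def by (subst nn_integral_cmult, simp, subst normal_law_exp) (simp_all add: power_divide)
    also have "\<dots> = ennreal (exp ((Im q)\<^sup>2 / 4)) * ennreal (exp ((Re q)\<^sup>2 / 4))"
      unfolding N_def by (subst nn_integral_multc, simp, subst normal_law_exp) (simp_all add: power_divide)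
    also have "\<dots> = ennreal (exp ((Im q)\<^sup>2 / 4 + (Re q)\<^sup>2 / 4))"
      by (simp add: exp_add ennreal_mult)
    also have "\<dots> \<le> ennreal (exp ((cmod q)\<^sup>2 / 2))" 
    proof (intro ennreal_leI, subst exp_le_cancel_iff)
      have q: "x / 4 + y / 4 \<le> (y + x) / 2" if "0 \<le> x" "0 \<le> y" for x y :: real
        using that by simp
      show "(Im q)\<^sup>2 / 4 + (Re q)\<^sup>2 / 4 \<le> (cmod q)\<^sup>2 / 2"
        unfolding cmod_power2 by (rule q) simp_all
    qed
    finally show ?thesis .
  qed
  ultimately show ?thesis by (simp add: std_subgaussian_def cs)
qed

section \<open>Exponential moments of linear forms of a row\<close>

lemma std_subgaussian_product_square:
  assumes mu: "std_subgaussian \<mu>" and I: "finite I"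
  shows "(\<integral>\<^sup>+z. ennreal ((cmod (A + (\<Sum>j\<in>I. z j * y j)))\<^sup>2) \<partial>PiM I (\<lambda>_. \<mu>)) = ennreal ((cmod A)\<^sup>2 + (\<Sum>j\<in>I. (cmod (y j))\<^sup>2))"
proof -
  interpret mu: prob_space \<mu> using mu by (simp add: std_subgaussian_def)
  have [measurable_cong]: "sets \<mu> = sets borel" using mu by (simp add: std_subgaussian_def)
  interpret product_prob_space "\<lambda>_. \<mu>" I by standard
  show ?thesis using I
  proof (induction I arbitrary: A)
    case empty
    show ?case by (simp add: PiM_empty)
  next
    case (insert i I)
    have "(\<integral>\<^sup>+z. ennreal ((cmod (A + (\<Sum>j\<in>insert i I. z j * y j)))\<^sup>2) \<partial>PiM (insert i I) (\<lambda>_. \<mu>)) =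
      (\<integral>\<^sup>+z. \<integral>\<^sup>+x. ennreal ((cmod (A + (\<Sum>j\<in>insert i I. (z(i := x)) j * y j)))\<^sup>2) \<partial>\<mu> \<partial>PiM I (\<lambda>_. \<mu>))"
      by (rule product_nn_integral_insert) (use insert in \<open>auto\<close>)
    also have "\<dots> = (\<integral>\<^sup>+z. \<integral>\<^sup>+x. ennreal ((cmod ((A + (\<Sum>j\<in>I. z j * y j)) + x * y i))\<^sup>2) \<partial>\<mu> \<partial>PiM I (\<lambda>_. \<mu>))"
    proof (intro nn_integral_cong)
      fix z x
      have "(\<Sum>j\<in>I. (z(i := x)) j * y j) = (\<Sum>j\<in>I. z j * y j)"
        using insert by (intro sum.cong) auto
      thus "ennreal ((cmod (A + (\<Sum>j\<in>insert i I. (z(i := x)) j * y j)))\<^sup>2) = ennreal ((cmod ((A + (\<Sum>j\<in>I. z j * y j)) + x * y i))\<^sup>2)"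
        using insert by (simp add: add_ac)
    qed
    also have "\<dots> = (\<integral>\<^sup>+z. ennreal ((cmod (A + (\<Sum>j\<in>I. z j * y j)))\<^sup>2) + ennreal ((cmod (y i))\<^sup>2) \<partial>PiM I (\<lambda>_. \<mu>))"
      using mu by (simp add: std_subgaussian_def)
    also have "\<dots> = (\<integral>\<^sup>+z. ennreal ((cmod (A + (\<Sum>j\<in>I. z j * y j)))\<^sup>2) \<partial>PiM I (\<lambda>_. \<mu>)) + ennreal ((cmod (y i))\<^sup>2)"
      using prob_space.emeasure_space_1[OF prob_space_PiM[of I "\<lambda>_. \<mu>"]] mu.prob_space_axioms by (subst nn_integral_add) (auto)
    also have "\<dots> = ennreal ((cmod A)\<^sup>2 + (\<Sum>j\<in>insert i I. (cmod (y j))\<^sup>2))"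
      unfolding insert.IH using insert by (subst ennreal_plus[symmetric]) (auto simp: sum_nonneg add_ac)
    finally show ?case .
  qed
qed

text \<open>A Gaussian integral linearises the square in the exponent.\<close>

lemma exp_cmod_square_linearised:
  "(\<integral>\<^sup>+u. \<integral>\<^sup>+v. ennreal (exp (Re (Complex (u / sqrt 2) (- v / sqrt 2) * w))) \<partial>normal_law 1 \<partial>normal_law 1)
     = ennreal (exp ((cmod w)\<^sup>2 / 4))"
proof -
  have "(\<integral>\<^sup>+u. \<integral>\<^sup>+v. ennreal (exp (Re (Complex (u / sqrt 2) (- v / sqrt 2) * w))) \<partial>normal_law 1 \<partial>normal_law 1)
     = (\<integral>\<^sup>+u. \<integral>\<^sup>+v. ennreal (exp (Re w / sqrt 2 * u)) * ennreal (exp (Im w / sqrt 2 * v)) \<partial>normal_law 1 \<partial>normal_law 1)"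
    by (simp add: mult_ac exp_add flip: ennreal_mult)
  also have "\<dots> = (\<integral>\<^sup>+u. ennreal (exp (Re w / sqrt 2 * u)) * ennreal (exp ((Im w)\<^sup>2 / 4)) \<partial>normal_law 1)"
    by (subst nn_integral_cmult, simp, subst normal_law_exp) (simp_all add: power_divide)
  also have "\<dots> = ennreal (exp ((Re w)\<^sup>2 / 4)) * ennreal (exp ((Im w)\<^sup>2 / 4))"
    by (subst nn_integral_multc, simp, subst normal_law_exp) (simp_all add: power_divide)
  also have "\<dots> = ennreal (exp ((cmod w)\<^sup>2 / 4))"
    unfolding cmod_power2 add_divide_distrib exp_add by (simp add: ennreal_mult)
  finally show ?thesis .
qed

text \<open>After linearisation of the square, the integral over the product measure factorizes. It leaves
  \<open>exp ((u\<^sup>2 + v\<^sup>2) / 4)\<close>, whose integral over the auxiliary normal variables \<open>u\<close> and \<open>v\<close> is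
  \<open>\<surd>2 \<cdot> \<surd>2\<close>.\<close>

lemma std_subgaussian_product_exp:
  assumes mu: "std_subgaussian \<mu>" and I: "finite I" and y: "(\<Sum>j\<in>I. (cmod (y j))\<^sup>2) = 1"
  shows "(\<integral>\<^sup>+z. ennreal (exp ((cmod (\<Sum>j\<in>I. z j * y j))\<^sup>2 / 4)) \<partial>PiM I (\<lambda>_. \<mu>)) \<le> 2"
proof -
  interpret mu: prob_space \<mu> using mu by (simp add: std_subgaussian_def)
  have [measurable_cong]: "sets \<mu> = sets borel" using mu by (simp add: std_subgaussian_def)
  interpret product_prob_space "\<lambda>_. \<mu>" I by standard
  interpret PI: prob_space "PiM I (\<lambda>_. \<mu>)" by (rule prob_space_PiM) (rule mu.prob_space_axioms)
  interpret N: prob_space "normal_law 1" by (rule normal_law_prob) simp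
  interpret PN: pair_prob_space "PiM I (\<lambda>_. \<mu>)" "normal_law 1" ..
  have linear: "(\<integral>\<^sup>+z. ennreal (exp (Re (q * (\<Sum>j\<in>I. z j * y j)))) \<partial>PiM I (\<lambda>_. \<mu>)) \<le> ennreal (exp ((cmod q)\<^sup>2 / 2))" for q
  proof -
    have "(\<integral>\<^sup>+z. ennreal (exp (Re (q * (\<Sum>j\<in>I. z j * y j)))) \<partial>PiM I (\<lambda>_. \<mu>)) = 
      (\<integral>\<^sup>+z. (\<Prod>j\<in>I. ennreal (exp (Re ((q * y j) * z j)))) \<partial>PiM I (\<lambda>_. \<mu>))"
    proof (rule nn_integral_cong)
      fix z
      have "Re (q * (\<Sum>j\<in>I. z j * y j)) = (\<Sum>j\<in>I. Re ((q * y j) * z j))"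
        unfolding sum_distrib_left Re_sum by (intro sum.cong refl) (simp only: ac_simps)
      thus "ennreal (exp (Re (q * (\<Sum>j\<in>I. z j * y j)))) = (\<Prod>j\<in>I. ennreal (exp (Re ((q * y j) * z j))))"
        using I by (simp only: exp_sum prod_ennreal exp_ge_zero)
    qed
    also have "\<dots> = (\<Prod>j\<in>I. \<integral>\<^sup>+x. ennreal (exp (Re ((q * y j) * x))) \<partial>\<mu>)"
      by (rule product_nn_integral_prod[OF I]) measurable
    also have "\<dots> \<le> (\<Prod>j\<in>I. ennreal (exp ((cmod (q * y j))\<^sup>2 / 2)))"
      using mu unfolding std_subgaussian_def by (intro prod_mono_ennreal) blast
    also have "\<dots> = ennreal (exp (\<Sum>j\<in>I. (cmod (q * y j))\<^sup>2 / 2))"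
      using I by (simp only: exp_sum prod_ennreal exp_ge_zero)
    also have "(\<Sum>j\<in>I. (cmod (q * y j))\<^sup>2 / 2) = (cmod q)\<^sup>2 / 2 * (\<Sum>j\<in>I. (cmod (y j))\<^sup>2)"
      unfolding sum_distrib_left by (intro sum.cong) (auto simp: norm_mult power_mult_distrib)
    finally show ?thesis unfolding y by simp
  qed
  define F where "F z u v = ennreal (exp (Re (Complex (u / sqrt 2) (- v / sqrt 2) * (\<Sum>j\<in>I. z j * y j))))" for z u v
  have "(\<integral>\<^sup>+z. ennreal (exp ((cmod (\<Sum>j\<in>I. z j * y j))\<^sup>2 / 4)) \<partial>PiM I (\<lambda>_. \<mu>)) =
    (\<integral>\<^sup>+z. \<integral>\<^sup>+u. \<integral>\<^sup>+v. F z u v \<partial>normal_law 1 \<partial>normal_law 1 \<partial>PiM I (\<lambda>_. \<mu>))"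
    unfolding exp_cmod_square_linearised[symmetric] F_def ..
  also have "\<dots> = (\<integral>\<^sup>+u. \<integral>\<^sup>+z. \<integral>\<^sup>+v. F z u v \<partial>normal_law 1 \<partial>PiM I (\<lambda>_. \<mu>) \<partial>normal_law 1)"
    by (rule PN.Fubini'[symmetric]) (unfold F_def split_beta Complex_eq, measurable)
  also have "\<dots> = (\<integral>\<^sup>+u. \<integral>\<^sup>+v. \<integral>\<^sup>+z. F z u v \<partial>PiM I (\<lambda>_. \<mu>) \<partial>normal_law 1 \<partial>normal_law 1)"
    by (intro nn_integral_cong PN.Fubini'[symmetric]) (unfold F_def split_beta Complex_eq, measurable)
  also have "\<dots> \<le> (\<integral>\<^sup>+u. \<integral>\<^sup>+v. ennreal (exp (u\<^sup>2 / 4)) * ennreal (exp (v\<^sup>2 / 4)) \<partial>normal_law 1 \<partial>normal_law 1)"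
  proof (intro nn_integral_mono)
    fix u v :: real
    have "(cmod (Complex (u / sqrt 2) (- v / sqrt 2)))\<^sup>2 / 2 = u\<^sup>2 / 4 + v\<^sup>2 / 4"
      unfolding cmod_power2 by (simp add: power_divide)
    thus "(\<integral>\<^sup>+z. F z u v \<partial>PiM I (\<lambda>_. \<mu>)) \<le> ennreal (exp (u\<^sup>2 / 4)) * ennreal (exp (v\<^sup>2 / 4))"
      using linear[of "Complex (u / sqrt 2) (- v / sqrt 2)"] unfolding F_def
      by (simp only: exp_add ennreal_mult exp_ge_zero)
  qed
  also have "\<dots> = (\<integral>\<^sup>+u. ennreal (exp (u\<^sup>2 / 4)) * ennreal (sqrt 2) \<partial>normal_law 1)"
    by (subst nn_integral_cmult) (simp_all add: normal_law_exp_square)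
  also have "\<dots> = ennreal (sqrt 2) * ennreal (sqrt 2)"
    by (subst nn_integral_multc) (simp_all add: normal_law_exp_square)
  also have "\<dots> = 2" by (simp flip: ennreal_mult)
  finally show ?thesis .
qed

text \<open>The only information on the law of a row that enters the concentration argument.\<close>

definition isotropic_subgaussian :: "nat \<Rightarrow> (nat \<Rightarrow> complex) measure \<Rightarrow> bool" where
  "isotropic_subgaussian n \<nu> \<longleftrightarrow> prob_space \<nu> \<and> sets \<nu> = sets (cvec_space n) \<and>
     (\<forall>y. (\<Sum>j<n. (cmod (y j))\<^sup>2) = 1 \<longrightarrow>
        (\<integral>\<^sup>+z. ennreal ((cmod (\<Sum>j<n. z j * y j))\<^sup>2) \<partial>\<nu>) = 1 \<and>
        (\<integral>\<^sup>+z. ennreal (exp ((cmod (\<Sum>j<n. z j * y j))\<^sup>2 / 4)) \<partial>\<nu>) \<le> 2)"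

lemma isotropic_subgaussian_product:
  assumes mu: "std_subgaussian \<mu>"
  shows "isotropic_subgaussian n (PiM {..<n} (\<lambda>_. \<mu>))"
proof -
  have "prob_space (PiM {..<n} (\<lambda>_. \<mu>))" using mu by (intro prob_space_PiM) (simp add: std_subgaussian_def)
  moreover have "sets (PiM {..<n} (\<lambda>_. \<mu>)) = sets (cvec_space n)"
    unfolding cvec_space_def by (intro sets_PiM_cong) (use mu in \<open>auto simp: std_subgaussian_def\<close>)
  ultimately show ?thesis
    using std_subgaussian_product_square[OF mu, of "{..<n}" 0] std_subgaussian_product_exp[OF mu, of "{..<n}"]
    by (auto simp: isotropic_subgaussian_def)
qed


lemma cvec_space_component [measurable (raw)]:
  "j < n \<Longrightarrow> (\<lambda>x. x j) \<in> measurable (cvec_space n) borel"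
  unfolding cvec_space_def by measurable

text \<open>Jensen's inequality for the exponential function. It is proved from the tangent at \<open>m\<close>, so that the
  right-hand side may be infinite.\<close>

lemma exp_nn_integral_ge:
  assumes "prob_space G" and X [measurable]: "X \<in> borel_measurable G" and X0: "\<And>x. 0 \<le> X x"
    and m: "(\<integral>\<^sup>+x. ennreal (X x) \<partial>G) = ennreal m" "0 \<le> m"
  shows "ennreal (exp m) \<le> (\<integral>\<^sup>+x. ennreal (exp (X x)) \<partial>G)"
proof -
  interpret prob_space G by fact
  have "ennreal (exp m * (1 + m)) = ennreal (exp m) * (\<integral>\<^sup>+x. 1 + ennreal (X x) \<partial>G)"
    using m by (subst nn_integral_add) (auto simp: emeasure_space_1 ennreal_mult)
  also have "\<dots> = (\<integral>\<^sup>+x. ennreal (exp m * (1 + X x)) \<partial>G)"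
    by (subst nn_integral_cmult[symmetric]) (auto simp: ennreal_mult X0)
  also have "\<dots> \<le> (\<integral>\<^sup>+x. ennreal (exp (X x)) + ennreal (exp m * m) \<partial>G)"
  proof (intro nn_integral_mono)
    fix x
    have "exp m * (1 + (X x - m)) \<le> exp m * exp (X x - m)" by (intro mult_left_mono exp_ge_add_one_self) auto
    hence "exp m * (1 + X x) \<le> exp (X x) + exp m * m" by (simp add: exp_add[symmetric] algebra_simps)
    thus "ennreal (exp m * (1 + X x)) \<le> ennreal (exp (X x)) + ennreal (exp m * m)"
      using m(2) by (subst ennreal_plus[symmetric]) (auto intro!: ennreal_leI simp del: ennreal_plus)
  qed
  also have "\<dots> = (\<integral>\<^sup>+x. ennreal (exp (X x)) \<partial>G) + ennreal (exp m * m)"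
    by (subst nn_integral_add) (auto simp: emeasure_space_1)
  finally have "ennreal (exp m) + ennreal (exp m * m) \<le> (\<integral>\<^sup>+x. ennreal (exp (X x)) \<partial>G) + ennreal (exp m * m)"
    using m(2) by (simp add: algebra_simps flip: ennreal_plus)
  thus ?thesis by (simp add: add.commute[of _ "ennreal (exp m * m)"] ennreal_add_left_cancel_le)
qed

text \<open>A reflection carries \<open>y\<close> to the direction of \<open>w\<close>, up to a phase. The phase makes the inner product
  real, as \<open>householder\<close> demands, and does not affect the absolute value of the form.\<close>

lemma haar_sphere_invariant:
  fixes y w :: "nat \<Rightarrow> complex"
  assumes haar: "haar_sphere K n \<mu>" and K: "K \<in> {\<real>, UNIV}"
    and y: "(\<Sum>i<n. (cmod (y i))\<^sup>2) = 1" "\<And>i. i < n \<Longrightarrow> y i \<in> K"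
    and w: "\<And>i. i < n \<Longrightarrow> w i \<in> K" and phi [measurable]: "\<phi> \<in> borel_measurable borel"
  shows "(\<integral>\<^sup>+x. \<phi> ((cmod (\<Sum>j<n. x j * w j))\<^sup>2) \<partial>\<mu>) =
     (\<integral>\<^sup>+x. \<phi> ((\<Sum>j<n. (cmod (w j))\<^sup>2) * (cmod (\<Sum>j<n. x j * y j))\<^sup>2) \<partial>\<mu>)"
proof (cases "(\<Sum>j<n. (cmod (w j))\<^sup>2) = 0")
  case True
  hence "\<forall>j\<in>{..<n}. (cmod (w j))\<^sup>2 = 0" by (subst (asm) sum_nonneg_eq_0_iff) auto
  thus ?thesis by simp
next
  case False
  define r where "r = sqrt (\<Sum>j<n. (cmod (w j))\<^sup>2)"
  have "0 \<le> (\<Sum>j<n. (cmod (w j))\<^sup>2)" by (intro sum_nonneg) auto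
  hence r: "0 < r" "(\<Sum>j<n. (cmod (w j))\<^sup>2) = r\<^sup>2" using False by (auto simp: r_def)
  define s where "s = (\<Sum>i<n. y i * cnj (w i / of_real r))"
  define p where "p = (if s = 0 then 1 else s / of_real (cmod s))"
  have p1: "cmod p = 1" by (auto simp: p_def norm_divide)
  have ps: "s * cnj p = of_real (cmod s)"
    by (auto simp: p_def complex_norm_square[symmetric] power2_eq_square)
  have pK: "p \<in> K"
  proof (cases "K = UNIV")
    case False
    hence KR: "K = \<real>" using K by auto
    have "s \<in> \<real>" unfolding s_def
      using y(2) w by (auto intro!: sum_in_Reals Reals_mult simp: KR complex_is_Real_iff)
    thus ?thesis by (simp add: p_def KR)
  qed simp
  define x' where "x' i = cnj (y i)" for i
  define t where "t i = cnj (p * (w i / of_real r))" for i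
  have 1: "(\<Sum>i<n. (cmod (x' i))\<^sup>2) = 1" using y by (simp add: x'_def)
  have 2: "(\<Sum>i<n. (cmod (t i))\<^sup>2) = 1"
  proof -
    have "(\<Sum>i<n. (cmod (t i))\<^sup>2) = (\<Sum>i<n. (cmod (w i))\<^sup>2) / r\<^sup>2"
      unfolding sum_divide_distrib using r(1) by (intro sum.cong) (auto simp: t_def norm_mult norm_divide p1 power_divide)
    thus ?thesis using r by simp
  qed
  have 3: "(\<Sum>i<n. cnj (x' i) * t i) \<in> \<real>"
  proof -
    have "(\<Sum>i<n. cnj (x' i) * t i) = s * cnj p"
      unfolding s_def sum_distrib_right by (intro sum.cong) (auto simp: x'_def t_def)
    thus ?thesis unfolding ps by simp
  qed
  obtain U where U: "U \<in> carrier_mat n n" "U * U = 1\<^sub>m n" "mat_adjoint U = U"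
    "\<And>i. i < n \<Longrightarrow> (\<Sum>j<n. U $$ (i, j) * x' j) = t i"
    "(\<forall>i<n. x' i \<in> \<real> \<and> t i \<in> \<real>) \<Longrightarrow> (\<forall>i<n. \<forall>j<n. U $$ (i, j) \<in> \<real>)"
    by (rule householder[OF 1 2 3]) blast
  have UK: "\<forall>i<n. \<forall>j<n. U $$ (i, j) \<in> K"
  proof (cases "K = UNIV")
    case False
    hence KR: "K = \<real>" using K by auto
    show ?thesis unfolding KR
      using y(2) w pK by (intro U(5)) (auto simp: x'_def t_def KR complex_is_Real_iff)
  qed simp
  have inv: "distr \<mu> (cvec_space n) (\<lambda>x. \<lambda>i\<in>{..<n}. \<Sum>j<n. U $$ (i, j) * x j) = \<mu>"
    using haar U UK unfolding haar_sphere_def by auto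
  have sets [measurable_cong]: "sets \<mu> = sets (cvec_space n)" using haar by (simp add: haar_sphere_def)
  have [measurable]: "(\<lambda>x. \<lambda>i\<in>{..<n}. \<Sum>j<n. U $$ (i, j) * x j) \<in> measurable \<mu> (cvec_space n)"
    unfolding cvec_space_def by (intro measurable_restrict) (use sets in measurable)
  have Uy: "(\<Sum>i<n. (\<Sum>j<n. U $$ (i, j) * x j) * y i) = p / of_real r * (\<Sum>j<n. x j * w j)" for x
  proof -
    have "(\<Sum>i<n. (\<Sum>j<n. U $$ (i, j) * x j) * y i) = (\<Sum>j<n. \<Sum>i<n. U $$ (i, j) * x j * y i)"
      unfolding sum_distrib_right by (rule sum.swap)
    also have "\<dots> = (\<Sum>j<n. x j * cnj (\<Sum>i<n. U $$ (j, i) * x' i))"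
      unfolding cnj_sum sum_distrib_left
    proof (intro sum.cong refl)
      fix i j assume "j \<in> {..<n}" "i \<in> {..<n}"
      hence "U $$ (i, j) = cnj (U $$ (j, i))" using hermitianD[OF U(3) U(1), of j i] by simp
      thus "U $$ (i, j) * x j * y i = x j * cnj (U $$ (j, i) * x' i)" by (simp add: x'_def)
    qed
    also have "\<dots> = (\<Sum>j<n. x j * cnj (t j))" using U(4) by simp
    also have "\<dots> = p / of_real r * (\<Sum>j<n. x j * w j)"
      unfolding sum_distrib_left by (intro sum.cong) (auto simp: t_def)
    finally show ?thesis .
  qed
  have "(\<integral>\<^sup>+x. \<phi> (r\<^sup>2 * (cmod (\<Sum>j<n. x j * y j))\<^sup>2) \<partial>\<mu>) =
    (\<integral>\<^sup>+x. \<phi> (r\<^sup>2 * (cmod (\<Sum>i<n. (\<lambda>i\<in>{..<n}. \<Sum>j<n. U $$ (i, j) * x j) i * y i))\<^sup>2) \<partial>\<mu>)"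
    by (subst inv[symmetric], subst nn_integral_distr) measurable
  also have "\<dots> = (\<integral>\<^sup>+x. \<phi> ((cmod (\<Sum>j<n. x j * w j))\<^sup>2) \<partial>\<mu>)"
  proof (rule nn_integral_cong)
    fix x
    have "(\<Sum>i<n. (\<lambda>i\<in>{..<n}. \<Sum>j<n. U $$ (i, j) * x j) i * y i) = p / of_real r * (\<Sum>j<n. x j * w j)"
      unfolding Uy[symmetric] by (intro sum.cong) auto
    hence "r\<^sup>2 * (cmod (\<Sum>i<n. (\<lambda>i\<in>{..<n}. \<Sum>j<n. U $$ (i, j) * x j) i * y i))\<^sup>2 = (cmod (\<Sum>j<n. x j * w j))\<^sup>2"
      using r(1) p1 by (simp add: norm_mult norm_divide power_divide power_mult_distrib)
    thus "\<phi> (r\<^sup>2 * (cmod (\<Sum>i<n. (\<lambda>i\<in>{..<n}. \<Sum>j<n. U $$ (i, j) * x j) i * y i))\<^sup>2) = \<phi> ((cmod (\<Sum>j<n. x j * w j))\<^sup>2)"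
      by simp
  qed
  finally show ?thesis unfolding r(2) ..
qed

text \<open>Averaging the linear form \<open>\<langle>u, g\<rangle>\<close> over an independent Gaussian vector \<open>g\<close> in two ways: for fixed
  \<open>u\<close> it is a Gaussian linear form, and for fixed \<open>g\<close> it has the law of \<open>\<bar>g\<bar> \<langle>u, y\<rangle>\<close>. Since
  \<open>\<bar>g\<bar>\<^sup>2\<close> has mean \<open>n\<close>, Jensen's inequality transfers the Gaussian exponential moment to the sphere.\<close>

lemma haar_sphere_moments:
  fixes y :: "nat \<Rightarrow> complex"
  assumes haar: "haar_sphere K n \<mu>" and K: "K \<in> {\<real>, UNIV}"
    and y: "(\<Sum>i<n. (cmod (y i))\<^sup>2) = 1" "\<And>i. i < n \<Longrightarrow> y i \<in> K"
  shows "(\<integral>\<^sup>+x. ennreal (n * (cmod (\<Sum>j<n. x j * y j))\<^sup>2) \<partial>\<mu>) = 1"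
    and "(\<integral>\<^sup>+x. ennreal (exp (n * (cmod (\<Sum>j<n. x j * y j))\<^sup>2 / 4)) \<partial>\<mu>) \<le> 2"
proof -
  define \<gamma> where "\<gamma> = (if K = \<real> then real_std_normal else complex_std_normal)"
  have gam: "std_subgaussian \<gamma>" using std_subgaussian_real std_subgaussian_complex by (simp add: \<gamma>_def)
  define G where "G = PiM {..<n} (\<lambda>_. \<gamma>)"
  have G: "isotropic_subgaussian n G" unfolding G_def by (rule isotropic_subgaussian_product[OF gam])
  interpret G: prob_space G using G by (simp add: isotropic_subgaussian_def)
  interpret mu: prob_space \<mu> using haar by (simp add: haar_sphere_def)
  interpret GM: pair_prob_space G \<mu> ..
  have [measurable_cong]: "sets \<mu> = sets (PiM {..<n} (\<lambda>_. borel))" using haar by (simp add: haar_sphere_def cvec_space_def)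
  have [measurable_cong]: "sets G = sets (PiM {..<n} (\<lambda>_. borel))" using G by (simp add: isotropic_subgaussian_def cvec_space_def)
  have gK: "AE g in G. \<forall>j\<in>{..<n}. g j \<in> K"
  proof (cases "K = \<real>")
    case True
    have "{z \<in> space borel. z \<in> (\<real> :: complex set)} \<in> sets borel"
      using borel_closed[OF closed_complex_Reals] by simp
    hence "AE z in real_std_normal. z \<in> \<real>"
      unfolding real_std_normal_def by (subst AE_distr_iff) auto
    hence "AE z in \<gamma>. z \<in> \<real>" unfolding \<gamma>_def if_P[OF True] .
    thus ?thesis unfolding G_def True using gam
      by (intro AE_finite_allI AE_PiM_component) (auto simp: std_subgaussian_def)
  qed (use K in auto)
  define q where "q g = (\<Sum>j<n. (cmod (g j))\<^sup>2)" for g :: "nat \<Rightarrow> complex"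
  define c where "c x = (cmod (\<Sum>j<n. x j * y j))\<^sup>2" for x :: "nat \<Rightarrow> complex"
  have [measurable]: "q \<in> borel_measurable (PiM {..<n} (\<lambda>_. borel))" "c \<in> borel_measurable (PiM {..<n} (\<lambda>_. borel))"
    unfolding q_def c_def by measurable
  have q0: "0 \<le> q g" and c0: "0 \<le> c g" for g by (auto simp: q_def c_def sum_nonneg)
  have sphere: "AE x in \<mu>. (\<Sum>j<n. (cmod (x j))\<^sup>2) = 1" using haar by (auto simp: haar_sphere_def)
  have two_ways: "(\<integral>\<^sup>+x. \<integral>\<^sup>+g. \<phi> (q g * c x) \<partial>G \<partial>\<mu>) = (\<integral>\<^sup>+x. \<integral>\<^sup>+g. \<phi> ((cmod (\<Sum>j<n. g j * x j))\<^sup>2) \<partial>G \<partial>\<mu>)"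
    if [measurable]: "\<phi> \<in> borel_measurable borel" for \<phi> :: "real \<Rightarrow> ennreal"
  proof -
    have "(\<integral>\<^sup>+x. \<integral>\<^sup>+g. \<phi> ((cmod (\<Sum>j<n. g j * x j))\<^sup>2) \<partial>G \<partial>\<mu>) = (\<integral>\<^sup>+g. \<integral>\<^sup>+x. \<phi> ((cmod (\<Sum>j<n. x j * g j))\<^sup>2) \<partial>\<mu> \<partial>G)"
      by (subst GM.Fubini') (unfold split_beta, measurable, simp add: mult.commute)
    also have "\<dots> = (\<integral>\<^sup>+g. \<integral>\<^sup>+x. \<phi> (q g * c x) \<partial>\<mu> \<partial>G)"
      unfolding q_def c_def using gK
      by (intro nn_integral_cong_AE, eventually_elim) (intro haar_sphere_invariant[OF haar K y], auto)
    also have "\<dots> = (\<integral>\<^sup>+x. \<integral>\<^sup>+g. \<phi> (q g * c x) \<partial>G \<partial>\<mu>)"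
      by (subst GM.Fubini') (unfold split_beta, measurable)
    finally show ?thesis ..
  qed
  have Gsq: "(\<integral>\<^sup>+g. ennreal (q g) \<partial>G) = ennreal n"
  proof -
    have one: "(\<integral>\<^sup>+g. ennreal ((cmod (g i))\<^sup>2) \<partial>G) = 1" if "i < n" for i
    proof -
      define e :: "nat \<Rightarrow> complex" where "e j = (if i = j then 1 else 0)" for j
      have "(\<Sum>j<n. (cmod (e j))\<^sup>2) = (\<Sum>j<n. if i = j then 1 else 0)" by (intro sum.cong) (auto simp: e_def)
      hence "(\<Sum>j<n. (cmod (e j))\<^sup>2) = 1" using that by simp
      hence "(\<integral>\<^sup>+g. ennreal ((cmod (\<Sum>j<n. g j * e j))\<^sup>2) \<partial>G) = 1" using G by (simp add: isotropic_subgaussian_def)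
      moreover have "(\<Sum>j<n. g j * e j) = g i" for g
      proof -
        have "(\<Sum>j<n. g j * e j) = (\<Sum>j<n. if i = j then g j else 0)" by (intro sum.cong) (auto simp: e_def)
        thus ?thesis using that by simp
      qed
      ultimately show ?thesis by simp
    qed
    have "(\<integral>\<^sup>+g. ennreal (q g) \<partial>G) = (\<integral>\<^sup>+g. (\<Sum>i<n. ennreal ((cmod (g i))\<^sup>2)) \<partial>G)"
      by (simp add: q_def sum_ennreal)
    also have "\<dots> = (\<Sum>i<n. \<integral>\<^sup>+g. ennreal ((cmod (g i))\<^sup>2) \<partial>G)" by (rule nn_integral_sum) measurable
    also have "\<dots> = ennreal n" using one by (simp add: ennreal_of_nat_eq_real_of_nat)
    finally show ?thesis .
  qed
  have Gc: "(\<integral>\<^sup>+g. ennreal (q g * c x) \<partial>G) = ennreal (n * c x)" for x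
  proof -
    have "(\<integral>\<^sup>+g. ennreal (q g * c x) \<partial>G) = (\<integral>\<^sup>+g. ennreal (q g) * ennreal (c x) \<partial>G)"
      by (simp add: ennreal_mult q0 c0)
    also have "\<dots> = ennreal (n * c x)" by (subst nn_integral_multc) (simp_all add: Gsq ennreal_mult c0)
    finally show ?thesis .
  qed
  have "(\<integral>\<^sup>+x. ennreal (n * c x) \<partial>\<mu>) = (\<integral>\<^sup>+x. \<integral>\<^sup>+g. ennreal ((cmod (\<Sum>j<n. g j * x j))\<^sup>2) \<partial>G \<partial>\<mu>)"
    unfolding Gc[symmetric] by (rule two_ways) measurable
  also have "\<dots> = (\<integral>\<^sup>+x. 1 \<partial>\<mu>)"
    using sphere by (intro nn_integral_cong_AE, elim AE_mp, intro AE_I2) (use G in \<open>auto simp: isotropic_subgaussian_def\<close>)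
  finally show "(\<integral>\<^sup>+x. ennreal (n * (cmod (\<Sum>j<n. x j * y j))\<^sup>2) \<partial>\<mu>) = 1" 
    by (simp add: c_def mu.emeasure_space_1)
  have "(\<integral>\<^sup>+x. ennreal (exp (n * c x / 4)) \<partial>\<mu>) \<le> (\<integral>\<^sup>+x. \<integral>\<^sup>+g. ennreal (exp (q g * c x / 4)) \<partial>G \<partial>\<mu>)"
  proof (intro nn_integral_mono)
    fix x
    have "(\<integral>\<^sup>+g. ennreal (q g * c x / 4) \<partial>G) = (\<integral>\<^sup>+g. ennreal (q g * c x) * ennreal (1 / 4) \<partial>G)"
      by (simp add: q0 c0 flip: ennreal_mult)
    also have "\<dots> = ennreal (n * c x / 4)" by (subst nn_integral_multc) (simp_all add: Gc c0 flip: ennreal_mult)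
    finally have "(\<integral>\<^sup>+g. ennreal (q g * c x / 4) \<partial>G) = ennreal (n * c x / 4)" .
    thus "ennreal (exp (n * c x / 4)) \<le> (\<integral>\<^sup>+g. ennreal (exp (q g * c x / 4)) \<partial>G)"
      by (intro exp_nn_integral_ge G.prob_space_axioms) (auto simp: q0 c0)
  qed
  also have "\<dots> = (\<integral>\<^sup>+x. \<integral>\<^sup>+g. ennreal (exp ((cmod (\<Sum>j<n. g j * x j))\<^sup>2 / 4)) \<partial>G \<partial>\<mu>)"
    by (rule two_ways) measurable
  also have "\<dots> \<le> (\<integral>\<^sup>+x. 2 \<partial>\<mu>)"
    using sphere by (intro nn_integral_mono_AE, elim AE_mp, intro AE_I2) (use G in \<open>auto simp: isotropic_subgaussian_def\<close>)
  finally show "(\<integral>\<^sup>+x. ennreal (exp (n * (cmod (\<Sum>j<n. x j * y j))\<^sup>2 / 4)) \<partial>\<mu>) \<le> 2"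
    by (simp add: c_def mu.emeasure_space_1)
qed

text \<open>What is left is the case of a real sphere and a complex \<open>y\<close>: there the form is a mixture of two real
  ones, and the exponential function is convex.\<close>

lemma isotropic_subgaussian_haar:
  assumes haar: "haar_sphere K n \<mu>" and K: "K \<in> {\<real>, UNIV}"
  shows "isotropic_subgaussian n (distr \<mu> (cvec_space n) (\<lambda>x. \<lambda>j\<in>{..<n}. of_real (sqrt (real n)) * x j))"
    (is "isotropic_subgaussian n ?\<nu>")
proof -
  interpret mu: prob_space \<mu> using haar by (simp add: haar_sphere_def)
  have [measurable_cong]: "sets \<mu> = sets (PiM {..<n} (\<lambda>_. borel))" using haar by (simp add: haar_sphere_def cvec_space_def)
  have m [measurable]: "(\<lambda>x. \<lambda>j\<in>{..<n}. complex_of_real (sqrt (real n)) * x j) \<in> measurable \<mu> (cvec_space n)"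
    unfolding cvec_space_def by measurable
  have form: "(cmod (\<Sum>j<n. (\<lambda>j\<in>{..<n}. complex_of_real (sqrt (real n)) * x j) j * y j))\<^sup>2 = n * (cmod (\<Sum>j<n. x j * y j))\<^sup>2" for x y
  proof -
    have "(\<Sum>j<n. (\<lambda>j\<in>{..<n}. complex_of_real (sqrt (real n)) * x j) j * y j) = complex_of_real (sqrt (real n)) * (\<Sum>j<n. x j * y j)"
      unfolding sum_distrib_left by (intro sum.cong) auto
    thus ?thesis by (simp add: norm_mult power_mult_distrib)
  qed
  have int: "(\<integral>\<^sup>+z. \<phi> ((cmod (\<Sum>j<n. z j * y j))\<^sup>2) \<partial>?\<nu>) = (\<integral>\<^sup>+x. \<phi> (n * (cmod (\<Sum>j<n. x j * y j))\<^sup>2) \<partial>\<mu>)"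
    if [measurable]: "\<phi> \<in> borel_measurable borel" for \<phi> :: "real \<Rightarrow> ennreal" and y
    unfolding form[symmetric] by (rule nn_integral_distr) measurable
  have "(\<integral>\<^sup>+x. ennreal (n * (cmod (\<Sum>j<n. x j * y j))\<^sup>2) \<partial>\<mu>) = 1 \<and>
    (\<integral>\<^sup>+x. ennreal (exp (n * (cmod (\<Sum>j<n. x j * y j))\<^sup>2 / 4)) \<partial>\<mu>) \<le> 2"
    if y: "(\<Sum>j<n. (cmod (y j))\<^sup>2) = 1" for y
  proof (cases "K = UNIV")
    case True
    thus ?thesis using haar_sphere_moments[OF haar K y] by auto
  next
    case False
    hence KR: "K = \<real>" using K by auto
    \<comment> \<open>On real vectors the form splits into two real forms, of weights \<open>\<alpha>\<close> and \<open>\<beta>\<close> adding up to 1.\<close>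
    have n0: "0 < n" using y by (cases n) auto
    have split: "\<exists>b. (\<Sum>j<n. (cmod (complex_of_real (b j)))\<^sup>2) = 1 \<and> (\<forall>j<n. a j = sqrt (\<Sum>j<n. (a j)\<^sup>2) * b j)" for a :: "nat \<Rightarrow> real"
    proof (cases "(\<Sum>j<n. (a j)\<^sup>2) = 0")
      case True
      hence "\<forall>j\<in>{..<n}. (a j)\<^sup>2 = 0" by (subst (asm) sum_nonneg_eq_0_iff) auto
      moreover have "(\<Sum>j<n. (cmod (complex_of_real (if j = 0 then 1 else 0)))\<^sup>2) = 1"
      proof -
        have "(\<Sum>j<n. (cmod (complex_of_real (if j = 0 then 1 else 0)))\<^sup>2) = (\<Sum>j<n. if j = 0 then 1 else 0)"
          by (intro sum.cong) auto
        thus ?thesis using n0 by simp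
      qed
      ultimately show ?thesis using True by (intro exI[of _ "\<lambda>j. if j = 0 then 1 else 0"]) auto
    next
      case False
      have "0 \<le> (\<Sum>j<n. (a j)\<^sup>2)" by (intro sum_nonneg) auto
      with False have "0 < (\<Sum>j<n. (a j)\<^sup>2)" by linarith
      thus ?thesis
        by (intro exI[of _ "\<lambda>j. a j / sqrt (\<Sum>j<n. (a j)\<^sup>2)"])
           (auto simp: power_divide sum_divide_distrib[symmetric] simp flip: of_real_divide)
    qed
    define \<alpha> where "\<alpha> = (\<Sum>j<n. (Re (y j))\<^sup>2)"
    define \<beta> where "\<beta> = (\<Sum>j<n. (Im (y j))\<^sup>2)"
    have ab: "0 \<le> \<alpha>" "0 \<le> \<beta>" "\<alpha> + \<beta> = 1"
      using y by (auto simp: \<alpha>_def \<beta>_def sum_nonneg cmod_power2 sum.distrib)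
    obtain b1 where b1: "(\<Sum>j<n. (cmod (complex_of_real (b1 j)))\<^sup>2) = 1" "\<And>j. j < n \<Longrightarrow> Re (y j) = sqrt \<alpha> * b1 j"
      using split[of "\<lambda>j. Re (y j)"] unfolding \<alpha>_def by blast
    obtain b2 where b2: "(\<Sum>j<n. (cmod (complex_of_real (b2 j)))\<^sup>2) = 1" "\<And>j. j < n \<Longrightarrow> Im (y j) = sqrt \<beta> * b2 j"
      using split[of "\<lambda>j. Im (y j)"] unfolding \<beta>_def by blast
    define f where "f b x = n * (cmod (\<Sum>j<n. x j * complex_of_real (b j)))\<^sup>2" for b :: "nat \<Rightarrow> real" and x
    have [measurable]: "f b \<in> borel_measurable \<mu>" for b unfolding f_def by measurable
    have f0: "0 \<le> f b x" for b x by (simp add: f_def)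
    have AE: "AE x in \<mu>. n * (cmod (\<Sum>j<n. x j * y j))\<^sup>2 = \<alpha> * f b1 x + \<beta> * f b2 x"
    proof -
      have "AE x in \<mu>. (\<forall>j<n. x j \<in> \<real>)" using haar unfolding haar_sphere_def KR by auto
      thus ?thesis
      proof (elim AE_mp, intro AE_I2 impI)
        fix x :: "nat \<Rightarrow> complex" assume x: "\<forall>j<n. x j \<in> \<real>"
        define r where "r j = Re (x j)" for j
        have xr: "x j = of_real (r j)" if "j < n" for j using x that by (simp add: r_def)
        have fr: "f b x = n * (\<Sum>j<n. r j * b j)\<^sup>2" for b
        proof -
          have "(\<Sum>j<n. x j * complex_of_real (b j)) = of_real (\<Sum>j<n. r j * b j)"
            unfolding of_real_sum by (intro sum.cong) (auto simp: xr)
          thus ?thesis unfolding f_def by (simp only: norm_of_real power2_abs)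
        qed
        have "Re (\<Sum>j<n. x j * y j) = sqrt \<alpha> * (\<Sum>j<n. r j * b1 j)"
          unfolding Re_sum sum_distrib_left by (intro sum.cong) (auto simp: xr b1)
        moreover have "Im (\<Sum>j<n. x j * y j) = sqrt \<beta> * (\<Sum>j<n. r j * b2 j)"
          unfolding Im_sum sum_distrib_left by (intro sum.cong) (auto simp: xr b2)
        ultimately show "n * (cmod (\<Sum>j<n. x j * y j))\<^sup>2 = \<alpha> * f b1 x + \<beta> * f b2 x"
          unfolding cmod_power2 fr using ab by (simp add: power_mult_distrib algebra_simps)
      qed
    qed
    have I1: "(\<integral>\<^sup>+x. ennreal (f b x) \<partial>\<mu>) = 1" "(\<integral>\<^sup>+x. ennreal (exp (f b x / 4)) \<partial>\<mu>) \<le> 2"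
      if "(\<Sum>j<n. (cmod (complex_of_real (b j)))\<^sup>2) = 1" for b
      using haar_sphere_moments[OF haar K that] unfolding f_def by (auto simp: KR)
    have lin: "(\<integral>\<^sup>+x. ennreal (\<alpha> * g b1 x + \<beta> * g b2 x) \<partial>\<mu>) = ennreal \<alpha> * (\<integral>\<^sup>+x. ennreal (g b1 x) \<partial>\<mu>) + ennreal \<beta> * (\<integral>\<^sup>+x. ennreal (g b2 x) \<partial>\<mu>)"
      if [measurable]: "\<And>b. g b \<in> borel_measurable \<mu>" and g0: "\<And>b x. 0 \<le> g b x" for g
    proof -
      have "(\<integral>\<^sup>+x. ennreal (\<alpha> * g b1 x + \<beta> * g b2 x) \<partial>\<mu>) = (\<integral>\<^sup>+x. ennreal \<alpha> * ennreal (g b1 x) + ennreal \<beta> * ennreal (g b2 x) \<partial>\<mu>)"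
        using ab g0 by (intro nn_integral_cong) (simp add: ennreal_mult)
      thus ?thesis by (simp add: nn_integral_add nn_integral_cmult)
    qed
    have "(\<integral>\<^sup>+x. ennreal (n * (cmod (\<Sum>j<n. x j * y j))\<^sup>2) \<partial>\<mu>) = (\<integral>\<^sup>+x. ennreal (\<alpha> * f b1 x + \<beta> * f b2 x) \<partial>\<mu>)"
      using AE by (intro nn_integral_cong_AE, elim AE_mp, intro AE_I2) auto
    also have "\<dots> = 1" 
      using ab by (subst lin) (auto simp: f0 I1[OF b1(1)] I1[OF b2(1)] simp flip: ennreal_plus)
    finally have 1: "(\<integral>\<^sup>+x. ennreal (n * (cmod (\<Sum>j<n. x j * y j))\<^sup>2) \<partial>\<mu>) = 1" .
    have "(\<integral>\<^sup>+x. ennreal (exp (n * (cmod (\<Sum>j<n. x j * y j))\<^sup>2 / 4)) \<partial>\<mu>) \<le>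
      (\<integral>\<^sup>+x. ennreal (\<alpha> * exp (f b1 x / 4) + \<beta> * exp (f b2 x / 4)) \<partial>\<mu>)"
    proof (intro nn_integral_mono_AE, use AE in \<open>elim AE_mp\<close>, intro AE_I2 impI ennreal_leI)
      fix x assume e: "n * (cmod (\<Sum>j<n. x j * y j))\<^sup>2 = \<alpha> * f b1 x + \<beta> * f b2 x"
      have "\<alpha> = 1 - \<beta>" using ab by simp
      have "exp ((1 - \<beta>) *\<^sub>R (f b1 x / 4) + \<beta> *\<^sub>R (f b2 x / 4)) \<le> (1 - \<beta>) * exp (f b1 x / 4) + \<beta> * exp (f b2 x / 4)"
        using exp_convex ab by (intro convex_onD) auto
      thus "exp (n * (cmod (\<Sum>j<n. x j * y j))\<^sup>2 / 4) \<le> \<alpha> * exp (f b1 x / 4) + \<beta> * exp (f b2 x / 4)"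
        unfolding e \<open>\<alpha> = 1 - \<beta>\<close> by (simp add: add_divide_distrib)
    qed
    also have "\<dots> = ennreal \<alpha> * (\<integral>\<^sup>+x. ennreal (exp (f b1 x / 4)) \<partial>\<mu>) + ennreal \<beta> * (\<integral>\<^sup>+x. ennreal (exp (f b2 x / 4)) \<partial>\<mu>)"
      by (rule lin) auto
    also have "\<dots> \<le> ennreal \<alpha> * 2 + ennreal \<beta> * 2"
      by (intro add_mono mult_left_mono I1 b1 b2) auto
    also have "\<dots> = (ennreal \<alpha> + ennreal \<beta>) * 2" by (simp add: distrib_right)
    also have "\<dots> = 2" using ab by (simp flip: ennreal_plus)
    finally show ?thesis using 1 by simp
  qed
  hence "(\<integral>\<^sup>+z. ennreal ((cmod (\<Sum>j<n. z j * y j))\<^sup>2) \<partial>?\<nu>) = 1 \<and>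
    (\<integral>\<^sup>+z. ennreal (exp ((cmod (\<Sum>j<n. z j * y j))\<^sup>2 / 4)) \<partial>?\<nu>) \<le> 2"
    if y: "(\<Sum>j<n. (cmod (y j))\<^sup>2) = 1" for y
    using y int[of "\<lambda>t. ennreal t" y] int[of "\<lambda>t. ennreal (exp (t / 4))" y] by simp
  moreover have "prob_space ?\<nu>" by (rule mu.prob_space_distr) measurable
  ultimately show ?thesis by (simp add: isotropic_subgaussian_def)
qed

lemma admissible_row_law_isotropic_subgaussian:
  assumes "admissible_row_law n \<nu>"
  shows "isotropic_subgaussian n \<nu>"
  using assms unfolding admissible_row_law_def
  by (auto intro: isotropic_subgaussian_product std_subgaussian_real std_subgaussian_complex isotropic_subgaussian_haar)

section \<open>Concentration of weighted sums of squares\<close>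

text \<open>Taylor's formula with the Lagrange remainder.\<close>

lemma exp_le_quadratic: "exp x \<le> 1 + x + x\<^sup>2 / 2 * exp \<bar>x\<bar>" for x :: real
proof -
  obtain t where t: "\<bar>t\<bar> \<le> \<bar>x\<bar>" "exp x = (\<Sum>m<2. x ^ m / fact m) + exp t / fact 2 * x ^ 2"
    using Maclaurin_exp_le[of x 2] by blast
  have "exp t * x\<^sup>2 \<le> exp \<bar>x\<bar> * x\<^sup>2" using t(1) by (intro mult_right_mono) auto
  thus ?thesis unfolding t(2) by (simp add: numeral_2_eq_2 mult_ac)
qed

text \<open>By \<open>exp x \<le> 1 + x + x\<^sup>2 exp \<bar>x\<bar> / 2\<close> the linear term has mean zero, and the quadratic one is
  dominated by the exponential moment of \<open>V\<close>.\<close>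

lemma centred_exp_moment:
  assumes P: "prob_space P" and [measurable]: "V \<in> borel_measurable P" and V0: "\<And>\<omega>. 0 \<le> V \<omega>"
    and mean: "(\<integral>\<^sup>+\<omega>. ennreal (V \<omega>) \<partial>P) = 1"
    and moment: "(\<integral>\<^sup>+\<omega>. ennreal (exp (V \<omega> / 4)) \<partial>P) \<le> 2"
    and \<theta>: "\<bar>\<theta>\<bar> \<le> 1 / 8"
  shows "(\<integral>\<^sup>+\<omega>. ennreal (exp (\<theta> * (V \<omega> - 1))) \<partial>P) \<le> ennreal (exp (256 * \<theta>\<^sup>2))"
proof -
  interpret prob_space P by fact
  have iV: "integrable P V"
    by (rule integrableI_bounded) (use V0 mean in auto)
  have eV: "expectation V = 1"
    using V0 mean iV by (subst integral_eq_nn_integral) auto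
  have iE: "integrable P (\<lambda>\<omega>. exp (V \<omega> / 4))"
  proof (rule integrableI_bounded)
    have "(\<integral>\<^sup>+\<omega>. ennreal (norm (exp (V \<omega> / 4))) \<partial>P) \<le> 2" using moment by simp
    also have "(2::ennreal) < \<infinity>" by simp
    finally show "(\<integral>\<^sup>+\<omega>. ennreal (norm (exp (V \<omega> / 4))) \<partial>P) < \<infinity>" .
  qed measurable
  have eE: "expectation (\<lambda>\<omega>. exp (V \<omega> / 4)) \<le> 2"
    using moment unfolding nn_integral_eq_integral[OF iE, simplified]
    by (simp only: ennreal_le_iff ennreal_numeral[symmetric] zero_le_numeral)
  have bound: "exp (\<theta> * (v - 1)) \<le> 1 + \<theta> * (v - 1) + 128 * \<theta>\<^sup>2 * exp (v / 4)" if v: "0 \<le> v" for v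
  proof -
    \<comment> \<open>In units of \<open>8\<close> one factor \<open>exp u\<close> absorbs the square, another one the remainder; their product
      stays within \<open>exp (v / 4)\<close>.\<close>
    define u where "u = \<bar>v - 1\<bar> / 8"
    have u0: "0 \<le> u" by (simp add: u_def)
    have "1 + u + u\<^sup>2 / 2 \<le> exp u" using exp_lower_Taylor_quadratic[OF u0] .
    hence u2: "u\<^sup>2 / 2 \<le> exp u" using u0 by simp
    have "\<bar>\<theta> * (v - 1)\<bar> = \<bar>\<theta>\<bar> * \<bar>v - 1\<bar>" by (rule abs_mult)
    also have "\<dots> \<le> 1 / 8 * \<bar>v - 1\<bar>" using \<theta> by (intro mult_right_mono) auto
    finally have a: "\<bar>\<theta> * (v - 1)\<bar> \<le> u" by (simp add: u_def)
    have "(v - 1)\<^sup>2 = 64 * u\<^sup>2" by (simp add: u_def power_divide)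
    hence "(\<theta> * (v - 1))\<^sup>2 / 2 * exp \<bar>\<theta> * (v - 1)\<bar> \<le> \<theta>\<^sup>2 * 64 * (u\<^sup>2 / 2) * exp u"
      using a by (simp add: power_mult_distrib mult_left_mono)
    also have "\<dots> \<le> \<theta>\<^sup>2 * 64 * exp u * exp u" using u2 by (intro mult_right_mono mult_left_mono) auto
    also have "\<dots> = 64 * \<theta>\<^sup>2 * exp (2 * u)" by (simp add: exp_add[symmetric])
    also have "\<dots> \<le> 64 * \<theta>\<^sup>2 * exp (1 / 4 + v / 4)" using v by (intro mult_left_mono) (auto simp: u_def)
    also have "\<dots> = 64 * \<theta>\<^sup>2 * exp (v / 4) * exp (1 / 4)" by (simp add: exp_add)
    also have "\<dots> \<le> 64 * \<theta>\<^sup>2 * exp (v / 4) * 2"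
    proof (intro mult_left_mono)
      have "exp (1 / 4 :: real) \<le> 1 + 1 / 4 + (1 / 4)\<^sup>2" by (rule exp_bound) auto
      thus "exp (1 / 4 :: real) \<le> 2" by (simp add: power2_eq_square)
    qed auto
    finally show ?thesis using exp_le_quadratic[of "\<theta> * (v - 1)"] by linarith
  qed
  define B where "B \<omega> = 1 + \<theta> * (V \<omega> - 1) + 128 * \<theta>\<^sup>2 * exp (V \<omega> / 4)" for \<omega>
  have iB: "integrable P B" unfolding B_def
    by (intro Bochner_Integration.integrable_add Bochner_Integration.integrable_diff integrable_mult_right iV iE) auto
  have B0: "0 \<le> B \<omega>" for \<omega> using bound[OF V0[of \<omega>]] exp_ge_zero[of "\<theta> * (V \<omega> - 1)"] unfolding B_def by linarith
  have "expectation B = 1 + \<theta> * (expectation V - 1) + 128 * \<theta>\<^sup>2 * expectation (\<lambda>\<omega>. exp (V \<omega> / 4))"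
    unfolding B_def using iV iE by (simp add: prob_space)
  also have "\<dots> \<le> 1 + 256 * \<theta>\<^sup>2" unfolding eV using mult_left_mono[OF eE, of "128 * \<theta>\<^sup>2"] by simp
  also have "\<dots> \<le> exp (256 * \<theta>\<^sup>2)" by (rule exp_ge_add_one_self)
  finally have eB: "expectation B \<le> exp (256 * \<theta>\<^sup>2)" .
  have "(\<integral>\<^sup>+\<omega>. ennreal (exp (\<theta> * (V \<omega> - 1))) \<partial>P) \<le> (\<integral>\<^sup>+\<omega>. ennreal (B \<omega>) \<partial>P)"
    unfolding B_def by (intro nn_integral_mono ennreal_leI bound V0)
  also have "\<dots> = ennreal (expectation B)" by (rule nn_integral_eq_integral[OF iB]) (simp add: B0)
  also have "\<dots> \<le> ennreal (exp (256 * \<theta>\<^sup>2))" by (rule ennreal_leI[OF eB])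
  finally show ?thesis .
qed

text \<open>Bernstein's method: by independence the exponential moment of the sum is the product of those of
  its terms, and \<open>\<theta> b \<le> n / 8\<close> keeps every term within the range of \<open>centred_exp_moment\<close>.\<close>

lemma weighted_squares_concentration:
  fixes n :: nat and X :: "nat \<Rightarrow> 'w \<Rightarrow> nat \<Rightarrow> complex" and c :: "nat \<Rightarrow> real"
    and b C t \<theta> :: real
  assumes P: "prob_space P" and indep: "prob_space.indep_vars P (\<lambda>_. cvec_space M) X {..<n}"
    and law: "\<And>i. i < n \<Longrightarrow> isotropic_subgaussian M (distr P (cvec_space M) (X i))"
    and c: "\<And>i. i < n \<Longrightarrow> 0 \<le> c i" "\<And>i. i < n \<Longrightarrow> c i \<le> b" "(\<Sum>i<n. (c i)\<^sup>2) \<le> C * n"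
    and n: "0 < n" and y: "(\<Sum>j<M. (cmod (y j))\<^sup>2) = 1"
    and \<theta>: "0 \<le> \<theta>" "\<theta> * b \<le> n / 8"
  shows "measure P {\<omega>\<in>space P. t \<le> \<bar>(\<Sum>i<n. c i * ((cmod (\<Sum>j<M. X i \<omega> j * y j))\<^sup>2 - 1)) / n\<bar>}
           \<le> 2 * exp (256 * C * \<theta>\<^sup>2 / n - \<theta> * t)"
proof -
  interpret prob_space P by fact
  define g where "g x = (cmod (\<Sum>j<M. x j * y j))\<^sup>2" for x
  have g0: "0 \<le> g x" for x by (simp add: g_def)
  have g [measurable]: "g \<in> borel_measurable (cvec_space M)" unfolding g_def by measurable
  have X [measurable]: "X i \<in> measurable P (cvec_space M)" if "i < n" for i
    using indep that by (auto simp: indep_vars_def)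
  define Y where "Y \<omega> = (\<Sum>i<n. c i * (g (X i \<omega>) - 1)) / n" for \<omega>
  have [measurable]: "Y \<in> borel_measurable P" unfolding Y_def
    by (intro borel_measurable_divide borel_measurable_sum borel_measurable_times borel_measurable_diff) auto
  have V: "(\<integral>\<^sup>+\<omega>. ennreal (g (X i \<omega>)) \<partial>P) = 1" "(\<integral>\<^sup>+\<omega>. ennreal (exp (g (X i \<omega>) / 4)) \<partial>P) \<le> 2" if i: "i < n" for i
  proof -
    have "(\<integral>\<^sup>+\<omega>. ennreal (g (X i \<omega>)) \<partial>P) = (\<integral>\<^sup>+x. ennreal (g x) \<partial>distr P (cvec_space M) (X i))"
      using i by (subst nn_integral_distr) auto
    thus "(\<integral>\<^sup>+\<omega>. ennreal (g (X i \<omega>)) \<partial>P) = 1"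
      using law[OF i] y by (simp add: isotropic_subgaussian_def g_def)
    have "(\<integral>\<^sup>+\<omega>. ennreal (exp (g (X i \<omega>) / 4)) \<partial>P) = (\<integral>\<^sup>+x. ennreal (exp (g x / 4)) \<partial>distr P (cvec_space M) (X i))"
      using i by (subst nn_integral_distr) auto
    thus "(\<integral>\<^sup>+\<omega>. ennreal (exp (g (X i \<omega>) / 4)) \<partial>P) \<le> 2"
      using law[OF i] y by (simp add: isotropic_subgaussian_def g_def)
  qed
  have one_sided: "prob {\<omega>\<in>space P. t \<le> s * Y \<omega>} \<le> exp (256 * C * \<theta>\<^sup>2 / n - \<theta> * t)" if s: "\<bar>s\<bar> = 1" for s
  proof -
    have mgf: "(\<integral>\<^sup>+\<omega>. ennreal (exp (\<theta> * (s * Y \<omega>))) \<partial>P) \<le> ennreal (exp (256 * C * \<theta>\<^sup>2 / n))"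
    proof -
      define h where "h i x = ennreal (exp (s * \<theta> * c i / n * (g x - 1)))" for i x
      have [measurable]: "h i \<in> borel_measurable (cvec_space M)" for i unfolding h_def by measurable
      have "(\<integral>\<^sup>+\<omega>. ennreal (exp (\<theta> * (s * Y \<omega>))) \<partial>P) = (\<integral>\<^sup>+\<omega>. (\<Prod>i<n. h i (X i \<omega>)) \<partial>P)"
      proof (rule nn_integral_cong)
        fix \<omega>
        have "\<theta> * (s * Y \<omega>) = (\<Sum>i<n. s * \<theta> * c i / n * (g (X i \<omega>) - 1))"
          unfolding Y_def sum_divide_distrib sum_distrib_left by (intro sum.cong) auto
        thus "ennreal (exp (\<theta> * (s * Y \<omega>))) = (\<Prod>i<n. h i (X i \<omega>))"
          by (simp add: h_def exp_sum prod_ennreal)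
      qed
      also have "\<dots> = (\<Prod>i<n. \<integral>\<^sup>+\<omega>. h i (X i \<omega>) \<partial>P)"
        by (rule indep_vars_nn_integral) (auto intro: indep_vars_compose2[OF indep])
      also have "\<dots> \<le> (\<Prod>i<n. ennreal (exp (256 * (s * \<theta> * c i / n)\<^sup>2)))"
      proof (intro prod_mono_ennreal)
        fix i assume "i \<in> {..<n}"
        hence i: "i < n" by simp
        have "\<theta> * c i \<le> \<theta> * b" using c(2)[OF i] \<theta>(1) by (intro mult_left_mono) auto
        hence "\<theta> * c i / n \<le> 1 / 8" using \<theta>(2) n by (simp add: field_simps)
        hence "\<bar>s * \<theta> * c i / n\<bar> \<le> 1 / 8" using s c(1)[OF i] \<theta>(1) by (simp add: abs_mult)
        thus "(\<integral>\<^sup>+\<omega>. h i (X i \<omega>) \<partial>P) \<le> ennreal (exp (256 * (s * \<theta> * c i / n)\<^sup>2))"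
          unfolding h_def using V[OF i] i by (intro centred_exp_moment prob_space_axioms) (auto simp: g0)
      qed
      also have "\<dots> = ennreal (exp (\<Sum>i<n. 256 * (s * \<theta> * c i / n)\<^sup>2))"
        by (simp add: exp_sum prod_ennreal)
      also have "\<dots> \<le> ennreal (exp (256 * C * \<theta>\<^sup>2 / n))"
      proof (intro ennreal_leI, subst exp_le_cancel_iff)
        have s2: "s\<^sup>2 = 1" using s by (simp add: abs_if split: if_splits)
        have "(\<Sum>i<n. 256 * (s * \<theta> * c i / n)\<^sup>2) = 256 * \<theta>\<^sup>2 / n\<^sup>2 * (\<Sum>i<n. (c i)\<^sup>2)"
          unfolding sum_distrib_left by (intro sum.cong) (auto simp: power_divide power_mult_distrib s2)
        also have "\<dots> \<le> 256 * \<theta>\<^sup>2 / n\<^sup>2 * (C * n)" using c(3) by (intro mult_left_mono) auto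
        also have "\<dots> = 256 * C * \<theta>\<^sup>2 / n" using n by (simp add: power2_eq_square)
        finally show "(\<Sum>i<n. 256 * (s * \<theta> * c i / n)\<^sup>2) \<le> 256 * C * \<theta>\<^sup>2 / n" .
      qed
      finally show ?thesis .
    qed
    have "emeasure P {\<omega>\<in>space P. t \<le> s * Y \<omega>} \<le> emeasure P {\<omega>\<in>space P. 1 \<le> ennreal (exp (- \<theta> * t)) * ennreal (exp (\<theta> * (s * Y \<omega>)))}"
    proof (intro emeasure_mono subsetI)
      fix \<omega> assume "\<omega> \<in> {\<omega>\<in>space P. t \<le> s * Y \<omega>}"
      moreover from this have "0 \<le> - \<theta> * t + \<theta> * (s * Y \<omega>)" using mult_left_mono[of t "s * Y \<omega>" \<theta>] \<theta>(1) by simp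
      ultimately show "\<omega> \<in> {\<omega>\<in>space P. 1 \<le> ennreal (exp (- \<theta> * t)) * ennreal (exp (\<theta> * (s * Y \<omega>)))}"
        by (simp add: exp_add[symmetric] flip: ennreal_mult)
    qed measurable
    also have "\<dots> \<le> ennreal (exp (- \<theta> * t)) * (\<integral>\<^sup>+\<omega>. ennreal (exp (\<theta> * (s * Y \<omega>))) * indicator (space P) \<omega> \<partial>P)"
      using nn_integral_Markov_inequality[of "\<lambda>\<omega>. ennreal (exp (\<theta> * (s * Y \<omega>)))" "space P" P "ennreal (exp (- \<theta> * t))"]
      by simp
    also have "\<dots> \<le> ennreal (exp (- \<theta> * t)) * ennreal (exp (256 * C * \<theta>\<^sup>2 / n))"
      using mgf by (intro mult_left_mono) (auto simp: nn_integral_set_ennreal cong: nn_integral_cong)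
    also have "\<dots> = ennreal (exp (256 * C * \<theta>\<^sup>2 / n - \<theta> * t))"
      by (simp add: exp_add[symmetric] flip: ennreal_mult)
    finally show ?thesis by (simp add: emeasure_eq_measure)
  qed
  have "prob {\<omega>\<in>space P. t \<le> \<bar>Y \<omega>\<bar>} \<le> prob ({\<omega>\<in>space P. t \<le> 1 * Y \<omega>} \<union> {\<omega>\<in>space P. t \<le> (- 1) * Y \<omega>})"
    by (intro finite_measure_mono) auto
  also have "\<dots> \<le> prob {\<omega>\<in>space P. t \<le> 1 * Y \<omega>} + prob {\<omega>\<in>space P. t \<le> (- 1) * Y \<omega>}"
    by (intro measure_Un_le) measurable
  also have "\<dots> \<le> 2 * exp (256 * C * \<theta>\<^sup>2 / n - \<theta> * t)"
    using one_sided[of 1] one_sided[of "- 1"] by simp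
  finally show ?thesis by (simp add: Y_def g_def)
qed


lemma random_row_form:
  "(\<Sum>j<M. random_row M Z i \<omega> j * y j) = (\<Sum>j<M. Z \<omega> $$ (i, j) * y j)"
  by (intro sum.cong) (auto simp: random_row_def)

text \<open>The parameter of the exponential moment is taken as large as the bound \<open>\<kappa> log M\<close> on the weights
  permits, namely \<open>\<theta> = N / (8 \<kappa> log M)\<close>. The gain \<open>\<theta> t\<close> is then at least twice the quadratic loss, and half
  of it is at least \<open>4 log M\<close>, as soon as \<open>log M\<close> and \<open>N / log\<^sup>3 M\<close> are large. This leaves \<open>2 M \<cdot> 2 M\<^sup>-\<^sup>4\<close> for the
  exceptional event, which is summable. The vectors \<open>y M l\<close> are arbitrary, and the errors are relative to
  their square norms.\<close>

theorem weighted_squares_uniform: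
  fixes P :: "'w measure" and N :: "nat \<Rightarrow> nat" and Z :: "nat \<Rightarrow> 'w \<Rightarrow> complex mat"
    and c :: "nat \<Rightarrow> nat \<Rightarrow> real" and y :: "nat \<Rightarrow> nat \<Rightarrow> nat \<Rightarrow> complex" and C \<kappa> t :: real
  assumes P: "prob_space P"
    and N1: "\<And>M. M \<ge> 1 \<Longrightarrow> N M \<ge> 1"
    and iid: "\<And>M. M \<ge> 1 \<Longrightarrow> iid_admissible_rows P (N M) M (Z M)"
    and c0: "\<And>n i. i < n \<Longrightarrow> 0 \<le> c n i"
    and C: "0 < C" "\<And>n. 1 \<le> n \<Longrightarrow> (\<Sum>i<n. (c n i)\<^sup>2) \<le> C * n"
    and \<kappa>: "0 < \<kappa>" "\<And>M i. 2 \<le> M \<Longrightarrow> i < N M \<Longrightarrow> c (N M) i \<le> \<kappa> * ln M"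
    and growth: "filterlim (\<lambda>M. real (N M) / (ln (real M)) ^ 3) at_top sequentially"
    and t: "0 < t"
  shows "AE \<omega> in P. eventually (\<lambda>M. \<forall>l<2*M.
     \<bar>(\<Sum>i<N M. c (N M) i * (cmod (\<Sum>j<M. Z M \<omega> $$ (i, j) * y M l j))\<^sup>2) / N M
        - (\<Sum>i<N M. c (N M) i) / N M * (\<Sum>j<M. (cmod (y M l j))\<^sup>2)\<bar> \<le> t * (\<Sum>j<M. (cmod (y M l j))\<^sup>2)) sequentially"
proof -
  interpret prob_space P by fact
  define q where "q M l = (\<Sum>j<M. (cmod (y M l j))\<^sup>2)" for M l
  define u where "u M l j = y M l j / of_real (sqrt (q M l))" for M l j
  define Y where "Y M l \<omega> = (\<Sum>i<N M. c (N M) i * ((cmod (\<Sum>j<M. random_row M (Z M) i \<omega> j * u M l j))\<^sup>2 - 1)) / N M" for M l \<omega>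
  have q0: "0 \<le> q M l" for M l by (simp add: q_def sum_nonneg)
  have unit: "(\<Sum>j<M. (cmod (u M l j))\<^sup>2) = 1" if "0 < q M l" for M l
  proof -
    have "(\<Sum>j<M. (cmod (u M l j))\<^sup>2) = (\<Sum>j<M. (cmod (y M l j))\<^sup>2) / q M l"
      unfolding sum_divide_distrib using that by (intro sum.cong) (auto simp: u_def norm_divide power_divide)
    thus ?thesis using that by (simp add: q_def)
  qed
  have "eventually (\<lambda>M. 2 \<le> M \<and> 1 \<le> ln (real M) \<and> 64 * C / (\<kappa> * t) \<le> ln (real M)
      \<and> 64 * \<kappa> / t \<le> real (N M) / (ln (real M)) ^ 3) sequentially"
  proof -
    have ln: "filterlim (\<lambda>M. ln (real M)) at_top sequentially"
      by (rule filterlim_compose[OF ln_at_top filterlim_real_sequentially])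
    show ?thesis
      using growth ln unfolding filterlim_at_top by (intro eventually_conj eventually_ge_at_top) auto
  qed
  then obtain M0 where M0: "\<And>M. M0 \<le> M \<Longrightarrow> 2 \<le> M" "\<And>M. M0 \<le> M \<Longrightarrow> 1 \<le> ln (real M)"
     "\<And>M. M0 \<le> M \<Longrightarrow> 64 * C / (\<kappa> * t) \<le> ln (real M)" "\<And>M. M0 \<le> M \<Longrightarrow> 64 * \<kappa> / t \<le> real (N M) / (ln (real M)) ^ 3"
    unfolding eventually_sequentially by blast
  define E where "E M l = {\<omega>\<in>space P. t \<le> \<bar>Y M l \<omega>\<bar>}" for M l
  define A where "A M = (if M0 \<le> M then (\<Union>l\<in>{l. l < 2 * M \<and> 0 < q M l}. E M l) else {})" for M
  have E: "E M l \<in> sets P" "prob (E M l) \<le> 2 * real M powr (- 4)" if M: "M0 \<le> M" and q: "0 < q M l" for M l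
  proof -
    have M1: "1 \<le> M" "2 \<le> M" and lnM: "0 < ln (real M)" using M0(1,2)[OF M] by auto
    have n: "0 < N M" using N1[of M] M1 by simp
    note ii = iid[OF M1(1), unfolded iid_admissible_rows_def]
    have indep: "indep_vars (\<lambda>_. cvec_space M) (random_row M (Z M)) {..<N M}" using ii by blast
    have law: "isotropic_subgaussian M (distr P (cvec_space M) (random_row M (Z M) i))" if "i < N M" for i
      using ii that admissible_row_law_isotropic_subgaussian by metis
    have X [measurable]: "random_row M (Z M) i \<in> measurable P (cvec_space M)" if "i < N M" for i
      using indep that by (auto simp: indep_vars_def)
    have [measurable]: "(\<lambda>\<omega>. random_row M (Z M) i \<omega> j) \<in> borel_measurable P" if "i < N M" "j < M" for i j
      using measurable_compose[OF X[OF that(1)] cvec_space_component[OF that(2)]] .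
    have "Y M l \<in> borel_measurable P" unfolding Y_def by measurable
    thus "E M l \<in> sets P" unfolding E_def by measurable
    define \<theta> where "\<theta> = N M / (8 * \<kappa> * ln (real M))"
    have "prob (E M l) \<le> 2 * exp (256 * C * \<theta>\<^sup>2 / N M - \<theta> * t)"
      unfolding E_def Y_def
    proof (rule weighted_squares_concentration[OF P indep law])
      show "(\<Sum>i<N M. (c (N M) i)\<^sup>2) \<le> C * real (N M)" using C(2) N1 M1 by simp
      show "\<theta> * (\<kappa> * ln M) \<le> N M / 8" using \<kappa>(1) lnM by (simp add: \<theta>_def field_simps)
    qed (use c0 \<kappa> M1 n unit[OF q] lnM in \<open>auto simp: \<theta>_def\<close>)
    also have "256 * C * \<theta>\<^sup>2 / N M - \<theta> * t \<le> - 4 * ln (real M)"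
    proof -
      define L where "L = ln (real M)"
      have L: "1 \<le> L" "64 * C / (\<kappa> * t) \<le> L" "64 * \<kappa> / t \<le> N M / L ^ 3" using M0[OF M] by (auto simp: L_def)
      have L0: "0 < L" using L(1) by simp
      have 1: "4 * C / (\<kappa>\<^sup>2 * L) \<le> t / (16 * \<kappa>)"
      proof -
        have "64 * C \<le> L * (\<kappa> * t)" using L(2) \<kappa>(1) t by (simp add: pos_divide_le_eq)
        hence "4 * C * (16 * \<kappa>) \<le> t * (\<kappa>\<^sup>2 * L)"
          using mult_left_mono[of "64 * C" "L * (\<kappa> * t)" \<kappa>] \<kappa>(1) by (simp add: power2_eq_square mult_ac)
        thus ?thesis using \<kappa>(1) L0 by (simp add: divide_le_eq le_divide_eq)
      qed
      have "64 * \<kappa> / t * L ^ 3 \<le> N M" using L(3) L0 by (simp add: le_divide_eq)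
      moreover have "64 * \<kappa> / t * L ^ 2 \<le> 64 * \<kappa> / t * L ^ 3"
        using L(1) \<kappa>(1) t by (intro mult_left_mono power_increasing) auto
      ultimately have "64 * \<kappa> / t * L ^ 2 \<le> N M" by linarith
      hence "64 * \<kappa> * L ^ 2 \<le> N M * t" using t by (simp add: field_simps)
      hence 2: "4 * L \<le> N M / L * (t / (16 * \<kappa>))" using L0 \<kappa>(1) by (simp add: field_simps power2_eq_square)
      have "256 * C * \<theta>\<^sup>2 / N M = N M / L * (4 * C / (\<kappa>\<^sup>2 * L))"
        using n L0 \<kappa>(1) unfolding \<theta>_def L_def[symmetric] by (simp add: field_simps power2_eq_square)
      also have "\<dots> \<le> N M / L * (t / (16 * \<kappa>))" using 1 L0 by (intro mult_left_mono) auto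
      finally have "256 * C * \<theta>\<^sup>2 / N M - \<theta> * t \<le> N M / L * (t / (16 * \<kappa>)) - N M / L * (t / (8 * \<kappa>))"
        unfolding \<theta>_def L_def[symmetric] by (simp add: mult_ac)
      also have "\<dots> = - (N M / L * (t / (16 * \<kappa>)))" using \<kappa>(1) L0 by (simp add: field_simps)
      also have "\<dots> \<le> - 4 * L" using 2 by simp
      finally show ?thesis by (simp add: L_def)
    qed
    finally show "prob (E M l) \<le> 2 * real M powr (- 4)"
      using M1 by (simp add: powr_def)
  qed
  have Aset: "A M \<in> sets P" for M unfolding A_def using E(1) by (auto intro!: sets.countable_UN'')
  have Aprob: "prob (A M) \<le> 4 * (1 / real M ^ 2)" for M
  proof (cases "M0 \<le> M")
    case True
    have M: "2 \<le> M" using M0(1)[OF True] .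
    have "prob (A M) \<le> (\<Sum>l\<in>{l. l < 2 * M \<and> 0 < q M l}. prob (E M l))"
      unfolding A_def using True E(1)[OF True] by (auto intro!: finite_measure_subadditive_finite)
    also have "\<dots> \<le> (\<Sum>l\<in>{l. l < 2 * M \<and> 0 < q M l}. 2 * real M powr (- 4))" using E(2)[OF True] by (intro sum_mono) auto
    also have "\<dots> \<le> (\<Sum>l<2*M. 2 * real M powr (- 4))" by (intro sum_mono2) auto
    also have "\<dots> = 4 * (real M * real M powr (- 4))" by simp
    also have "real M * real M powr (- 4) = 1 / real M ^ 3" using M
      by (simp add: powr_minus divide_simps powr_numeral) (simp add: power_eq_if)
    also have "\<dots> \<le> 1 / real M ^ 2" using M by (intro divide_left_mono power_increasing) auto
    finally show ?thesis by simp
  qed (simp add: A_def)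
  have "summable (\<lambda>M. prob (A M))"
  proof (rule summable_comparison_test')
    show "summable (\<lambda>M. 4 * (1 / real M ^ 2))"
      using inverse_power_summable[of 2, where ?'a = real] by (intro summable_mult) (simp add: field_simps)
    show "norm (prob (A M)) \<le> 4 * (1 / real M ^ 2)" if "0 \<le> M" for M using Aprob[of M] by simp
  qed
  hence "AE \<omega> in P. eventually (\<lambda>M. \<omega> \<in> space P - A M) sequentially"
    using Aset by (intro borel_cantelli_AE1) (auto simp: emeasure_eq_measure)
  thus ?thesis
  proof (elim AE_mp, intro AE_I2 impI)
    fix \<omega> assume "\<omega> \<in> space P" "eventually (\<lambda>M. \<omega> \<in> space P - A M) sequentially"
    hence "eventually (\<lambda>M. \<omega> \<in> space P - A M \<and> M0 \<le> M) sequentially"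
      by (intro eventually_conj eventually_ge_at_top) auto
    thus "eventually (\<lambda>M. \<forall>l<2*M.
     \<bar>(\<Sum>i<N M. c (N M) i * (cmod (\<Sum>j<M. Z M \<omega> $$ (i, j) * y M l j))\<^sup>2) / N M
        - (\<Sum>i<N M. c (N M) i) / N M * (\<Sum>j<M. (cmod (y M l j))\<^sup>2)\<bar> \<le> t * (\<Sum>j<M. (cmod (y M l j))\<^sup>2)) sequentially"
    proof (eventually_elim, intro allI impI)
      fix M l assume M: "\<omega> \<in> space P - A M \<and> M0 \<le> M" and l: "l < 2 * M"
      define V where "V i = (cmod (\<Sum>j<M. Z M \<omega> $$ (i, j) * y M l j))\<^sup>2" for i
      have "\<bar>(\<Sum>i<N M. c (N M) i * V i) / N M - (\<Sum>i<N M. c (N M) i) / N M * q M l\<bar> \<le> t * q M l"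
      proof (cases "0 < q M l")
        case False
        hence "q M l = 0" using q0[of M l] by simp
        moreover from this have "\<forall>j\<in>{..<M}. (cmod (y M l j))\<^sup>2 = 0" unfolding q_def by (subst (asm) sum_nonneg_eq_0_iff) auto
        hence "V i = 0" for i by (simp add: V_def)
        ultimately show ?thesis by simp
      next
        case True
        have "\<bar>Y M l \<omega>\<bar> \<le> t" using M l True by (force simp: A_def E_def)
        moreover have "(\<Sum>i<N M. c (N M) i * V i) / N M - (\<Sum>i<N M. c (N M) i) / N M * q M l = Y M l \<omega> * q M l"
        proof -
          have "(cmod (\<Sum>j<M. random_row M (Z M) i \<omega> j * u M l j))\<^sup>2 = V i / q M l" for i
          proof -
            have "(\<Sum>j<M. random_row M (Z M) i \<omega> j * u M l j) = (\<Sum>j<M. Z M \<omega> $$ (i, j) * y M l j) / of_real (sqrt (q M l))"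
              unfolding random_row_form sum_divide_distrib by (simp add: u_def)
            thus ?thesis using True by (simp add: norm_divide power_divide V_def)
          qed
          hence "Y M l \<omega> * q M l = (\<Sum>i<N M. c (N M) i * (V i / q M l - 1) * q M l) / N M"
            unfolding Y_def by (simp add: sum_distrib_right)
          also have "(\<Sum>i<N M. c (N M) i * (V i / q M l - 1) * q M l) = (\<Sum>i<N M. c (N M) i * V i) - (\<Sum>i<N M. c (N M) i) * q M l"
            unfolding sum_distrib_right sum_subtractf[symmetric] using True by (intro sum.cong) (auto simp: field_simps)
          finally show ?thesis by (simp add: diff_divide_distrib)
        qed
        ultimately show ?thesis using q0[of M l] by (simp add: abs_mult mult_right_mono)
      qed
      thus "\<bar>(\<Sum>i<N M. c (N M) i * (cmod (\<Sum>j<M. Z M \<omega> $$ (i, j) * y M l j))\<^sup>2) / N M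
        - (\<Sum>i<N M. c (N M) i) / N M * (\<Sum>j<M. (cmod (y M l j))\<^sup>2)\<bar> \<le> t * (\<Sum>j<M. (cmod (y M l j))\<^sup>2)"
        unfolding V_def q_def .
    qed
  qed
qed

section \<open>Averaging along diagonals\<close>

text \<open>The orthogonal projection onto Toeplitz matrices, damped by the triangular factor
  \<open>1 - \<bar>i - j\<bar> / M\<close>: each diagonal sum is divided by \<open>M\<close> and not by the length of the diagonal.\<close>

definition toeplitz_avg :: "nat \<Rightarrow> (nat \<Rightarrow> nat \<Rightarrow> complex) \<Rightarrow> nat \<Rightarrow> nat \<Rightarrow> complex" where
  "toeplitz_avg M S i j = (\<Sum>p<M. \<Sum>q<M. if int p - int q = int i - int j then S p q else 0) / of_nat M"

text \<open>The exponential vector of the frequency \<open>2 \<pi> l / (2 M)\<close>.\<close>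

definition freq :: "nat \<Rightarrow> nat \<Rightarrow> nat \<Rightarrow> complex" where
  "freq M l p = cis (- (pi * real l * real p / real M))"

lemma norm_freq [simp]: "cmod (freq M l p) = 1"
  by (simp add: freq_def)

lemma sum_cis_double:
  assumes "\<bar>d\<bar> < 2 * int M"
  shows "(\<Sum>l<2*M. cis (pi * real l * real_of_int d / real M)) = (if d = 0 then of_nat (2 * M) else 0)"
proof (cases "d = 0")
  case False
  define z where "z = cis (pi * real_of_int d / real M)"
  have M: "0 < M" using assms by linarith
  have zl: "cis (pi * real l * real_of_int d / real M) = z ^ l" for l
    unfolding z_def Complex.DeMoivre by (rule arg_cong[of _ _ cis]) simp
  have "z ^ (2 * M) = cis (2 * pi * real_of_int d)"
    unfolding zl[symmetric] using M by (intro arg_cong[of _ _ cis]) simp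
  also have "\<dots> = 1" by (rule cis_multiple_2pi) simp
  finally have zL: "z ^ (2 * M) = 1" .
  have "z \<noteq> 1"
  proof
    assume "z = 1"
    hence "cos (pi * real_of_int d / real M) = 1" by (simp add: z_def complex_eq_iff)
    then obtain k :: int where "pi * real_of_int d / real M = real_of_int k * 2 * pi"
      using cos_one_2pi_int by auto
    hence "real_of_int d = real_of_int (k * 2 * int M)" using M by (simp add: field_simps)
    hence d: "d = k * 2 * int M" unfolding of_int_eq_iff .
    hence "\<bar>k\<bar> * (2 * int M) < 1 * (2 * int M)" using assms by (simp add: abs_mult)
    hence "\<bar>k\<bar> < 1" using mult_less_cancel_right[of "\<bar>k\<bar>" "2 * int M" 1] M by linarith
    thus False using d False by simp
  qed
  have "(\<Sum>l<2*M. z ^ l) = (z ^ (2 * M) - 1) / (z - 1)" using geometric_sum[OF \<open>z \<noteq> 1\<close>] .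
  thus ?thesis using False unfolding zl zL by simp
qed simp

lemma sum_cis_indicator:
  assumes "p < M" "q < M" "i < M" "j < M"
  shows "(\<Sum>l<2*M. cnj (freq M l p) * freq M l q * (freq M l i * cnj (freq M l j))) =
    (if int p - int q = int i - int j then of_nat (2 * M) else 0)"
proof -
  define d where "d = (int p - int q) - (int i - int j)"
  have "cnj (freq M l p) * freq M l q * (freq M l i * cnj (freq M l j)) = cis (pi * real l * real_of_int d / real M)" for l
    unfolding freq_def cis_cnj cis_mult
    by (rule arg_cong[of _ _ cis]) (simp add: d_def diff_divide_distrib[symmetric] add_divide_distrib[symmetric] algebra_simps)
  moreover have "\<bar>d\<bar> < 2 * int M" using assms by (simp add: d_def)
  ultimately show ?thesis using sum_cis_double[of d M] by (simp add: d_def)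
qed

text \<open>A sum of \<open>2 M\<close>-th roots of unity detects \<open>p - q = i - j\<close>, because \<open>(p - q) - (i - j)\<close> is smaller than
  \<open>2 M\<close> in absolute value. Thus the form of a diagonal average is a positive combination of the values of the
  original form at \<open>2 M\<close> exponential vectors.\<close>

lemma toeplitz_avg_form:
  "sform M (toeplitz_avg M S) v v =
     (\<Sum>l<2*M. sform M S (freq M l) (freq M l) * of_real ((cmod (\<Sum>j<M. v j * cnj (freq M l j)))\<^sup>2)) / of_nat (2 * M * M)"
proof (cases "M = 0")
  case False
  hence M: "0 < M" by simp
  define D :: complex where "D = of_nat (2 * M)"
  have D: "D \<noteq> 0" using M by (simp add: D_def)
  have sq: "of_real ((cmod (\<Sum>j<M. v j * cnj (freq M l j)))\<^sup>2) = (\<Sum>i<M. \<Sum>j<M. cnj (v i) * freq M l i * (v j * cnj (freq M l j)))" for l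
  proof -
    have "complex_of_real ((cmod (\<Sum>j<M. v j * cnj (freq M l j)))\<^sup>2) = cnj (\<Sum>i<M. v i * cnj (freq M l i)) * (\<Sum>j<M. v j * cnj (freq M l j))"
      unfolding complex_norm_square by (rule mult.commute)
    thus ?thesis unfolding cnj_sum sum_product by simp
  qed
  have "(\<Sum>l<2*M. sform M S (freq M l) (freq M l) * of_real ((cmod (\<Sum>j<M. v j * cnj (freq M l j)))\<^sup>2)) =
    (\<Sum>l<2*M. \<Sum>i<M. \<Sum>j<M. \<Sum>p<M. \<Sum>q<M. cnj (freq M l p) * S p q * freq M l q * (cnj (v i) * freq M l i * (v j * cnj (freq M l j))))"
    unfolding sq sform_def by (intro sum.cong refl) (simp only: sum_distrib_left sum_distrib_right)
  also have "\<dots> = (\<Sum>i<M. \<Sum>j<M. \<Sum>l<2*M. \<Sum>p<M. \<Sum>q<M. cnj (freq M l p) * S p q * freq M l q * (cnj (v i) * freq M l i * (v j * cnj (freq M l j))))"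
    by (subst sum.swap, rule sum.cong[OF refl], rule sum.swap)
  also have "\<dots> = (\<Sum>i<M. \<Sum>j<M. \<Sum>p<M. \<Sum>q<M. \<Sum>l<2*M. cnj (freq M l p) * S p q * freq M l q * (cnj (v i) * freq M l i * (v j * cnj (freq M l j))))"
    by (rule sum.cong[OF refl], rule sum.cong[OF refl], subst sum.swap, rule sum.cong[OF refl], rule sum.swap)
  also have "\<dots> = (\<Sum>i<M. \<Sum>j<M. \<Sum>p<M. \<Sum>q<M. cnj (v i) * (if int p - int q = int i - int j then S p q else 0) * v j * D)"
  proof (intro sum.cong refl)
    fix i j p q assume "i \<in> {..<M}" "j \<in> {..<M}" "p \<in> {..<M}" "q \<in> {..<M}"
    hence *: "(\<Sum>l<2*M. cnj (freq M l p) * freq M l q * (freq M l i * cnj (freq M l j))) =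
      (if int p - int q = int i - int j then D else 0)" unfolding D_def by (intro sum_cis_indicator) auto
    have "(\<Sum>l<2*M. cnj (freq M l p) * S p q * freq M l q * (cnj (v i) * freq M l i * (v j * cnj (freq M l j)))) =
      cnj (v i) * S p q * v j * (\<Sum>l<2*M. cnj (freq M l p) * freq M l q * (freq M l i * cnj (freq M l j)))"
      unfolding sum_distrib_left by (intro sum.cong refl) (simp only: ac_simps)
    thus "(\<Sum>l<2*M. cnj (freq M l p) * S p q * freq M l q * (cnj (v i) * freq M l i * (v j * cnj (freq M l j)))) =
      cnj (v i) * (if int p - int q = int i - int j then S p q else 0) * v j * D" unfolding * by simp
  qed
  also have "\<dots> = D * of_nat M * sform M (toeplitz_avg M S) v v"
    unfolding sform_def toeplitz_avg_def sum_distrib_left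
  proof (intro sum.cong refl)
    fix i j
    define B where "B p q = (if int p - int q = int i - int j then S p q else 0)" for p q
    have "(\<Sum>p<M. \<Sum>q<M. cnj (v i) * B p q * v j * D) = cnj (v i) * (\<Sum>p<M. \<Sum>q<M. B p q) * v j * D"
      by (simp add: sum_distrib_left sum_distrib_right)
    also have "\<dots> = D * of_nat M * (cnj (v i) * ((\<Sum>p<M. \<Sum>q<M. B p q) / of_nat M) * v j)" using M by simp
    finally show "(\<Sum>p<M. \<Sum>q<M. cnj (v i) * (if int p - int q = int i - int j then S p q else 0) * v j * D) =
      D * of_nat M * (cnj (v i) * ((\<Sum>p<M. \<Sum>q<M. if int p - int q = int i - int j then S p q else 0) / of_nat M) * v j)"
      unfolding B_def .
  qed
  finally show ?thesis using D M by (simp add: D_def)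
qed (simp add: sform_def)

text \<open>The sampled exponential vectors form a tight frame.\<close>

lemma sum_freq_form:
  "(\<Sum>l<2*M. sform M S (freq M l) (freq M l)) = of_nat (2 * M) * (\<Sum>p<M. S p p)"
proof -
  have "(\<Sum>l<2*M. sform M S (freq M l) (freq M l)) = (\<Sum>p<M. \<Sum>q<M. \<Sum>l<2*M. cnj (freq M l p) * S p q * freq M l q)"
    unfolding sform_def by (subst sum.swap, rule sum.cong[OF refl], rule sum.swap)
  also have "\<dots> = (\<Sum>p<M. \<Sum>q<M. if p = q then of_nat (2 * M) * S p q else 0)"
  proof (intro sum.cong refl)
    fix p q assume pq: "p \<in> {..<M}" "q \<in> {..<M}"
    have u: "freq M l 0 = 1" for l by (simp add: freq_def)
    have "(\<Sum>l<2*M. cnj (freq M l p) * S p q * freq M l q) = S p q * (\<Sum>l<2*M. cnj (freq M l p) * freq M l q * (freq M l 0 * cnj (freq M l 0)))"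
      unfolding sum_distrib_left u by (intro sum.cong refl) simp
    also have "(\<Sum>l<2*M. cnj (freq M l p) * freq M l q * (freq M l 0 * cnj (freq M l 0))) = (if int p - int q = int 0 - int 0 then of_nat (2 * M) else 0)"
      using pq by (intro sum_cis_indicator) auto
    finally show "(\<Sum>l<2*M. cnj (freq M l p) * S p q * freq M l q) = (if p = q then of_nat (2 * M) * S p q else 0)"
      by simp
  qed
  also have "\<dots> = (\<Sum>p<M. of_nat (2 * M) * S p p)" by (intro sum.cong refl, subst sum.delta') auto
  finally show ?thesis by (simp add: sum_distrib_left)
qed

lemma Re_toeplitz_avg_form:
  "Re (sform M (toeplitz_avg M S) v v) =
     (\<Sum>l<2*M. Re (sform M S (freq M l) (freq M l)) * (cmod (\<Sum>j<M. v j * cnj (freq M l j)))\<^sup>2) / real (2 * M * M)"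
proof -
  have "Re (a * of_real x) = Re a * x" for a x by simp
  thus ?thesis unfolding toeplitz_avg_form Re_divide_of_nat Re_sum by simp
qed

lemma toeplitz_avg_form_close:
  assumes "\<And>l. l < 2 * M \<Longrightarrow> \<bar>Re (sform M S (freq M l) (freq M l)) - \<xi> * Re (sform M R (freq M l) (freq M l))\<bar>
     \<le> t * Re (sform M R (freq M l) (freq M l))"
  shows "\<bar>Re (sform M (toeplitz_avg M S) v v) - \<xi> * Re (sform M (toeplitz_avg M R) v v)\<bar> \<le> t * Re (sform M (toeplitz_avg M R) v v)"
proof -
  define w where "w l = (cmod (\<Sum>j<M. v j * cnj (freq M l j)))\<^sup>2 / real (2 * M * M)" for l
  have w0: "0 \<le> w l" for l by (simp add: w_def)
  have form: "Re (sform M (toeplitz_avg M S) v v) = (\<Sum>l<2*M. Re (sform M S (freq M l) (freq M l)) * w l)" for S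
    unfolding Re_toeplitz_avg_form w_def by (simp add: sum_divide_distrib)
  have "\<bar>Re (sform M (toeplitz_avg M S) v v) - \<xi> * Re (sform M (toeplitz_avg M R) v v)\<bar> =
    \<bar>\<Sum>l<2*M. (Re (sform M S (freq M l) (freq M l)) - \<xi> * Re (sform M R (freq M l) (freq M l))) * w l\<bar>"
    unfolding form by (simp add: sum_distrib_left sum_subtractf left_diff_distrib mult.assoc)
  also have "\<dots> \<le> (\<Sum>l<2*M. \<bar>Re (sform M S (freq M l) (freq M l)) - \<xi> * Re (sform M R (freq M l) (freq M l))\<bar> * w l)"
    by (rule order.trans[OF sum_abs]) (simp add: abs_mult w0)
  also have "\<dots> \<le> (\<Sum>l<2*M. t * Re (sform M R (freq M l) (freq M l)) * w l)"
    using assms w0 by (intro sum_mono mult_right_mono) auto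
  also have "\<dots> = t * Re (sform M (toeplitz_avg M R) v v)" unfolding form by (simp add: sum_distrib_left mult.assoc)
  finally show ?thesis .
qed

lemma toeplitz_avg_form_nonneg:
  assumes "\<And>v. 0 \<le> Re (sform M S v v)"
  shows "0 \<le> Re (sform M (toeplitz_avg M S) v v)"
  unfolding Re_toeplitz_avg_form using assms by (intro divide_nonneg_nonneg sum_nonneg mult_nonneg_nonneg) auto

text \<open>The consequence of orthonormality from which all trace bounds follow.\<close>

locale bessel_family =
  fixes M :: nat and m :: real and v :: "nat \<Rightarrow> nat \<Rightarrow> complex"
  assumes m: "0 < m"
    and bessel: "\<And>e. (\<Sum>i<M. (cmod (\<Sum>j<M. v i j * e j))\<^sup>2) \<le> (\<Sum>j<M. (cmod (e j))\<^sup>2) / m"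
begin

text \<open>Each rank-one term of \<open>toeplitz_avg_form\<close> is controlled by Bessel's inequality, and the weights add up to
  the trace.\<close>

lemma sum_toeplitz_avg_form:
  assumes S: "\<And>v. 0 \<le> Re (sform M S v v)"
  shows "(\<Sum>i<M. Re (sform M (toeplitz_avg M S) (v i) (v i))) \<le> Re (\<Sum>p<M. S p p) / m"
proof (cases "M = 0")
  case False
  hence M: "0 < real M" by simp
  have "(\<Sum>i<M. Re (sform M (toeplitz_avg M S) (v i) (v i))) =
    (\<Sum>l<2*M. Re (sform M S (freq M l) (freq M l)) * (\<Sum>i<M. (cmod (\<Sum>j<M. v i j * cnj (freq M l j)))\<^sup>2)) / real (2 * M * M)"
    unfolding Re_toeplitz_avg_form sum_divide_distrib[symmetric] sum_distrib_left by (subst sum.swap) simp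
  also have "\<dots> \<le> (\<Sum>l<2*M. Re (sform M S (freq M l) (freq M l)) * (M / m)) / real (2 * M * M)"
  proof (intro divide_right_mono sum_mono mult_left_mono S)
    fix l
    show "(\<Sum>i<M. (cmod (\<Sum>j<M. v i j * cnj (freq M l j)))\<^sup>2) \<le> M / m"
      using bessel[of "\<lambda>j. cnj (freq M l j)"] by simp
  qed auto
  also have "\<dots> = Re (\<Sum>l<2*M. sform M S (freq M l) (freq M l)) * (M / m) / real (2 * M * M)"
    unfolding Re_sum sum_distrib_right ..
  also have "\<dots> = Re (\<Sum>p<M. S p p) / m" unfolding sum_freq_form using M m by (simp add: field_simps)
  finally show ?thesis .
qed simp

text \<open>\<open>2 \<bar>x y\<bar> \<le> \<epsilon> \<bar>x\<bar>\<^sup>2 + \<bar>y\<bar>\<^sup>2 / \<epsilon>\<close> is applied to the terms of \<open>v\<^sub>i\<^sup>* (F v\<^sub>i)\<close>. By Bessel's inequality the two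
  resulting sums of squares are at most \<open>1 / m\<close> times the traces of the identity and of \<open>F F\<^sup>*\<close>.\<close>

lemma sum_abs_form:
  assumes F: "\<And>a. a < M \<Longrightarrow> (\<Sum>b<M. (cmod (F a b))\<^sup>2) \<le> q" and \<epsilon>: "0 < \<epsilon>"
  shows "(\<Sum>i<M. \<bar>Re (sform M F (v i) (v i))\<bar>) \<le> M / (2 * m) * (\<epsilon> + q / \<epsilon>)"
proof -
  have one: "\<bar>Re (sform M F (v i) (v i))\<bar> \<le> (\<Sum>a<M. \<epsilon> / 2 * (cmod (v i a))\<^sup>2 + 1 / (2 * \<epsilon>) * (cmod (\<Sum>b<M. v i b * F a b))\<^sup>2)" for i
  proof -
    have "sform M F (v i) (v i) = (\<Sum>a<M. cnj (v i a) * (\<Sum>b<M. v i b * F a b))"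
      unfolding sform_def sum_distrib_left by (intro sum.cong refl) (simp only: ac_simps)
    hence "\<bar>Re (sform M F (v i) (v i))\<bar> \<le> cmod (\<Sum>a<M. cnj (v i a) * (\<Sum>b<M. v i b * F a b))"
      by (metis abs_Re_le_cmod)
    also have "\<dots> \<le> (\<Sum>a<M. cmod (v i a) * cmod (\<Sum>b<M. v i b * F a b))"
      by (rule order.trans[OF norm_sum]) (simp add: norm_mult)
    also have "\<dots> \<le> (\<Sum>a<M. \<epsilon> / 2 * (cmod (v i a))\<^sup>2 + 1 / (2 * \<epsilon>) * (cmod (\<Sum>b<M. v i b * F a b))\<^sup>2)"
    proof (intro sum_mono)
      fix a
      define x y where "x = cmod (v i a)" and "y = cmod (\<Sum>b<M. v i b * F a b)"
      have "0 \<le> (\<epsilon> * x - y)\<^sup>2" by simp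
      hence "2 * \<epsilon> * (x * y) \<le> \<epsilon>\<^sup>2 * x\<^sup>2 + y\<^sup>2" by (simp add: power2_eq_square algebra_simps)
      hence "x * y \<le> (\<epsilon>\<^sup>2 * x\<^sup>2 + y\<^sup>2) / (2 * \<epsilon>)" using \<epsilon> by (simp add: pos_le_divide_eq mult_ac)
      also have "\<dots> = \<epsilon> / 2 * x\<^sup>2 + 1 / (2 * \<epsilon>) * y\<^sup>2" using \<epsilon> by (simp add: add_divide_distrib power2_eq_square)
      finally show "cmod (v i a) * cmod (\<Sum>b<M. v i b * F a b) \<le> \<epsilon> / 2 * (cmod (v i a))\<^sup>2 + 1 / (2 * \<epsilon>) * (cmod (\<Sum>b<M. v i b * F a b))\<^sup>2"
        unfolding x_def y_def .
    qed
    finally show ?thesis .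
  qed
  have v2: "(\<Sum>i<M. (cmod (v i a))\<^sup>2) \<le> 1 / m" if a: "a < M" for a
  proof -
    define e :: "nat \<Rightarrow> complex" where "e j = (if a = j then 1 else 0)" for j
    have "(\<Sum>j<M. (cmod (e j))\<^sup>2) = (\<Sum>j<M. if a = j then 1 else 0)" by (intro sum.cong) (auto simp: e_def)
    moreover have "(\<Sum>j<M. v i j * e j) = v i a" for i
    proof -
      have "(\<Sum>j<M. v i j * e j) = (\<Sum>j<M. if a = j then v i j else 0)" by (intro sum.cong) (auto simp: e_def)
      thus ?thesis using a by simp
    qed
    ultimately show ?thesis using bessel[of e] a by simp
  qed
  have "(\<Sum>i<M. \<bar>Re (sform M F (v i) (v i))\<bar>) \<le> (\<Sum>i<M. \<Sum>a<M. \<epsilon> / 2 * (cmod (v i a))\<^sup>2 + 1 / (2 * \<epsilon>) * (cmod (\<Sum>b<M. v i b * F a b))\<^sup>2)"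
    by (intro sum_mono one)
  also have "\<dots> = (\<Sum>a<M. \<epsilon> / 2 * (\<Sum>i<M. (cmod (v i a))\<^sup>2) + 1 / (2 * \<epsilon>) * (\<Sum>i<M. (cmod (\<Sum>b<M. v i b * F a b))\<^sup>2))"
    by (subst sum.swap) (simp add: sum.distrib sum_distrib_left)
  also have "\<dots> \<le> (\<Sum>a<M. \<epsilon> / 2 * (1 / m) + 1 / (2 * \<epsilon>) * (q / m))"
  proof (intro sum_mono add_mono mult_left_mono)
    fix a assume "a \<in> {..<M}"
    thus "(\<Sum>i<M. (cmod (v i a))\<^sup>2) \<le> 1 / m" using v2 by simp
    have "(\<Sum>i<M. (cmod (\<Sum>b<M. v i b * F a b))\<^sup>2) \<le> (\<Sum>b<M. (cmod (F a b))\<^sup>2) / m" by (rule bessel)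
    also have "\<dots> \<le> q / m" using F \<open>a \<in> {..<M}\<close> m by (intro divide_right_mono) auto
    finally show "(\<Sum>i<M. (cmod (\<Sum>b<M. v i b * F a b))\<^sup>2) \<le> q / m" .
  qed (use \<epsilon> in auto)
  also have "\<dots> = M / (2 * m) * (\<epsilon> + q / \<epsilon>)" using m \<epsilon> by (simp add: field_simps)
  finally show ?thesis .
qed

end

text \<open>The diagonal of offset \<open>k\<close> has \<open>M - \<bar>k\<bar>\<close> entries.\<close>

lemma toeplitz_avg_toeplitz:
  assumes "i < M" "j < M"
  shows "toeplitz_avg M (\<lambda>i j. r (int i - int j)) i j = (1 - of_int \<bar>int i - int j\<bar> / of_nat M) * r (int i - int j)"
proof -
  define k where "k = int i - int j"
  have M: "0 < M" using assms by simp
  have inner: "(\<Sum>p<M. if int p - int q = k then r (int p - int q) else 0) = (if 0 \<le> int q + k \<and> int q + k < int M then r k else 0)" if "q < M" for q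
  proof -
    have "(\<Sum>p<M. if int p - int q = k then r (int p - int q) else 0) = (\<Sum>p<M. if p = nat (int q + k) then (if 0 \<le> int q + k then r k else 0) else 0)"
      by (intro sum.cong) auto
    also have "\<dots> = (if nat (int q + k) < M then (if 0 \<le> int q + k then r k else 0) else 0)"
      by (subst sum.delta) auto
    finally show ?thesis by auto
  qed
  have "(\<Sum>p<M. \<Sum>q<M. if int p - int q = k then r (int p - int q) else 0) = (\<Sum>q<M. if 0 \<le> int q + k \<and> int q + k < int M then r k else 0)"
    by (subst sum.swap, intro sum.cong refl inner) auto
  also have "\<dots> = of_nat (card {q\<in>{..<M}. 0 \<le> int q + k \<and> int q + k < int M}) * r k"
    by (simp add: sum.If_cases Int_def conj_ac)
  also have "{q\<in>{..<M}. 0 \<le> int q + k \<and> int q + k < int M} = {nat (max 0 (- k))..<nat (min (int M) (int M - k))}" by auto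
  also have "card \<dots> = nat (int M - \<bar>k\<bar>)" by (auto simp: max_def min_def abs_if)
  also have "(of_nat (nat (int M - \<bar>k\<bar>)) :: complex) = of_nat M - of_int \<bar>k\<bar>"
  proof -
    have "\<bar>k\<bar> \<le> int M" using assms by (simp add: k_def)
    thus ?thesis by (simp add: of_nat_nat)
  qed
  finally show ?thesis unfolding toeplitz_avg_def k_def using M by (simp add: field_simps)
qed

lemma sform_diff: "sform M (\<lambda>i j. S i j - T i j) u v = sform M S u v - sform M T u v"
  by (simp add: sform_def sum_subtractf algebra_simps)

lemma sform_add: "sform M (\<lambda>i j. S i j + T i j) u v = sform M S u v + sform M T u v"
  by (simp add: sform_def sum.distrib algebra_simps)

lemma toeplitz_avg_add: "toeplitz_avg M (\<lambda>i j. S i j + T i j) = (\<lambda>i j. toeplitz_avg M S i j + toeplitz_avg M T i j)"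
proof (intro ext)
  fix i j
  have "(\<Sum>p<M. \<Sum>q<M. if int p - int q = int i - int j then S p q + T p q else 0) =
    (\<Sum>p<M. \<Sum>q<M. (if int p - int q = int i - int j then S p q else 0) + (if int p - int q = int i - int j then T p q else 0))"
    by (intro sum.cong) auto
  thus "toeplitz_avg M (\<lambda>i j. S i j + T i j) i j = toeplitz_avg M S i j + toeplitz_avg M T i j"
    unfolding toeplitz_avg_def by (simp add: sum.distrib add_divide_distrib)
qed

section \<open>Toeplitz forms and Fourier coefficients\<close>

abbreviation torus :: "real measure" where
  "torus \<equiv> lebesgue_on {-pi..pi}"

definition trig_poly :: "nat \<Rightarrow> (nat \<Rightarrow> complex) \<Rightarrow> real \<Rightarrow> complex" where
  "trig_poly n v x = (\<Sum>j<n. v j * cis (real j * x))"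

lemma torus_cis_measurable [measurable]: "(\<lambda>x. cis (k * x)) \<in> borel_measurable torus"
proof -
  have "(\<lambda>x. cis (k * x)) \<in> borel_measurable borel"
    by (intro borel_measurable_continuous_onI continuous_intros)
  thus ?thesis by (intro measurable_restrict_space1 measurable_completion) simp
qed

lemma trig_poly_measurable [measurable]: "trig_poly n v \<in> borel_measurable torus"
  unfolding trig_poly_def by measurable

lemma torus_finite: "finite_measure torus"
  by (rule finite_measure_lebesgue_on) simp

lemma measure_torus: "measure torus {-pi..pi} = 2 * pi"
  by (simp add: measure_restrict_space)

lemma integrable_torus_bounded:
  fixes g :: "real \<Rightarrow> 'a :: {banach, second_countable_topology}"
  assumes "g \<in> borel_measurable torus" "\<And>x. norm (g x) \<le> B"
  shows "integrable torus g"
  by (rule finite_measure.integrable_const_bound[OF torus_finite]) (use assms in auto)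

lemma integrable_torus_mult_bounded:
  fixes f :: "real \<Rightarrow> real" and g :: "real \<Rightarrow> real"
  assumes f: "integrable torus f" and g [measurable]: "g \<in> borel_measurable torus" and B: "\<And>x. \<bar>g x\<bar> \<le> B"
  shows "integrable torus (\<lambda>x. f x * g x)"
proof (rule Bochner_Integration.integrable_bound)
  show "integrable torus (\<lambda>x. \<bar>f x\<bar> * B)" using f by auto
  have [measurable]: "f \<in> borel_measurable torus" using f by auto
  show "(\<lambda>x. f x * g x) \<in> borel_measurable torus" by measurable
  show "AE x in torus. norm (f x * g x) \<le> norm (\<bar>f x\<bar> * B)"
  proof (rule AE_I2)
    fix x
    have "\<bar>g x\<bar> \<le> \<bar>B\<bar>" using B[of x] by linarith
    thus "norm (f x * g x) \<le> norm (\<bar>f x\<bar> * B)" by (simp add: abs_mult mult_left_mono)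
  qed
qed

lemma integrable_torus_cis:
  assumes f: "integrable torus f"
  shows "integrable torus (\<lambda>x. complex_of_real (f x) * cis (k * x))"
proof (rule Bochner_Integration.integrable_bound[OF f])
  have [measurable]: "f \<in> borel_measurable torus" using f by auto
  show "(\<lambda>x. complex_of_real (f x) * cis (k * x)) \<in> borel_measurable torus" by measurable
qed (simp add: norm_mult)

lemma integrable_torus_cis_minus:
  "integrable torus f \<Longrightarrow> integrable torus (\<lambda>x. complex_of_real (f x) * cis (- (k * x)))"
  using integrable_torus_cis[of f "- k"] by simp

lemma fourier_coeff_torus:
  "fourier_coeff f k = (\<integral>x. of_real (f x) * cis (- (of_int k * x)) \<partial>torus) / of_real (2 * pi)"
proof -
  have "exp (- \<i> * of_int k * of_real x) = cis (- (of_int k * x))" for x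
    by (simp add: cis_conv_exp mult.assoc)
  thus ?thesis unfolding fourier_coeff_def set_lebesgue_integral_def
    by (subst integral_restrict_space) auto
qed

lemma fourier_coeff_minus: "fourier_coeff f (- k) = cnj (fourier_coeff f k)"
proof -
  have "(\<integral>x. of_real (f x) * cis (- (of_int (- k) * x)) \<partial>torus) = (\<integral>x. cnj (of_real (f x) * cis (- (of_int k * x))) \<partial>torus)"
    by (simp add: cis_cnj)
  also have "\<dots> = cnj (\<integral>x. of_real (f x) * cis (- (of_int k * x)) \<partial>torus)" by (rule Bochner_Integration.integral_cnj)
  finally show ?thesis unfolding fourier_coeff_torus by simp
qed

lemma fourier_coeff_add:
  assumes "integrable torus f" "integrable torus g"
  shows "fourier_coeff (\<lambda>x. f x + g x) k = fourier_coeff f k + fourier_coeff g k"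
  unfolding fourier_coeff_torus
  using integrable_torus_cis[OF assms(1), of "- of_int k"] integrable_torus_cis[OF assms(2), of "- of_int k"]
  by (simp add: distrib_right add_divide_distrib)

lemma fourier_coeff_0: "fourier_coeff f 0 = of_real ((\<integral>x. f x \<partial>torus) / (2 * pi))"
  by (simp add: fourier_coeff_torus)

lemma fourier_coeff_const: "fourier_coeff (\<lambda>_. 1) k = (if k = 0 then 1 else 0)"
proof (cases "k = 0")
  case True
  thus ?thesis by (simp add: fourier_coeff_0 measure_torus)
next
  case False
  \<comment> \<open>An antiderivative; it takes the same value at both end points.\<close>
  define F where "F x = cis (- (real_of_int k * x)) * (\<i> / of_int k)" for x
  have "((\<lambda>x. cis (- (real_of_int k * x))) has_integral (F pi - F (- pi))) {-pi..pi}"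
  proof (rule fundamental_theorem_of_calculus)
    fix x assume "x \<in> {-pi..pi}"
    have "((\<lambda>z. exp (- \<i> * of_int k * z) * (\<i> / of_int k)) has_field_derivative exp (- \<i> * of_int k * of_real x)) (at (of_real x))"
      using False by (auto intro!: derivative_eq_intros)
    hence "((\<lambda>x. exp (- \<i> * of_int k * of_real x) * (\<i> / of_int k)) has_vector_derivative exp (- \<i> * of_int k * of_real x)) (at x within {-pi..pi})"
      by (rule has_vector_derivative_real_field)
    thus "(F has_vector_derivative cis (- (real_of_int k * x))) (at x within {-pi..pi})"
      unfolding F_def cis_conv_exp by (simp add: mult.assoc)
  qed simp
  moreover have "F pi = F (- pi)"
  proof -
    have "cis (- (real_of_int k * pi)) = cis (real_of_int k * pi)"
      by (simp add: complex_eq_iff sin_times_pi_eq_0)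
    thus ?thesis by (simp add: F_def)
  qed
  ultimately have hi: "((\<lambda>x. cis (- (real_of_int k * x))) has_integral 0) {-pi..pi}" by simp
  have "set_integrable lebesgue {-pi..pi} (\<lambda>x. cis (- (real_of_int k * x)))"
    by (intro absolutely_integrable_continuous_real continuous_intros)
  hence "(LINT x:{-pi..pi}|lebesgue. cis (- (real_of_int k * x))) = 0"
    using set_lebesgue_integral_eq_integral(2) integral_unique[OF hi] by metis
  hence "(\<integral>x. cis (- (real_of_int k * x)) \<partial>torus) = 0"
    unfolding set_lebesgue_integral_def by (subst integral_restrict_space) auto
  thus ?thesis using False by (simp add: fourier_coeff_torus)
qed

lemma trig_poly_bound: "cmod (trig_poly n v x) \<le> (\<Sum>j<n. cmod (v j))"
  unfolding trig_poly_def by (rule order.trans[OF norm_sum]) (simp add: norm_mult)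

lemma integrable_torus_trig_poly:
  assumes "integrable torus f"
  shows "integrable torus (\<lambda>x. f x * (cmod (trig_poly n v x))\<^sup>2)"
  by (rule integrable_torus_mult_bounded[OF assms, of _ "(\<Sum>j<n. cmod (v j))\<^sup>2"])
     (auto intro: power_mono trig_poly_bound)

lemma toeplitz_form:
  assumes f: "integrable torus f"
  shows "sform n (\<lambda>i j. fourier_coeff f (int i - int j)) v v =
    of_real ((\<integral>x. f x * (cmod (trig_poly n v x))\<^sup>2 \<partial>torus) / (2 * pi))"
proof -
  have i: "integrable torus (\<lambda>x. cnj (v i) * (of_real (f x) * cis (- (of_int (int i - int j) * x))) * v j)" for i j
    by (intro integrable_mult_left integrable_mult_right integrable_torus_cis_minus f)
  have e: "(\<Sum>i<n. \<Sum>j<n. cnj (v i) * (of_real (f x) * cis (- (of_int (int i - int j) * x))) * v j) = of_real (f x * (cmod (trig_poly n v x))\<^sup>2)" for x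
  proof -
    have "complex_of_real ((cmod (trig_poly n v x))\<^sup>2) = cnj (trig_poly n v x) * trig_poly n v x"
      unfolding complex_norm_square by (rule mult.commute)
    also have "\<dots> = (\<Sum>i<n. \<Sum>j<n. cnj (v i) * cis (- (real i * x)) * (v j * cis (real j * x)))"
      unfolding trig_poly_def cnj_sum sum_product by (simp add: cis_cnj)
    also have "\<dots> = (\<Sum>i<n. \<Sum>j<n. cnj (v i) * cis (- (of_int (int i - int j) * x)) * v j)"
    proof (intro sum.cong refl)
      fix i j
      have c: "cis (- (real i * x)) * cis (real j * x) = cis (- (of_int (int i - int j) * x))"
        unfolding cis_mult by (rule arg_cong[of _ _ cis]) (simp add: algebra_simps)
      thus "cnj (v i) * cis (- (real i * x)) * (v j * cis (real j * x)) = cnj (v i) * cis (- (of_int (int i - int j) * x)) * v j"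
        unfolding c[symmetric] by (simp only: ac_simps)
    qed
    finally show ?thesis unfolding of_real_mult by (simp add: sum_distrib_left mult_ac)
  qed
  have "sform n (\<lambda>i j. fourier_coeff f (int i - int j)) v v =
    (\<Sum>i<n. \<Sum>j<n. \<integral>x. cnj (v i) * (of_real (f x) * cis (- (of_int (int i - int j) * x))) * v j \<partial>torus) / of_real (2 * pi)"
    unfolding sform_def sum_divide_distrib
  proof (intro sum.cong refl)
    fix i j
    show "cnj (v i) * fourier_coeff f (int i - int j) * v j =
      (\<integral>x. cnj (v i) * (of_real (f x) * cis (- (of_int (int i - int j) * x))) * v j \<partial>torus) / of_real (2 * pi)"
      using integrable_torus_cis_minus[OF f, of "of_int (int i - int j)"] by (simp add: fourier_coeff_torus del: of_int_diff)
  qed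
  also have "(\<Sum>i<n. \<Sum>j<n. \<integral>x. cnj (v i) * (of_real (f x) * cis (- (of_int (int i - int j) * x))) * v j \<partial>torus) =
    (\<integral>x. (\<Sum>i<n. \<Sum>j<n. cnj (v i) * (of_real (f x) * cis (- (of_int (int i - int j) * x))) * v j) \<partial>torus)"
  proof (rule sym, rule trans[OF Bochner_Integration.integral_sum])
    show "integrable torus (\<lambda>x. \<Sum>j<n. cnj (v i) * (of_real (f x) * cis (- (of_int (int i - int j) * x))) * v j)" for i
      by (intro Bochner_Integration.integrable_sum i)
  qed (intro sum.cong refl Bochner_Integration.integral_sum i)
  finally show ?thesis unfolding e integral_complex_of_real of_real_divide .
qed

lemma trig_poly_norm:
  "(\<integral>x. (cmod (trig_poly n v x))\<^sup>2 \<partial>torus) = 2 * pi * (\<Sum>j<n. (cmod (v j))\<^sup>2)"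
proof -
  have "integrable torus (\<lambda>_. 1 :: real)" by (rule integrable_torus_bounded[where B = 1]) auto
  hence "of_real ((\<integral>x. (cmod (trig_poly n v x))\<^sup>2 \<partial>torus) / (2 * pi)) = sform n (\<lambda>i j. fourier_coeff (\<lambda>_. 1) (int i - int j)) v v"
    by (subst toeplitz_form) auto
  also have "\<dots> = (\<Sum>i<n. \<Sum>j<n. if i = j then cnj (v i) * v i else 0)"
    unfolding sform_def by (intro sum.cong refl) (auto simp: fourier_coeff_const)
  also have "\<dots> = (\<Sum>i<n. v i * cnj (v i))" by (rule sum.cong[OF refl], subst sum.delta') (auto simp: mult.commute)
  also have "\<dots> = of_real (\<Sum>j<n. (cmod (v j))\<^sup>2)" unfolding of_real_sum complex_norm_square ..
  finally show ?thesis unfolding of_real_eq_iff by (simp add: field_simps)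
qed

lemma toeplitz_form_lower:
  assumes f: "integrable torus f" and m: "AE x in torus. m \<le> f x"
  shows "m * (\<Sum>j<n. (cmod (v j))\<^sup>2) \<le> Re (sform n (\<lambda>i j. fourier_coeff f (int i - int j)) v v)"
proof -
  have "(\<integral>x. m * (cmod (trig_poly n v x))\<^sup>2 \<partial>torus) \<le> (\<integral>x. f x * (cmod (trig_poly n v x))\<^sup>2 \<partial>torus)"
  proof (rule integral_mono_AE)
    show "integrable torus (\<lambda>x. m * (cmod (trig_poly n v x))\<^sup>2)"
      by (rule integrable_torus_trig_poly) (rule integrable_torus_bounded[where B = "\<bar>m\<bar>"], auto)
    show "AE x in torus. m * (cmod (trig_poly n v x))\<^sup>2 \<le> f x * (cmod (trig_poly n v x))\<^sup>2"
      using m by eventually_elim (auto intro: mult_right_mono)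
  qed (rule integrable_torus_trig_poly[OF f])
  thus ?thesis unfolding toeplitz_form[OF f] by (simp add: trig_poly_norm field_simps)
qed

lemma toeplitz_form_nonneg:
  assumes f: "integrable torus f" and "AE x in torus. 0 \<le> f x"
  shows "0 \<le> Re (sform n (\<lambda>i j. fourier_coeff f (int i - int j)) v v)"
  using toeplitz_form_lower[OF f, of 0] assms(2) by simp

lemma (in bessel_family) sum_toeplitz_form:
  assumes g: "integrable torus g" and g0: "AE x in torus. 0 \<le> g x"
  shows "(\<Sum>i<M. Re (sform M (\<lambda>i j. fourier_coeff g (int i - int j)) (v i) (v i))) \<le> M / m * ((\<integral>x. g x \<partial>torus) / (2 * pi))"
proof -
  have "(\<Sum>i<M. Re (sform M (\<lambda>i j. fourier_coeff g (int i - int j)) (v i) (v i))) =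
    (\<integral>x. (\<Sum>i<M. g x * (cmod (trig_poly M (v i) x))\<^sup>2) \<partial>torus) / (2 * pi)"
    unfolding toeplitz_form[OF g] Re_complex_of_real sum_divide_distrib[symmetric]
    by (subst Bochner_Integration.integral_sum) (auto intro: integrable_torus_trig_poly[OF g])
  also have "\<dots> \<le> (\<integral>x. g x * (M / m) \<partial>torus) / (2 * pi)"
  proof (intro divide_right_mono integral_mono_AE)
    show "integrable torus (\<lambda>x. \<Sum>i<M. g x * (cmod (trig_poly M (v i) x))\<^sup>2)"
      by (intro Bochner_Integration.integrable_sum integrable_torus_trig_poly[OF g])
    show "integrable torus (\<lambda>x. g x * (M / m))" using g by simp
    have b: "(\<Sum>i<M. (cmod (trig_poly M (v i) x))\<^sup>2) \<le> M / m" for x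
      using bessel[of "\<lambda>j. cis (real j * x)"] by (simp add: trig_poly_def)
    show "AE x in torus. (\<Sum>i<M. g x * (cmod (trig_poly M (v i) x))\<^sup>2) \<le> g x * (M / m)"
      using g0 by eventually_elim (unfold sum_distrib_left[symmetric], intro mult_left_mono b)
  qed simp
  finally show ?thesis by (simp add: mult_ac)
qed

text \<open>Bessel's inequality by duality: if \<open>p\<close> is the partial Fourier sum and \<open>Q\<close> the sum in question, then \<open>Q\<close> is the
  normalized integral of \<open>f \<cdot> cnj p\<close>, which is at most \<open>(B\<^sup>2 + Q) / 2\<close>.\<close>

lemma bounded_fourier_coeff_square_sum:
  assumes [measurable]: "f \<in> borel_measurable torus" and B: "\<And>x. \<bar>f x\<bar> \<le> B"
  shows "(\<Sum>k<n. (cmod (fourier_coeff f (int k)))\<^sup>2) \<le> B\<^sup>2"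
proof -
  have f: "integrable torus f" by (rule integrable_torus_bounded[where B = B]) (use B in auto)
  define c where "c k = fourier_coeff f (int k)" for k
  define Q where "Q = (\<Sum>k<n. (cmod (c k))\<^sup>2)"
  have "complex_of_real Q = (\<Sum>k<n. c k * cnj (c k))" unfolding Q_def of_real_sum complex_norm_square ..
  also have "\<dots> = (\<Sum>k<n. \<integral>x. of_real (f x) * cis (- (real k * x)) * cnj (c k) \<partial>torus) / of_real (2 * pi)"
    unfolding sum_divide_distrib
  proof (intro sum.cong refl)
    fix k
    have "(\<integral>x. of_real (f x) * cis (- (real k * x)) * cnj (c k) \<partial>torus) = (\<integral>x. of_real (f x) * cis (- (real k * x)) \<partial>torus) * cnj (c k)"
      using integrable_torus_cis_minus[OF f, of "real k"] by simp
    thus "c k * cnj (c k) = (\<integral>x. of_real (f x) * cis (- (real k * x)) * cnj (c k) \<partial>torus) / of_real (2 * pi)"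
      by (simp add: c_def fourier_coeff_torus)
  qed
  also have "(\<Sum>k<n. \<integral>x. of_real (f x) * cis (- (real k * x)) * cnj (c k) \<partial>torus) =
    (\<integral>x. (\<Sum>k<n. of_real (f x) * cis (- (real k * x)) * cnj (c k)) \<partial>torus)"
    using integrable_torus_cis_minus[OF f] by (subst Bochner_Integration.integral_sum) auto
  also have "\<dots> = (\<integral>x. of_real (f x) * cnj (trig_poly n c x) \<partial>torus)"
    unfolding trig_poly_def cnj_sum sum_distrib_left by (simp add: cis_cnj mult_ac)
  finally have Q: "complex_of_real Q = (\<integral>x. of_real (f x) * cnj (trig_poly n c x) \<partial>torus) / of_real (2 * pi)" .
  have I: "integrable torus (\<lambda>x. (cmod (trig_poly n c x))\<^sup>2)"
    using integrable_torus_trig_poly[of "\<lambda>_. 1"] integrable_torus_bounded[where B = 1 and g = "\<lambda>_. 1 :: real"] by auto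
  have c: "integrable torus (\<lambda>_. B\<^sup>2)" by (rule integrable_torus_bounded[where B = "B\<^sup>2"]) auto
  have "2 * pi * Q = cmod (\<integral>x. of_real (f x) * cnj (trig_poly n c x) \<partial>torus)"
  proof -
    have "0 \<le> Q" unfolding Q_def by (intro sum_nonneg) auto
    hence "Q = cmod (complex_of_real Q)" by simp
    thus ?thesis unfolding Q by (simp add: norm_divide)
  qed
  also have "\<dots> \<le> (\<integral>x. (B\<^sup>2 + (cmod (trig_poly n c x))\<^sup>2) / 2 \<partial>torus)"
  proof (rule order.trans[OF Bochner_Integration.integral_norm_bound Bochner_Integration.integral_mono])
    have "integrable torus (\<lambda>x. of_real (f x) * cnj (trig_poly n c x))"
      unfolding trig_poly_def cnj_sum sum_distrib_left complex_cnj_mult cis_cnj mult.left_commute[of "of_real _"]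
      by (intro Bochner_Integration.integrable_sum integrable_mult_right integrable_torus_cis_minus f)
    thus "integrable torus (\<lambda>x. norm (of_real (f x) * cnj (trig_poly n c x)))" by (rule integrable_norm)
    show "integrable torus (\<lambda>x. (B\<^sup>2 + (cmod (trig_poly n c x))\<^sup>2) / 2)" using I c by simp
    fix x
    have "\<bar>f x\<bar> * cmod (trig_poly n c x) \<le> (\<bar>f x\<bar>\<^sup>2 + (cmod (trig_poly n c x))\<^sup>2) / 2"
      using sum_squares_bound[of "\<bar>f x\<bar>" "cmod (trig_poly n c x)"] by simp
    also have "\<dots> \<le> (B\<^sup>2 + (cmod (trig_poly n c x))\<^sup>2) / 2"
      using power_mono[OF B[of x], of 2] by simp
    finally show "norm (of_real (f x) * cnj (trig_poly n c x)) \<le> (B\<^sup>2 + (cmod (trig_poly n c x))\<^sup>2) / 2"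
      by (simp add: norm_mult)
  qed
  also have "\<dots> = (2 * pi * B\<^sup>2 + 2 * pi * Q) / 2"
  proof -
    have "(\<integral>x. B\<^sup>2 \<partial>torus) = 2 * pi * B\<^sup>2" by (simp add: measure_torus)
    thus ?thesis using I c by (simp add: trig_poly_norm Q_def)
  qed
  finally have "Q \<le> B\<^sup>2" by (simp add: field_simps)
  thus ?thesis by (simp add: Q_def c_def)
qed

text \<open>Tannery's theorem, with the summable majorant \<open>a\<close>.\<close>

lemma cesaro_square_sum_tendsto_0:
  fixes a :: "nat \<Rightarrow> real"
  assumes a0: "\<And>k. 0 \<le> a k" and bound: "\<And>n. (\<Sum>k<n. a k) \<le> B"
  shows "(\<lambda>M. \<Sum>k<M. a k * (k / M)\<^sup>2) \<longlonglongrightarrow> 0"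
proof -
  have sa: "summable a"
    by (rule bounded_imp_summable[where B = B, OF a0]) (unfold lessThan_Suc_atMost[symmetric], rule bound)
  define b where "b k M = (if k < M then a k * (k / M)\<^sup>2 else 0)" for k M :: nat
  have le: "norm (b k M) \<le> a k" for k M
  proof (cases "k < M")
    case True
    hence "(real k / real M)\<^sup>2 \<le> 1" by (simp add: power_le_one)
    thus ?thesis using True a0[of k] by (simp add: b_def mult_left_le)
  qed (simp add: b_def a0)
  have lim: "(\<lambda>M. b k M) \<longlonglongrightarrow> 0" for k
  proof (rule Lim_null_comparison)
    show "\<forall>\<^sub>F M in sequentially. norm (b k M) \<le> a k * (k / M)\<^sup>2"
      using a0[of k] by (intro always_eventually allI) (auto simp: b_def)
    have "(\<lambda>M. real k / real M) \<longlonglongrightarrow> 0" by (rule lim_const_over_n)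
    from tendsto_mult[OF tendsto_const tendsto_power[OF this, of 2], of "a k"]
    show "(\<lambda>M. a k * (k / M)\<^sup>2) \<longlonglongrightarrow> 0" by simp
  qed
  have "((\<lambda>M. suminf (\<lambda>k. b k M)) \<longlongrightarrow> suminf (\<lambda>_. 0)) sequentially"
    using tannerys_theorem[of b "\<lambda>_. 0" sequentially a, OF lim always_eventually sa] le
    by (simp add: case_prod_beta)
  moreover have "suminf (\<lambda>k. b k M) = (\<Sum>k<M. a k * (k / M)\<^sup>2)" for M
    by (subst suminf_finite[of "{..<M}"]) (auto simp: b_def)
  ultimately show ?thesis by simp
qed

lemma truncation_integral_tendsto_0:
  assumes f: "integrable torus f" and f0: "AE x in torus. 0 \<le> f x"
  shows "(\<lambda>K::nat. \<integral>x. f x - max 0 (min (f x) (real K)) \<partial>torus) \<longlonglongrightarrow> 0"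
proof -
  have [measurable]: "f \<in> borel_measurable torus" using f by auto
  have "(\<lambda>K::nat. \<integral>x. f x - max 0 (min (f x) (real K)) \<partial>torus) \<longlonglongrightarrow> (\<integral>x. 0 \<partial>torus)"
  proof (rule integral_dominated_convergence[where w = "\<lambda>x. \<bar>f x\<bar>"])
    show "AE x in torus. (\<lambda>K::nat. f x - max 0 (min (f x) (real K))) \<longlonglongrightarrow> 0"
      using f0
    proof (elim AE_mp, intro AE_I2 impI, intro tendsto_eventually)
      fix x assume "0 \<le> f x"
      moreover obtain K0 :: nat where "f x \<le> real K0" using real_arch_simple by blast
      ultimately show "\<forall>\<^sub>F K in sequentially. f x - max 0 (min (f x) (real K)) = 0"
        by (intro eventually_sequentiallyI[of K0]) auto
    qed
  qed (use f in auto)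
  thus ?thesis by simp
qed

section \<open>Deviation of the eigenvalues from 1\<close>

lemma sum_abs_diff_le:
  fixes h :: "nat \<Rightarrow> real"
  assumes h: "\<And>k. 0 \<le> h k" and a: "a < M"
  shows "(\<Sum>b<M. h (nat \<bar>int a - int b\<bar>)) \<le> 2 * (\<Sum>k<M. h k)"
proof -
  have part: "(\<Sum>b\<in>B. h (nat \<bar>int a - int b\<bar>)) \<le> (\<Sum>k<M. h k)"
    if B: "B \<subseteq> {..<M}" and inj: "inj_on (\<lambda>b. nat \<bar>int a - int b\<bar>) B" for B
  proof -
    have "(\<Sum>b\<in>B. h (nat \<bar>int a - int b\<bar>)) = sum h ((\<lambda>b. nat \<bar>int a - int b\<bar>) ` B)"
      using sum.reindex[OF inj, of h] by simp
    also have "\<dots> \<le> (\<Sum>k<M. h k)" using B a by (intro sum_mono2 h) auto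
    finally show ?thesis .
  qed
  have "(\<Sum>b<M. h (nat \<bar>int a - int b\<bar>)) = (\<Sum>b\<in>{..a} \<union> {a<..<M}. h (nat \<bar>int a - int b\<bar>))"
    using a by (intro sum.cong) auto
  also have "\<dots> = (\<Sum>b\<in>{..a}. h (nat \<bar>int a - int b\<bar>)) + (\<Sum>b\<in>{a<..<M}. h (nat \<bar>int a - int b\<bar>))"
    by (rule sum.union_disjoint) auto
  also have "\<dots> \<le> (\<Sum>k<M. h k) + (\<Sum>k<M. h k)"
    using a by (intro add_mono part) (auto simp: inj_on_def)
  finally show ?thesis by simp
qed

text \<open>The deterministic core. The eigenvalues deviate from 1 through the relative errors \<open>t\<close> at the
  frequencies, through \<open>\<xi> - 1\<close>, through the part of \<open>f\<close> above the level \<open>K\<close>, and through the damping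
  of the Fourier coefficients of the truncated density; \<open>\<epsilon>\<close> is a free parameter.\<close>

lemma eigenvalue_deviation:
  fixes f :: "real \<Rightarrow> real" and l :: "nat \<Rightarrow> real" and K :: nat and v :: "nat \<Rightarrow> nat \<Rightarrow> complex"
  defines "R \<equiv> \<lambda>i j. fourier_coeff f (int i - int j)"
    and "f1 \<equiv> \<lambda>x. max 0 (min (f x) (real K))"
  assumes f: "integrable torus f" and low: "AE x in torus. m \<le> f x" and m: "0 < m"
    and orth: "\<And>i j. i < M \<Longrightarrow> j < M \<Longrightarrow> sform M R (v i) (v j) = (if i = j then 1 else 0)"
    and l: "\<And>i. i < M \<Longrightarrow> sform M (toeplitz_avg M S) (v i) (v i) = of_real (l i)"
    and close: "\<And>k. k < 2 * M \<Longrightarrow> \<bar>Re (sform M S (freq M k) (freq M k)) - \<xi> * Re (sform M R (freq M k) (freq M k))\<bar>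
        \<le> t * Re (sform M R (freq M k) (freq M k))"
    and \<epsilon>: "0 < \<epsilon>" and t: "0 \<le> t"
  shows "(\<Sum>i<M. \<bar>l i - 1\<bar>) \<le> M / m * ((t + \<bar>\<xi> - 1\<bar>) * ((\<integral>x. f x \<partial>torus) / (2 * pi))
      + 2 * ((\<integral>x. f x - f1 x \<partial>torus) / (2 * pi)))
      + M / (2 * m) * (\<epsilon> + 2 * (\<Sum>k<M. (cmod (fourier_coeff f1 (int k)))\<^sup>2 * (k / M)\<^sup>2) / \<epsilon>)"
proof -
  have lowR: "m * (\<Sum>i<M. (cmod (w i))\<^sup>2) \<le> Re (sform M R w w)" for w
    unfolding R_def by (rule toeplitz_form_lower[OF f low])
  interpret bessel_family M m v
    by unfold_locales (use m bessel_sform[OF orth lowR m] in auto)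
  have [measurable]: "f \<in> borel_measurable torus" using f by auto
  have f1m [measurable]: "f1 \<in> borel_measurable torus" unfolding f1_def by measurable
  \<comment> \<open>The maximum with 0 changes the density on a null set only; it makes \<open>f1\<close> bounded everywhere.\<close>
  have f1: "integrable torus f1" by (rule integrable_torus_bounded[where B = "real K"]) (auto simp: f1_def)
  \<comment> \<open>The integrable part above the level \<open>K\<close> is positive almost everywhere.\<close>
  define f2 where "f2 x = f x - f1 x" for x
  have f2: "integrable torus f2" unfolding f2_def using f f1 by simp
  have f0: "AE x in torus. 0 \<le> f x" using low by eventually_elim (use m in simp)
  have f20: "AE x in torus. 0 \<le> f2 x" using f0 by eventually_elim (auto simp: f2_def f1_def)
  define R1 where "R1 = (\<lambda>i j. fourier_coeff f1 (int i - int j))"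
  define R2 where "R2 = (\<lambda>i j. fourier_coeff f2 (int i - int j))"
  have R: "R = (\<lambda>i j. R1 i j + R2 i j)"
    unfolding R_def R1_def R2_def fourier_coeff_add[OF f1 f2, symmetric] by (simp add: f2_def)
  have R0: "0 \<le> Re (sform M R w w)" for w unfolding R_def by (rule toeplitz_form_nonneg[OF f f0])
  have R20: "0 \<le> Re (sform M R2 w w)" for w unfolding R2_def by (rule toeplitz_form_nonneg[OF f2 f20])
  define F where "F = (\<lambda>i j. toeplitz_avg M R1 i j - R1 i j)"
  define r where "r = (\<integral>x. f x \<partial>torus) / (2 * pi)"
  define g where "g = (\<integral>x. f2 x \<partial>torus) / (2 * pi)"
  define q where "q = (\<Sum>k<M. (cmod (fourier_coeff f1 (int k)))\<^sup>2 * (k / M)\<^sup>2)"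
  define A where "A i = Re (sform M (toeplitz_avg M R) (v i) (v i))" for i
  define B where "B i = Re (sform M (toeplitz_avg M R2) (v i) (v i))" for i
  define B' where "B' i = Re (sform M R2 (v i) (v i))" for i
  define E where "E i = \<bar>Re (sform M F (v i) (v i))\<bar>" for i
  have A0: "0 \<le> A i" for i unfolding A_def by (rule toeplitz_avg_form_nonneg[OF R0])
  have B0: "0 \<le> B i" for i unfolding B_def by (rule toeplitz_avg_form_nonneg[OF R20])
  have B'0: "0 \<le> B' i" for i unfolding B'_def by (rule R20)
  have point: "\<bar>l i - 1\<bar> \<le> (t + \<bar>\<xi> - 1\<bar>) * A i + E i + B i + B' i" if i: "i < M" for i
  proof -
    have li: "l i = Re (sform M (toeplitz_avg M S) (v i) (v i))" using l[OF i] by simp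
    have 1: "\<bar>l i - \<xi> * A i\<bar> \<le> t * A i"
      unfolding li A_def by (rule toeplitz_avg_form_close[OF close])
    have "Re (sform M R (v i) (v i)) = 1" using orth[OF i i] by simp
    hence one: "Re (sform M R1 (v i) (v i)) + B' i = 1" unfolding R sform_add B'_def by simp
    have Asplit: "A i = Re (sform M (toeplitz_avg M R1) (v i) (v i)) + B i"
      unfolding A_def B_def R toeplitz_avg_add sform_add by simp
    have "Re (sform M F (v i) (v i)) = Re (sform M (toeplitz_avg M R1) (v i) (v i)) - Re (sform M R1 (v i) (v i))"
      unfolding F_def sform_diff by simp
    hence "l i - 1 = (l i - \<xi> * A i) + (\<xi> - 1) * A i + Re (sform M F (v i) (v i)) + B i - B' i"
      using one Asplit by (simp add: algebra_simps)
    moreover have "\<bar>(\<xi> - 1) * A i\<bar> = \<bar>\<xi> - 1\<bar> * A i" using A0[of i] by (simp add: abs_mult)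
    ultimately have "\<bar>l i - 1\<bar> \<le> t * A i + \<bar>\<xi> - 1\<bar> * A i + E i + B i + B' i"
      using 1 B0[of i] B'0[of i] unfolding E_def by linarith
    thus ?thesis by (simp add: distrib_right)
  qed
  have trace: "Re (\<Sum>p<M. fourier_coeff h (int p - int p)) = M * ((\<integral>x. h x \<partial>torus) / (2 * pi))" for h
    by (simp add: fourier_coeff_0)
  have sA: "(\<Sum>i<M. A i) \<le> M / m * r"
    using sum_toeplitz_avg_form[OF R0] trace[of f] by (simp add: A_def R_def r_def mult_ac)
  have sB: "(\<Sum>i<M. B i) \<le> M / m * g"
    using sum_toeplitz_avg_form[OF R20] trace[of f2] by (simp add: B_def R2_def g_def mult_ac)
  have sB': "(\<Sum>i<M. B' i) \<le> M / m * g"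
    using sum_toeplitz_form[OF f2 f20] by (simp add: B'_def R2_def g_def mult_ac)
  have sE: "(\<Sum>i<M. E i) \<le> M / (2 * m) * (\<epsilon> + 2 * q / \<epsilon>)"
    unfolding E_def
  proof (rule sum_abs_form[OF _ \<epsilon>])
    fix a assume a: "a < M"
    define h where "h k = (cmod (fourier_coeff f1 (int k)))\<^sup>2 * (k / M)\<^sup>2" for k :: nat
    have "(\<Sum>b<M. (cmod (F a b))\<^sup>2) = (\<Sum>b<M. h (nat \<bar>int a - int b\<bar>))"
    proof (intro sum.cong refl)
      fix b assume "b \<in> {..<M}"
      hence b: "b < M" by simp
      define d where "d = int a - int b"
      have "F a b = - (of_int \<bar>d\<bar> / of_nat M) * fourier_coeff f1 d"
        unfolding F_def R1_def toeplitz_avg_toeplitz[OF a b] d_def by (simp add: algebra_simps)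
      hence "cmod (F a b) = real_of_int \<bar>d\<bar> / M * cmod (fourier_coeff f1 d)"
        by (simp add: norm_mult norm_divide)
      moreover have "cmod (fourier_coeff f1 d) = cmod (fourier_coeff f1 \<bar>d\<bar>)"
        using fourier_coeff_minus[of f1 d] by (cases "0 \<le> d") auto
      ultimately show "(cmod (F a b))\<^sup>2 = h (nat \<bar>int a - int b\<bar>)"
        unfolding h_def d_def by (simp add: power_mult_distrib power_divide mult.commute)
    qed
    also have "\<dots> \<le> 2 * (\<Sum>k<M. h k)" by (rule sum_abs_diff_le[OF _ a]) (simp add: h_def)
    finally show "(\<Sum>b<M. (cmod (F a b))\<^sup>2) \<le> 2 * q" unfolding q_def h_def .
  qed
  have "(\<Sum>i<M. \<bar>l i - 1\<bar>) \<le> (\<Sum>i<M. (t + \<bar>\<xi> - 1\<bar>) * A i + E i + B i + B' i)"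
    by (intro sum_mono point) auto
  also have "\<dots> = (t + \<bar>\<xi> - 1\<bar>) * (\<Sum>i<M. A i) + (\<Sum>i<M. E i) + (\<Sum>i<M. B i) + (\<Sum>i<M. B' i)"
    by (simp add: sum.distrib sum_distrib_left)
  also have "\<dots> \<le> (t + \<bar>\<xi> - 1\<bar>) * (M / m * r) + M / (2 * m) * (\<epsilon> + 2 * q / \<epsilon>) + M / m * g + M / m * g"
    using t by (intro add_mono mult_left_mono sA sB sB' sE) auto
  also have "\<dots> = M / m * ((t + \<bar>\<xi> - 1\<bar>) * r + 2 * g) + M / (2 * m) * (\<epsilon> + 2 * q / \<epsilon>)"
    by (simp add: algebra_simps add_divide_distrib)
  finally show ?thesis unfolding r_def g_def f2_def q_def .
qed

section \<open>The matrices of the model\<close>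

lemma toeplitz_carrier [simp]: "toeplitz n r \<in> carrier_mat n n"
  by (simp add: toeplitz_def)

lemma R_mat_carrier [simp]: "R_mat f M \<in> carrier_mat M M"
  by (simp add: R_mat_def)

lemma R_mat_entry: "i < M \<Longrightarrow> j < M \<Longrightarrow> R_mat f M $$ (i, j) = fourier_coeff f (int i - int j)"
  by (simp add: R_mat_def toeplitz_def)

lemma sform_cong:
  assumes "\<And>i j. i < n \<Longrightarrow> j < n \<Longrightarrow> S i j = T i j"
  shows "sform n S u v = sform n T u v"
  unfolding sform_def using assms by (intro sum.cong refl) simp

lemma sform_R_mat: "sform M (\<lambda>i j. R_mat f M $$ (i, j)) u v = sform M (\<lambda>i j. fourier_coeff f (int i - int j)) u v"
  by (rule sform_cong) (rule R_mat_entry)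

lemma R_mat_hermitian: "mat_adjoint (R_mat f M) = R_mat f M"
proof (rule hermitianI[OF R_mat_carrier])
  fix i j assume ij: "i < M" "j < M"
  show "R_mat f M $$ (j, i) = cnj (R_mat f M $$ (i, j))"
    unfolding R_mat_entry[OF ij] R_mat_entry[OF ij(2,1)] fourier_coeff_minus[symmetric] by simp
qed

lemma R_mat_psd:
  assumes "integrable torus f" "AE x in torus. 0 \<le> f x"
  shows "pos_semidef (R_mat f M)"
  unfolding pos_semidef_sform[OF R_mat_carrier] sform_R_mat
  using R_mat_hermitian toeplitz_form_nonneg[OF assms] by blast

lemma mat_trace_C_mat: "Re (mat_trace (C_mat c n)) = (\<Sum>i<n. c n i)"
  by (simp add: mat_trace_def C_mat_def mat_diag_def)

lemma mat_trace_C_mat_square: "Re (mat_trace (C_mat c n * C_mat c n)) = (\<Sum>i<n. (c n i)\<^sup>2)"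
proof -
  have "C_mat c n * C_mat c n = mat_diag n (\<lambda>i. complex_of_real (c n i) * complex_of_real (c n i))"
    unfolding C_mat_def by (rule mat_diag_diag)
  thus ?thesis by (simp add: mat_trace_def mat_diag_def power2_eq_square)
qed

text \<open>The \<open>i\<close>-th coordinate vector attains the entry, and the supremum is over a set bounded by the trace.\<close>

lemma C_mat_entry_le_op_norm:
  assumes c: "\<And>i. i < n \<Longrightarrow> 0 \<le> c n i" and i: "i < n"
  shows "c n i \<le> op_norm (C_mat c n)"
proof -
  have C: "C_mat c n \<in> carrier_mat n n" by (simp add: C_mat_def)
  have Cv: "vec_index (C_mat c n *\<^sub>v v) k = of_real (c n k) * vec_index v k" if v: "v \<in> carrier_vec n" and k: "k < n" for v k
  proof -
    have "vec_index (C_mat c n *\<^sub>v v) k = (\<Sum>j<n. (if k = j then of_real (c n j) else 0) * vec_index v j)"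
      using v k by (simp add: C_mat_def mat_diag_def scalar_prod_def lessThan_atLeast0)
    also have "\<dots> = (\<Sum>j<n. if k = j then of_real (c n j) * vec_index v j else 0)"
      by (intro sum.cong) auto
    finally show ?thesis using k by simp
  qed
  define b where "b = (\<Sum>j<n. c n j)"
  have cb: "c n k \<le> b" if "k < n" for k
    unfolding b_def using that c by (intro member_le_sum) auto
  have bd: "l2_norm_vec (C_mat c n *\<^sub>v v) \<le> b" if v: "v \<in> carrier_vec n" and one: "l2_norm_vec v = 1" for v
  proof -
    have "(\<Sum>k<n. (cmod (vec_index v k))\<^sup>2) = 1" using one v by (simp add: l2_norm_vec_def)
    moreover have "(\<Sum>k<n. (cmod (vec_index (C_mat c n *\<^sub>v v) k))\<^sup>2) \<le> (\<Sum>k<n. b\<^sup>2 * (cmod (vec_index v k))\<^sup>2)"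
    proof (intro sum_mono)
      fix k assume "k \<in> {..<n}"
      hence k: "k < n" by simp
      have "(c n k)\<^sup>2 \<le> b\<^sup>2" using cb[OF k] c[OF k] by (intro power_mono) auto
      thus "(cmod (vec_index (C_mat c n *\<^sub>v v) k))\<^sup>2 \<le> b\<^sup>2 * (cmod (vec_index v k))\<^sup>2"
        unfolding Cv[OF v k] by (simp add: norm_mult power_mult_distrib mult_right_mono)
    qed
    ultimately have "(\<Sum>k<n. (cmod (vec_index (C_mat c n *\<^sub>v v) k))\<^sup>2) \<le> b\<^sup>2"
      by (simp add: sum_distrib_left[symmetric])
    moreover have "0 \<le> b" unfolding b_def using c by (intro sum_nonneg) auto
    ultimately show ?thesis using C by (auto simp: l2_norm_vec_def intro!: real_le_lsqrt sum_nonneg)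
  qed
  define e where "e = Matrix.vec n (\<lambda>k. if i = k then 1 else 0 :: complex)"
  have e: "e \<in> carrier_vec n" by (simp add: e_def)
  have norm_e: "l2_norm_vec e = 1"
  proof -
    have "(\<Sum>k<n. (cmod (vec_index e k))\<^sup>2) = (\<Sum>k<n. if i = k then 1 else 0)"
      by (intro sum.cong) (auto simp: e_def)
    thus ?thesis using i by (simp add: l2_norm_vec_def e_def)
  qed
  have norm_Ce: "l2_norm_vec (C_mat c n *\<^sub>v e) = c n i"
  proof -
    have "(\<Sum>k<n. (cmod (vec_index (C_mat c n *\<^sub>v e) k))\<^sup>2) = (\<Sum>k<n. if i = k then (c n i)\<^sup>2 else 0)"
    proof (rule sum.cong[OF refl])
      fix k assume "k \<in> {..<n}"
      hence k: "k < n" by simp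
      show "(cmod (vec_index (C_mat c n *\<^sub>v e) k))\<^sup>2 = (if i = k then (c n i)\<^sup>2 else 0)"
        unfolding Cv[OF e k] using k by (simp add: e_def)
    qed
    thus ?thesis using i c[OF i] C by (simp add: l2_norm_vec_def)
  qed
  show ?thesis unfolding op_norm_def
  proof (rule cSup_upper)
    show "c n i \<in> {l2_norm_vec (C_mat c n *\<^sub>v v) |v. v \<in> carrier_vec (dim_col (C_mat c n)) \<and> l2_norm_vec v = 1}"
      using e norm_e norm_Ce C by (auto intro!: exI[of _ e])
    show "bdd_above {l2_norm_vec (C_mat c n *\<^sub>v v) |v. v \<in> carrier_vec (dim_col (C_mat c n)) \<and> l2_norm_vec v = 1}"
      using bd C by (auto intro!: bdd_aboveI[of _ b])
  qed
qed

lemma S_mat_carrier: "X \<in> carrier_mat N M \<Longrightarrow> S_mat X \<in> carrier_mat M M"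
  by (auto simp: S_mat_def intro: mult_carrier_mat mat_adjoint_carrier)

lemma S_mat_entry:
  assumes X: "X \<in> carrier_mat N M" and ij: "i < M" "j < M"
  shows "S_mat X $$ (i, j) = (\<Sum>n<N. cnj (X $$ (n, i)) * X $$ (n, j)) / of_nat N"
proof -
  have "(mat_adjoint X * X) $$ (i, j) = (\<Sum>n<N. cnj (X $$ (n, i)) * X $$ (n, j))"
    unfolding mult_mat_entry[OF mat_adjoint_carrier[OF X] X ij]
    by (intro sum.cong) (auto simp: mat_adjoint_entry[OF X ij(1)])
  thus ?thesis using X ij by (simp add: S_mat_def)
qed

lemma S_mat_form:
  assumes X: "X \<in> carrier_mat N M"
  shows "sform M (\<lambda>i j. S_mat X $$ (i, j)) u u = of_real ((\<Sum>n<N. (cmod (\<Sum>p<M. X $$ (n, p) * u p))\<^sup>2) / N)"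
proof -
  have "sform M (\<lambda>i j. S_mat X $$ (i, j)) u u =
    (\<Sum>i<M. \<Sum>j<M. \<Sum>n<N. cnj (X $$ (n, i) * u i) * (X $$ (n, j) * u j)) / of_nat N"
    unfolding sform_def sum_divide_distrib
    by (intro sum.cong refl) (simp add: S_mat_entry[OF X] sum_distrib_left sum_distrib_right sum_divide_distrib mult_ac)
  also have "(\<Sum>i<M. \<Sum>j<M. \<Sum>n<N. cnj (X $$ (n, i) * u i) * (X $$ (n, j) * u j)) =
    (\<Sum>n<N. \<Sum>i<M. \<Sum>j<M. cnj (X $$ (n, i) * u i) * (X $$ (n, j) * u j))"
    by (rule sym, subst sum.swap, rule sum.cong[OF refl], rule sum.swap)
  also have "\<dots> = (\<Sum>n<N. of_real ((cmod (\<Sum>p<M. X $$ (n, p) * u p))\<^sup>2))"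
  proof (intro sum.cong refl)
    fix n
    have "complex_of_real ((cmod (\<Sum>p<M. X $$ (n, p) * u p))\<^sup>2) = cnj (\<Sum>p<M. X $$ (n, p) * u p) * (\<Sum>p<M. X $$ (n, p) * u p)"
      unfolding complex_norm_square by (rule mult.commute)
    thus "(\<Sum>i<M. \<Sum>j<M. cnj (X $$ (n, i) * u i) * (X $$ (n, j) * u j)) = of_real ((cmod (\<Sum>p<M. X $$ (n, p) * u p))\<^sup>2)"
      unfolding cnj_sum sum_product by simp
  qed
  finally show ?thesis by simp
qed

text \<open>The sum over \<open>q\<close> with both \<open>q\<close> and \<open>q + k\<close> in range runs through one diagonal.\<close>

lemma Rhat_b_entry:
  assumes X: "X \<in> carrier_mat N M" and ij: "i < M" "j < M"
  shows "Rhat_b X $$ (i, j) = toeplitz_avg M (\<lambda>p q. S_mat X $$ (p, q)) i j"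
proof -
  have S: "dim_row (S_mat X) = M" using S_mat_carrier[OF X] by simp
  define k where "k = int i - int j"
  have inner: "(\<Sum>p<M. if int p - int q = k then S_mat X $$ (p, q) else 0) =
      (if 0 \<le> int q + k \<and> int q + k < int M then S_mat X $$ (nat (int q + k), q) else 0)" for q
  proof -
    have "(\<Sum>p<M. if int p - int q = k then S_mat X $$ (p, q) else 0) =
       (\<Sum>p<M. if p = nat (int q + k) then (if 0 \<le> int q + k then S_mat X $$ (p, q) else 0) else 0)"
      by (intro sum.cong) auto
    thus ?thesis by (auto simp: sum.delta)
  qed
  have "(\<Sum>p<M. \<Sum>q<M. if int p - int q = k then S_mat X $$ (p, q) else 0) =
    (\<Sum>q<M. if 0 \<le> int q + k \<and> int q + k < int M then S_mat X $$ (nat (int q + k), q) else 0)"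
    by (subst sum.swap) (simp add: inner)
  also have "\<dots> = (\<Sum>q \<in> {q. q < M \<and> 0 \<le> int q + k \<and> int q + k < int M}. S_mat X $$ (nat (int q + k), q))"
    by (rule sum.mono_neutral_cong_right) auto
  finally show ?thesis
    using X ij by (simp add: Rhat_b_def toeplitz_def rhat_b_def S toeplitz_avg_def k_def)
qed

lemma Rhat_b_carrier: "X \<in> carrier_mat N M \<Longrightarrow> Rhat_b X \<in> carrier_mat M M"
  by (auto simp: Rhat_b_def toeplitz_def)

lemma sform_Rhat_b:
  assumes X: "X \<in> carrier_mat N M"
  shows "sform M (\<lambda>i j. Rhat_b X $$ (i, j)) u v = sform M (toeplitz_avg M (\<lambda>p q. S_mat X $$ (p, q))) u v"
  by (rule sform_cong) (rule Rhat_b_entry[OF X])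

lemma Rhat_b_hermitian:
  assumes X: "X \<in> carrier_mat N M"
  shows "mat_adjoint (Rhat_b X) = Rhat_b X"
proof (rule hermitianI[OF Rhat_b_carrier[OF X]])
  fix i j assume ij: "i < M" "j < M"
  have "(\<Sum>p<M. \<Sum>q<M. if int p - int q = int j - int i then S_mat X $$ (p, q) else 0) =
    (\<Sum>p<M. \<Sum>q<M. if int q - int p = int j - int i then S_mat X $$ (q, p) else 0)" by (rule sum.swap)
  also have "\<dots> = (\<Sum>p<M. \<Sum>q<M. cnj (if int p - int q = int i - int j then S_mat X $$ (p, q) else 0))"
    by (intro sum.cong refl) (auto simp: S_mat_entry[OF X] mult.commute)
  finally have "toeplitz_avg M (\<lambda>p q. S_mat X $$ (p, q)) j i = cnj (toeplitz_avg M (\<lambda>p q. S_mat X $$ (p, q)) i j)"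
    by (simp add: toeplitz_avg_def)
  thus "Rhat_b X $$ (j, i) = cnj (Rhat_b X $$ (i, j))"
    unfolding Rhat_b_entry[OF X ij] Rhat_b_entry[OF X ij(2,1)] .
qed

text \<open>The columns of the simultaneous diagonalization serve as the vectors \<open>v\<^sub>i\<close>.\<close>

lemma esd_whitened:
  assumes f: "integrable torus f" and low: "AE x in torus. m \<le> f x" and m: "0 < m"
    and X: "X \<in> carrier_mat N M" and M: "0 < M"
  obtains l v where "esd (the (mat_inverse (R_mat f M)) * Rhat_b X) = distr (measure_pmf (pmf_of_set {..<M})) borel l"
    "\<And>i j. i < M \<Longrightarrow> j < M \<Longrightarrow> sform M (\<lambda>i j. fourier_coeff f (int i - int j)) (v i) (v j) = (if i = j then 1 else 0)"
    "\<And>i. i < M \<Longrightarrow> sform M (toeplitz_avg M (\<lambda>p q. S_mat X $$ (p, q))) (v i) (v i) = of_real (l i)"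
proof -
  note R = R_mat_carrier[of f M] and T = Rhat_b_carrier[OF X]
  have pos: "0 < Re (sform M (\<lambda>i j. R_mat f M $$ (i, j)) v v)" if v: "\<exists>i<M. v i \<noteq> 0" for v
  proof -
    obtain i where i: "i < M" "v i \<noteq> 0" using v by blast
    have "0 < (cmod (v i))\<^sup>2" using i by simp
    also have "\<dots> \<le> (\<Sum>i<M. (cmod (v i))\<^sup>2)" using i by (intro member_le_sum) auto
    finally have "0 < m * (\<Sum>i<M. (cmod (v i))\<^sup>2)" using m by simp
    also have "\<dots> \<le> Re (sform M (\<lambda>i j. R_mat f M $$ (i, j)) v v)"
      unfolding sform_R_mat by (rule toeplitz_form_lower[OF f low])
    finally show ?thesis .
  qed
  obtain V l where V: "V \<in> carrier_mat M M" "mat_adjoint V * R_mat f M * V = 1\<^sub>m M"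
     "mat_adjoint V * Rhat_b X * V = mat_diag M (\<lambda>i. complex_of_real (l i))"
    using simultaneous_diagonalization[OF R R_mat_hermitian T Rhat_b_hermitian[OF X] pos] by blast
  show ?thesis
  proof (rule that[of l "\<lambda>i k. V $$ (k, i)"])
    show "esd (the (mat_inverse (R_mat f M)) * Rhat_b X) = distr (measure_pmf (pmf_of_set {..<M})) borel l"
      by (rule esd_eq_distr[OF char_poly_inverse_mult[OF R T V] M])
    fix i j assume ij: "i < M" "j < M"
    show "sform M (\<lambda>i j. fourier_coeff f (int i - int j)) (\<lambda>k. V $$ (k, i)) (\<lambda>k. V $$ (k, j)) = (if i = j then 1 else 0)"
      using sform_entry[OF V(1) R V(1) ij] V(2) ij by (simp add: sform_R_mat)
  next
    fix i assume i: "i < M"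
    show "sform M (toeplitz_avg M (\<lambda>p q. S_mat X $$ (p, q))) (\<lambda>k. V $$ (k, i)) (\<lambda>k. V $$ (k, i)) = of_real (l i)"
      using sform_entry[OF V(1) T V(1) i i] V(3) i by (simp add: sform_Rhat_b[OF X] mat_diag_def)
  qed
qed

text \<open>The vector \<open>R\<^sup>1\<^sup>/\<^sup>2 e\<close>, where \<open>e\<close> is the exponential vector of one frequency.\<close>

definition whitened_freq :: "(real \<Rightarrow> real) \<Rightarrow> nat \<Rightarrow> nat \<Rightarrow> nat \<Rightarrow> complex" where
  "whitened_freq f M l j = (\<Sum>p<M. psd_sqrt (R_mat f M) $$ (j, p) * freq M l p)"

lemma whitened_freq_norm:
  assumes f: "integrable torus f" "AE x in torus. 0 \<le> f x"
  shows "Re (sform M (\<lambda>i j. fourier_coeff f (int i - int j)) (freq M l) (freq M l)) = (\<Sum>j<M. (cmod (whitened_freq f M l j))\<^sup>2)"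
proof -
  define B where "B = psd_sqrt (R_mat f M)"
  have B: "B \<in> carrier_mat M M" "mat_adjoint B = B" "B * B = R_mat f M"
    using psd_sqrt_exists[OF R_mat_carrier R_mat_psd[OF f]] by (auto simp: B_def)
  have one: "1\<^sub>m M \<in> carrier_mat M M" by simp
  have "mat_adjoint B * 1\<^sub>m M * B = R_mat f M" using B by simp
  hence "sform M (\<lambda>i j. R_mat f M $$ (i, j)) (freq M l) (freq M l) =
    sform M (\<lambda>k l. 1\<^sub>m M $$ (k, l)) (whitened_freq f M l) (whitened_freq f M l)"
    using sform_conj[OF B(1) one, of "freq M l"] unfolding whitened_freq_def B_def by metis
  also have "\<dots> = (\<Sum>i<M. 1 * of_real ((cmod (whitened_freq f M l i))\<^sup>2))"
    unfolding mat_diag_one[symmetric] sform_mat_diag ..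
  also have "\<dots> = of_real (\<Sum>j<M. (cmod (whitened_freq f M l j))\<^sup>2)" by simp
  finally show ?thesis unfolding sform_R_mat by simp
qed

text \<open>At one frequency, the form of the sample covariance matrix is a weighted mean of squares of linear forms
  of the rows of \<open>Z\<close>, all with the same coefficient vector \<open>R\<^sup>1\<^sup>/\<^sup>2 e\<close>.\<close>

lemma X_mat_form:
  assumes c: "\<And>i. i < N \<Longrightarrow> 0 \<le> c N i" and f: "integrable torus f" "AE x in torus. 0 \<le> f x"
    and Z: "Z \<in> carrier_mat N M"
  shows "X_mat (C_mat c N) Z (R_mat f M) \<in> carrier_mat N M"
    and "Re (sform M (\<lambda>i j. S_mat (X_mat (C_mat c N) Z (R_mat f M)) $$ (i, j)) (freq M l) (freq M l)) =
      (\<Sum>n<N. c N n * (cmod (\<Sum>j<M. Z $$ (n, j) * whitened_freq f M l j))\<^sup>2) / N"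
proof -
  define B where "B = psd_sqrt (R_mat f M)"
  have B: "B \<in> carrier_mat M M"
    using psd_sqrt_exists[OF R_mat_carrier R_mat_psd[OF f]] by (auto simp: B_def)
  define D where "D = mat_diag N (\<lambda>i. complex_of_real (sqrt (c N i)))"
  have sC: "psd_sqrt (C_mat c N) = D" unfolding C_mat_def D_def by (rule psd_sqrt_mat_diag[OF c])
  define X where "X = X_mat (C_mat c N) Z (R_mat f M)"
  have XD: "X = D * Z * B" unfolding X_def X_mat_def sC B_def ..
  have D: "D \<in> carrier_mat N N" by (simp add: D_def)
  have DZ: "D * Z \<in> carrier_mat N M" using D Z by simp
  show X: "X_mat (C_mat c N) Z (R_mat f M) \<in> carrier_mat N M" using DZ B XD unfolding X_def by simp
  have DZe: "(D * Z) $$ (n, j) = of_real (sqrt (c N n)) * Z $$ (n, j)" if "n < N" "j < M" for n j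
    unfolding D_def mat_diag_mult_left[OF Z] using that by simp
  have row: "(cmod (\<Sum>p<M. X $$ (n, p) * freq M l p))\<^sup>2 = c N n * (cmod (\<Sum>j<M. Z $$ (n, j) * whitened_freq f M l j))\<^sup>2" if n: "n < N" for n
  proof -
    have "(\<Sum>p<M. X $$ (n, p) * freq M l p) = (\<Sum>p<M. \<Sum>j<M. of_real (sqrt (c N n)) * (Z $$ (n, j) * (B $$ (j, p) * freq M l p)))"
      unfolding XD using n by (intro sum.cong refl) (simp add: mult_mat_entry[OF DZ B n] DZe sum_distrib_right mult.assoc)
    also have "\<dots> = of_real (sqrt (c N n)) * (\<Sum>j<M. Z $$ (n, j) * whitened_freq f M l j)"
      unfolding whitened_freq_def B_def[symmetric] sum_distrib_left by (rule sum.swap)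
    finally show ?thesis using c[OF n] by (simp add: norm_mult power_mult_distrib)
  qed
  have "Re (sform M (\<lambda>i j. S_mat X $$ (i, j)) (freq M l) (freq M l)) = (\<Sum>n<N. (cmod (\<Sum>p<M. X $$ (n, p) * freq M l p))\<^sup>2) / N"
    unfolding S_mat_form[OF X[folded X_def]] by simp
  also have "\<dots> = (\<Sum>n<N. c N n * (cmod (\<Sum>j<M. Z $$ (n, j) * whitened_freq f M l j))\<^sup>2) / N"
    by (simp add: row)
  finally show "Re (sform M (\<lambda>i j. S_mat (X_mat (C_mat c N) Z (R_mat f M)) $$ (i, j)) (freq M l) (freq M l)) =
      (\<Sum>n<N. c N n * (cmod (\<Sum>j<M. Z $$ (n, j) * whitened_freq f M l j))\<^sup>2) / N"
    unfolding X_def .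
qed

section \<open>Almost sure convergence\<close>

lemma integrable_torus_open:
  fixes f :: "real \<Rightarrow> real"
  assumes "f absolutely_integrable_on {-pi<..<pi}"
  shows "integrable torus f"
proof -
  have "f absolutely_integrable_on {-pi..pi}"
    by (rule absolutely_integrable_spike_set[OF assms]) (auto intro: negligible_subset[of "{-pi, pi}"])
  thus ?thesis by (simp add: set_integrable_def integrable_restrict_space)
qed

lemma essinf_pos_lower_bound:
  assumes "0 < essinf (lebesgue_on {-pi<..<pi}) (\<lambda>x. ereal (f x))"
  obtains m where "0 < m" "AE x in torus. m \<le> f x"
proof -
  define s where "s = esssup (lebesgue_on {-pi<..<pi}) (\<lambda>x. - ereal (f x))"
  have "s < 0" using assms unfolding essinf_def s_def[symmetric] by (simp add: ereal_less_uminus_reorder)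
  then obtain z where z: "s < ereal z" "ereal z < 0" using ereal_dense2[of s 0] by auto
  have "AE x in lebesgue_on {-pi<..<pi}. - ereal (f x) \<le> s" unfolding s_def by (rule esssup_AE)
  hence "AE x in lebesgue_on {-pi<..<pi}. - z \<le> f x"
  proof eventually_elim
    fix x assume "- ereal (f x) \<le> s"
    hence "- ereal (f x) \<le> ereal z" using z(1) by order
    thus "- z \<le> f x" by simp
  qed
  hence "AE x in lebesgue. x \<in> {-pi<..<pi} \<longrightarrow> - z \<le> f x" by (simp add: AE_restrict_space_iff)
  moreover have "AE x in lebesgue. x \<notin> {-pi, pi}"
    by (rule AE_not_in) (simp add: negligible_iff_null_sets[symmetric])
  ultimately have "AE x in lebesgue. x \<in> {-pi..pi} \<longrightarrow> - z \<le> f x" by eventually_elim auto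
  hence "AE x in torus. - z \<le> f x" by (simp add: AE_restrict_space_iff)
  moreover have "0 < - z" using z(2) by simp
  ultimately show ?thesis using that by blast
qed

lemma filterlim_size_at_top:
  assumes "filterlim (\<lambda>M. real (N M) / (ln (real M)) ^ 3) at_top sequentially"
  shows "filterlim N at_top sequentially"
  unfolding filterlim_at_top
proof
  fix Z :: nat
  have ln: "filterlim (\<lambda>M. ln (real M)) at_top sequentially"
    by (rule filterlim_compose[OF ln_at_top filterlim_real_sequentially])
  have "eventually (\<lambda>M. real Z \<le> real (N M) / (ln (real M)) ^ 3) sequentially"
    using assms unfolding filterlim_at_top by blast
  moreover have "eventually (\<lambda>M. 1 \<le> ln (real M)) sequentially"
    using ln unfolding filterlim_at_top by blast
  ultimately show "eventually (\<lambda>M. Z \<le> N M) sequentially"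
  proof eventually_elim
    fix M assume *: "real Z \<le> real (N M) / (ln (real M)) ^ 3" "1 \<le> ln (real M)"
    hence "1 \<le> ln (real M) ^ 3" by (simp add: one_le_power)
    hence "real (N M) / (ln (real M)) ^ 3 \<le> real (N M)" 
      using divide_left_mono[of 1 "ln (real M) ^ 3" "real (N M)"] *(2) by simp
    thus "Z \<le> N M" using * by linarith
  qed
qed

theorem proposition2p5:
  fixes P :: "'w measure"
    and N :: "nat \<Rightarrow> nat"
    and Z :: "nat \<Rightarrow> 'w \<Rightarrow> complex mat"
    and c :: "nat \<Rightarrow> nat \<Rightarrow> real"
    and f L :: "real \<Rightarrow> real"
    and a :: real
  assumes "prob_space P"
    and "\<And>M. M \<ge> 1 \<Longrightarrow> N M \<ge> 1"
    and "\<And>M. M \<ge> 1 \<Longrightarrow> iid_admissible_rows P (N M) M (Z M)"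
    and "\<And>n i. i < n \<Longrightarrow> c n i \<ge> 0"
    and "\<exists>C>0. \<forall>n\<ge>1. Re (mat_trace (C_mat c n * C_mat c n)) / real n \<le> C"
    and "\<exists>\<kappa>>0. \<forall>M\<ge>2. op_norm (C_mat c (N M)) \<le> \<kappa> * ln (real M)"
    and "f absolutely_integrable_on {-pi<..<pi}"
    and "\<And>x. x \<in> {-pi..pi} - {0} \<Longrightarrow> f x > 0"
    and "\<And>\<delta>. \<delta> > 0 \<Longrightarrow> bounded (f ` ({-pi..pi} - {-\<delta><..<\<delta>}))"
    and "essinf (lebesgue_on {-pi<..<pi}) (\<lambda>x. ereal (f x)) > 0"
    and "\<And>x. x \<in> {-pi..pi} \<Longrightarrow> f (- x) = f x"
    and "0 < a" and "a < 1"
    and "slowly_varying_on (1 / pi) L"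
    and "\<And>x. x \<in> {-pi..pi} - {0} \<Longrightarrow> f x = L (1 / \<bar>x\<bar>) / \<bar>x\<bar> powr a"
    and "(\<lambda>n. Re (mat_trace (C_mat c n)) / real n) \<longlonglongrightarrow> 1"
    and "filterlim (\<lambda>M. real (N M) / (ln (real M)) ^ 3) at_top sequentially"
  shows "AE \<omega> in P. weak_conv_m
           (\<lambda>M. esd (the (mat_inverse (R_mat f M)) *
                     Rhat_b (X_mat (C_mat c (N M)) (Z M \<omega>) (R_mat f M))))
           (return borel 1)"
proof -
  note P = assms(1) and N1 = assms(2) and iid = assms(3) and c0 = assms(4) and growth = assms(17)
  obtain C :: real where C: "0 < C" "\<And>n. 1 \<le> n \<Longrightarrow> (\<Sum>i<n. (c n i)\<^sup>2) \<le> C * n"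
  proof -
    obtain C :: real where "0 < C" "\<forall>n\<ge>1. Re (mat_trace (C_mat c n * C_mat c n)) / real n \<le> C"
      using assms(5) by blast
    thus ?thesis by (intro that[of C]) (auto simp: mat_trace_C_mat_square divide_le_eq)
  qed
  obtain \<kappa> :: real where \<kappa>: "0 < \<kappa>" "\<And>M i. 2 \<le> M \<Longrightarrow> i < N M \<Longrightarrow> c (N M) i \<le> \<kappa> * ln M"
  proof -
    obtain \<kappa> :: real where "0 < \<kappa>" and *: "\<forall>M\<ge>2. op_norm (C_mat c (N M)) \<le> \<kappa> * ln (real M)"
      using assms(6) by blast
    moreover have "c (N M) i \<le> \<kappa> * ln M" if "2 \<le> M" "i < N M" for M i
      using C_mat_entry_le_op_norm[OF c0 that(2)] * that(1) by fastforce
    ultimately show ?thesis by (intro that[of \<kappa>])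
  qed
  have f: "integrable torus f" by (rule integrable_torus_open[OF assms(7)])
  obtain m where m: "0 < m" and low: "AE x in torus. m \<le> f x" by (rule essinf_pos_lower_bound[OF assms(10)])
  have f0: "AE x in torus. 0 \<le> f x" using low by eventually_elim (use m in simp)
  define \<xi> where "\<xi> M = (\<Sum>i<N M. c (N M) i) / N M" for M
  have \<xi>: "\<xi> \<longlonglongrightarrow> 1"
    using filterlim_compose[OF assms(16) filterlim_size_at_top[OF growth]]
    by (simp add: \<xi>_def[abs_def] mat_trace_C_mat)
  define V where "V M \<omega> l = (\<Sum>i<N M. c (N M) i * (cmod (\<Sum>j<M. Z M \<omega> $$ (i, j) * whitened_freq f M l j))\<^sup>2) / N M" for M \<omega> l
  define q where "q M l = (\<Sum>j<M. (cmod (whitened_freq f M l j))\<^sup>2)" for M l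
  have "AE \<omega> in P. \<forall>k. eventually (\<lambda>M. \<forall>l<2*M. \<bar>V M \<omega> l - \<xi> M * q M l\<bar> \<le> 1 / real (Suc k) * q M l) sequentially"
    unfolding V_def \<xi>_def q_def AE_all_countable
    by (intro allI weighted_squares_uniform[OF P N1 iid c0 C \<kappa> growth]) auto
  thus ?thesis
  proof (elim AE_mp, intro AE_I2 impI)
    fix \<omega> assume \<omega>: "\<omega> \<in> space P"
      and H: "\<forall>k. eventually (\<lambda>M. \<forall>l<2*M. \<bar>V M \<omega> l - \<xi> M * q M l\<bar> \<le> 1 / real (Suc k) * q M l) sequentially"
    define X where "X M = X_mat (C_mat c (N M)) (Z M \<omega>) (R_mat f M)" for M
    define R where "R = (\<lambda>i j. fourier_coeff f (int i - int j))"
    define S where "S M = (\<lambda>i j. S_mat (X M) $$ (i, j))" for M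
    have Z: "Z M \<omega> \<in> carrier_mat (N M) M" if "0 < M" for M
      using iid[of M] that \<omega> by (simp add: iid_admissible_rows_def)
    have X: "X M \<in> carrier_mat (N M) M" if "0 < M" for M
      unfolding X_def by (rule X_mat_form(1)[OF c0 f f0 Z[OF that]])
    define Q where "Q M l \<longleftrightarrow> esd (the (mat_inverse (R_mat f M)) * Rhat_b (X M)) = distr (measure_pmf (pmf_of_set {..<M})) borel l \<and>
       (\<exists>v. (\<forall>i<M. \<forall>j<M. sform M R (v i) (v j) = (if i = j then 1 else 0)) \<and>
            (\<forall>i<M. sform M (toeplitz_avg M (S M)) (v i) (v i) = of_real (l i)))" for M and l :: "nat \<Rightarrow> real"
    have "\<exists>l. Q M l" if M: "0 < M" for M
    proof -
      obtain l v where "esd (the (mat_inverse (R_mat f M)) * Rhat_b (X M)) = distr (measure_pmf (pmf_of_set {..<M})) borel l"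
        "\<And>i j. i < M \<Longrightarrow> j < M \<Longrightarrow> sform M (\<lambda>i j. fourier_coeff f (int i - int j)) (v i) (v j) = (if i = j then 1 else 0)"
        "\<And>i. i < M \<Longrightarrow> sform M (toeplitz_avg M (\<lambda>p q. S_mat (X M) $$ (p, q))) (v i) (v i) = of_real (l i)"
        by (rule esd_whitened[OF f low m X[OF M] M]) blast+
      thus ?thesis unfolding Q_def R_def S_def by blast
    qed
    then obtain l where l: "\<And>M. 0 < M \<Longrightarrow> Q M (l M)" by metis
    have l_esd: "esd (the (mat_inverse (R_mat f M)) * Rhat_b (X M)) = distr (measure_pmf (pmf_of_set {..<M})) borel (l M)" if "0 < M" for M
      using l[OF that] unfolding Q_def by (rule conjunct1)
    have l_basis: "\<exists>v. (\<forall>i<M. \<forall>j<M. sform M R (v i) (v j) = (if i = j then 1 else 0)) \<and>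
            (\<forall>i<M. sform M (toeplitz_avg M (S M)) (v i) (v i) = of_real (l M i))" if "0 < M" for M
      using l[OF that] unfolding Q_def by (rule conjunct2)
    define r where "r = (\<integral>x. f x \<partial>torus) / (2 * pi)"
    define f1 where "f1 K = (\<lambda>x. max 0 (min (f x) (real K)))" for K :: nat
    define g where "g K = (\<integral>x. f x - f1 K x \<partial>torus) / (2 * pi)" for K
    define B where "B K M = (\<Sum>k<M. (cmod (fourier_coeff (f1 K) (int k)))\<^sup>2 * (k / M)\<^sup>2)" for K M :: nat
    have dev: "eventually (\<lambda>M. (\<Sum>i<M. \<bar>l M i - 1\<bar>) / M \<le>
        ((1 / real (Suc k) + \<bar>\<xi> M - 1\<bar>) * r + 2 * g K) / m + (\<epsilon> + 2 * B K M / \<epsilon>) / (2 * m)) sequentially"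
      if \<epsilon>: "0 < \<epsilon>" for \<epsilon> k K
      using H[rule_format, of k] eventually_gt_at_top[of 0]
    proof eventually_elim
      fix M assume *: "\<forall>l<2*M. \<bar>V M \<omega> l - \<xi> M * q M l\<bar> \<le> 1 / real (Suc k) * q M l" and M: "0 < M"
      obtain v where v: "(\<forall>i<M. \<forall>j<M. sform M R (v i) (v j) = (if i = j then 1 else 0)) \<and>
          (\<forall>i<M. sform M (toeplitz_avg M (S M)) (v i) (v i) = of_real (l M i))"
        using l_basis[OF M] ..
      have close: "\<bar>Re (sform M (S M) (freq M i) (freq M i)) - \<xi> M * Re (sform M R (freq M i) (freq M i))\<bar>
        \<le> 1 / real (Suc k) * Re (sform M R (freq M i) (freq M i))" if "i < 2 * M" for i
      proof -
        have 1: "Re (sform M (S M) (freq M i) (freq M i)) = V M \<omega> i"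
          unfolding S_def V_def X_def by (rule X_mat_form(2)[OF c0 f f0 Z[OF M]])
        have 2: "Re (sform M R (freq M i) (freq M i)) = q M i"
          unfolding R_def q_def by (rule whitened_freq_norm[OF f f0])
        show ?thesis unfolding 1 2 using * that by simp
      qed
      have "(\<Sum>i<M. \<bar>l M i - 1\<bar>) \<le> M / m * ((1 / real (Suc k) + \<bar>\<xi> M - 1\<bar>) * r + 2 * g K) + M / (2 * m) * (\<epsilon> + 2 * B K M / \<epsilon>)"
        unfolding r_def g_def B_def f1_def
        by (rule eigenvalue_deviation[OF f low m v[THEN conjunct1, rule_format, unfolded R_def] v[THEN conjunct2, rule_format] close[unfolded R_def] \<epsilon>]) auto
      hence "(\<Sum>i<M. \<bar>l M i - 1\<bar>) / M \<le> (M / m * ((1 / real (Suc k) + \<bar>\<xi> M - 1\<bar>) * r + 2 * g K) + M / (2 * m) * (\<epsilon> + 2 * B K M / \<epsilon>)) / M"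
        by (rule divide_right_mono) simp
      also have "\<dots> = ((1 / real (Suc k) + \<bar>\<xi> M - 1\<bar>) * r + 2 * g K) / m + (\<epsilon> + 2 * B K M / \<epsilon>) / (2 * m)"
        using M by (simp add: add_divide_distrib)
      finally show "(\<Sum>i<M. \<bar>l M i - 1\<bar>) / M \<le>
        ((1 / real (Suc k) + \<bar>\<xi> M - 1\<bar>) * r + 2 * g K) / m + (\<epsilon> + 2 * B K M / \<epsilon>) / (2 * m)" .
    qed
    have "(\<lambda>M. (\<Sum>i<M. \<bar>l M i - 1\<bar>) / M) \<longlonglongrightarrow> 0"
    proof (rule LIMSEQ_I)
      fix \<eta> :: real assume \<eta>: "0 < \<eta>"
      have fm [measurable]: "f \<in> borel_measurable torus" using f by auto
      have "(\<lambda>k. 1 / real (Suc k) * r / m) \<longlonglongrightarrow> 0 * r / m"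
        using LIMSEQ_Suc[OF lim_1_over_n] m by (intro tendsto_intros) auto
      hence "eventually (\<lambda>k. 1 / real (Suc k) * r / m < \<eta> / 5) sequentially"
        by (rule order_tendstoD) (use \<eta> in simp)
      then obtain k where k: "1 / real (Suc k) * r / m < \<eta> / 5" unfolding eventually_sequentially by blast
      have "(\<lambda>K. 2 * g K / m) \<longlonglongrightarrow> 2 * (0 / (2 * pi)) / m"
        unfolding g_def f1_def using truncation_integral_tendsto_0[OF f f0] m by (intro tendsto_intros) auto
      hence "eventually (\<lambda>K. 2 * g K / m < \<eta> / 5) sequentially"
        by (rule order_tendstoD) (use \<eta> in simp)
      then obtain K where K: "2 * g K / m < \<eta> / 5" unfolding eventually_sequentially by blast
      \<comment> \<open>The bound is a sum of five terms; this is the value that makes the fourth one \<open>\<eta> / 5\<close>.\<close>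
      define \<epsilon> where "\<epsilon> = 2 * m * \<eta> / 5"
      have \<epsilon>: "0 < \<epsilon>" "\<epsilon> / (2 * m) = \<eta> / 5" using m \<eta> by (auto simp: \<epsilon>_def)
      have "(\<lambda>M. \<bar>\<xi> M - 1\<bar> * r / m) \<longlonglongrightarrow> \<bar>1 - 1\<bar> * r / m"
        using \<xi> m by (intro tendsto_intros) auto
      hence e1: "eventually (\<lambda>M. \<bar>\<xi> M - 1\<bar> * r / m < \<eta> / 5) sequentially"
        by (rule order_tendstoD) (use \<eta> in simp)
      have "(\<Sum>k<n. (cmod (fourier_coeff (f1 K) (int k)))\<^sup>2) \<le> (real K)\<^sup>2" for n
        by (rule bounded_fourier_coeff_square_sum) (auto simp: f1_def)
      hence "B K \<longlonglongrightarrow> 0" unfolding B_def by (intro cesaro_square_sum_tendsto_0) auto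
      hence "(\<lambda>M. 2 * B K M / \<epsilon> / (2 * m)) \<longlonglongrightarrow> 2 * 0 / \<epsilon> / (2 * m)"
        using m \<epsilon> by (intro tendsto_intros) auto
      hence e2: "eventually (\<lambda>M. 2 * B K M / \<epsilon> / (2 * m) < \<eta> / 5) sequentially"
        by (rule order_tendstoD) (use \<eta> in simp)
      have "eventually (\<lambda>M. norm ((\<Sum>i<M. \<bar>l M i - 1\<bar>) / M - 0) < \<eta>) sequentially"
        using dev[OF \<epsilon>(1), of k K] e1 e2
      proof eventually_elim
        fix M
        assume 1: "(\<Sum>i<M. \<bar>l M i - 1\<bar>) / M \<le>
            ((1 / real (Suc k) + \<bar>\<xi> M - 1\<bar>) * r + 2 * g K) / m + (\<epsilon> + 2 * B K M / \<epsilon>) / (2 * m)"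
          and 2: "\<bar>\<xi> M - 1\<bar> * r / m < \<eta> / 5" and 3: "2 * B K M / \<epsilon> / (2 * m) < \<eta> / 5"
        have arith: "D < \<eta>" if "D \<le> x" "x = x1 + x2 + x3 + x4 + x5" "x1 < \<eta> / 5" "x2 < \<eta> / 5" "x3 < \<eta> / 5" "x4 = \<eta> / 5" "x5 < \<eta> / 5"
          for D x x1 x2 x3 x4 x5 using that by linarith
        have "((1 / real (Suc k) + \<bar>\<xi> M - 1\<bar>) * r + 2 * g K) / m + (\<epsilon> + 2 * B K M / \<epsilon>) / (2 * m) =
          1 / real (Suc k) * r / m + \<bar>\<xi> M - 1\<bar> * r / m + 2 * g K / m + \<epsilon> / (2 * m) + 2 * B K M / \<epsilon> / (2 * m)"
          unfolding add_divide_distrib distrib_right by simp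
        from arith[OF 1 this k 2 K \<epsilon>(2) 3] have "(\<Sum>i<M. \<bar>l M i - 1\<bar>) / M < \<eta>" .
        moreover have "0 \<le> (\<Sum>i<M. \<bar>l M i - 1\<bar>) / M" by (intro divide_nonneg_nonneg sum_nonneg) auto
        ultimately show "norm ((\<Sum>i<M. \<bar>l M i - 1\<bar>) / M - 0) < \<eta>" by simp
      qed
      thus "\<exists>M0. \<forall>M\<ge>M0. norm ((\<Sum>i<M. \<bar>l M i - 1\<bar>) / M - 0) < \<eta>" unfolding eventually_sequentially .
    qed
    thus "weak_conv_m (\<lambda>M. esd (the (mat_inverse (R_mat f M)) * Rhat_b (X_mat (C_mat c (N M)) (Z M \<omega>) (R_mat f M)))) (return borel 1)"
      unfolding X_def[symmetric] using l_esd by (rule weak_conv_esd_dirac)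
  qed
qed

end
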